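(* Let $\lambda$ be a partition. For every $\pi\in\mathcal A^{(\lambda)}\otimes\mathbb C[y]$ there exists a $\pi^\flat\in\overset{*}{\mathcal A}{}^{(\lambda)}$ such that $$\pi(\partial_z,y,z)\Psi^{(\lambda)}(x,y,z)=\pi^\flat(x,y,\partial_x)\Psi^{(\lambda)}(x,y,z).$$ The corresponding mapping $\mathcal A^{(\lambda)}\otimes\mathbb C[y]\to\overset{*}{\mathcal A}{}^{(\lambda)}$, $\pi\mapsto\pi^\flat$, is an algebra anti-isomorphism.
   Context: Partitions: $\lambda_1\ge\lambda_2\ge\cdots\ge0$ integers, $N=|\lambda|=\sum\lambda_i<\infty$, $\ell$ the number of nonzero entries, $m_i=\lambda_i-i$ ($i\ge1$), $\mathcal J^{(\lambda)}=\mathbb Z\setminus\{m_i:i\ge1\}$, $k_i=m_i+\ell$ for $1\le i\le\ell$. Bivariate Hermite polynomials: $e^{xz+yz^2}=\sum_{n\ge0}H_n(x,y)z^n/n!$. With $\mathrm{Wr}$ the Wronskian in $x$, $$R^{(\lambda)}_m=\frac{1}{\prod_{i=1}^{\ell}(m-m_i)}\,\frac{\mathrm{Wr}[H_{k_\ell},\dots,H_{k_1},H_{m+\ell}]}{\mathrm{Wr}[H_{k_\ell},\dots,H_{k_1}]}\ (m\in\mathcal J^{(\lambda)}),\qquad \Psi^{(\lambda)}(x,y,z)=\frac{\mathrm{Wr}[H_{k_\ell},\dots,H_{k_1},e^{xz+yz^2}]}{z^\ell\,\mathrm{Wr}[H_{k_\ell},\dots,H_{k_1}]}.$$ $\Psi^{(\lambda)}$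 is the semi-stationary wave function of $W^{(\lambda)}$. $W^{(\lambda)}=\mathrm{span}_{\mathbb C}\{z^m:m\in\mathcal J^{(\lambda)}\}$, and $\overset{*}{W}{}^{(\lambda)}$ is the $\mathbb C[y]$-span of $\{R^{(\lambda)}_m(x,y):m\in\mathcal J^{(\lambda)}\}$. When a derivative is substituted for a variable in a multivariable function, all derivatives are placed to the right of the other variables. $\mathcal A^{(\lambda)}$ is the algebra (under composition) of differential operators $\pi(\partial_z,z)$, $\pi(x,z)\in\mathbb C[x,z,z^{-1}]$, with $\pi(\partial_z,z)W^{(\lambda)}\subset W^{(\lambda)}$; elements of $\mathcal A^{(\lambda)}\otimes\mathbb C[y]$ are written $\pi(\partial_z,y,z)$. $\overset{*}{\mathcal A}{}^{(\lambda)}$ is the algebra of differential operators $\sigma(x,y,\partial_x)$ in $\partial_x$ (with coefficients rational in $x,y$) with $\sigma(x,y,\partial_x)\overset{*}{W}{}^{(\lambda)}\subset\overset{*}{W}{}^{(\lambda)}$. *)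

theory Defs
  imports
    "HOL-Computational_Algebra.Formal_Laurent_Series"
    "HOL-Computational_Algebra.Fraction_Field"
    "HOL-Algebra.QuotRing"
    "Jordan_Normal_Form.Determinant"
begin

section \<open>Rational functions in \<open>x\<close>, \<open>y\<close> and Laurent series over them\<close>

text \<open>The field \<open>\<complex>(x,y)\<close> is the fraction field of \<open>\<complex>[y][x]\<close>: the outer polynomial variable is \<open>x\<close>,
  the inner one is \<open>y\<close>.\<close>

type_synonym ratxy = "complex poly poly fract"

definition of_y :: "complex poly \<Rightarrow> ratxy" where
  "of_y p = Fract [:p:] 1"

definition of_C :: "complex \<Rightarrow> ratxy" where
  "of_C c = of_y [:c:]"

definition var_y :: ratxy where
  "var_y = of_y [:0, 1:]"

definition var_x :: ratxy where
  "var_x = Fract [:0, 1:] 1"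

definition dx :: "ratxy \<Rightarrow> ratxy" where
  "dx f = (THE g. \<forall>p q. q \<noteq> 0 \<longrightarrow> f = Fract p q \<longrightarrow>
                   g = Fract (pderiv p * q - p * pderiv q) (q * q))"

lemma dx_Fract:
  assumes "b \<noteq> 0"
  shows "dx (Fract a b) = Fract (pderiv a * b - a * pderiv b) (b * b)"
  unfolding dx_def
proof (rule the_equality)
  show "\<forall>p q. q \<noteq> 0 \<longrightarrow> Fract a b = Fract p q \<longrightarrow>
      Fract (pderiv a * b - a * pderiv b) (b * b) = Fract (pderiv p * q - p * pderiv q) (q * q)"
  proof (intro allI impI)
    fix c d assume d: "d \<noteq> 0" and "Fract a b = Fract c d"
    then have e: "a * d = c * b" using assms by (simp add: eq_fract)
    then have "pderiv (a * d) = pderiv (c * b)" by simp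
    then have e': "a * pderiv d + d * pderiv a = c * pderiv b + b * pderiv c"
      by (simp add: pderiv_mult)
    have "(pderiv a * b - a * pderiv b) * (d * d) - (pderiv c * d - c * pderiv d) * (b * b)
        = b * d * ((a * pderiv d + d * pderiv a) - (c * pderiv b + b * pderiv c))
          - (pderiv b * d + b * pderiv d) * (a * d - c * b)"
      by (simp add: algebra_simps)
    also have "\<dots> = 0" using e e' by simp
    finally show "Fract (pderiv a * b - a * pderiv b) (b * b)
        = Fract (pderiv c * d - c * pderiv d) (d * d)"
      using assms d by (simp add: eq_fract)
  qed
qed (use assms in blast)

text \<open>Laurent series in \<open>z\<close> with coefficients in \<open>\<complex>(x,y)\<close>. Both kinds of operators act on this space:
  operators in \<open>z\<close> directly, operators in \<open>x\<close> coefficientwise.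
  The functions (Laurent polynomial in \<open>z\<close> over \<open>\<complex>(x,y)\<close>) times \<open>exp (x z + y z^2)\<close> embed into it
  compatibly with all derivatives and with multiplication by \<open>x\<close>, \<open>y\<close>, \<open>z\<close>, \<open>1/z\<close>.\<close>

type_synonym lseries = "ratxy fls"

definition coeffwise :: "(ratxy \<Rightarrow> ratxy) \<Rightarrow> lseries \<Rightarrow> lseries" where
  "coeffwise \<sigma> F = Abs_fls (\<lambda>n. \<sigma> (fls_nth F n))"

definition scale_C :: "complex \<Rightarrow> lseries \<Rightarrow> lseries" where
  "scale_C c F = fls_const (of_C c) * F"


lemma of_y_simps: "of_y (p + q) = of_y p + of_y q" "of_y (p * q) = of_y p * of_y q" "of_y 1 = 1"
  by (simp_all add: of_y_def one_pCons[symmetric] One_fract_def mult.commute)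

lemma of_C_simps: "of_C (a + b) = of_C a + of_C b" "of_C (a * b) = of_C a * of_C b" "of_C 1 = 1"
  by (simp_all add: of_C_def mult.commute one_pCons flip: of_y_simps)

lemma module_scale_C: "Modules.module scale_C"
  by unfold_locales
     (simp_all add: scale_C_def of_C_simps algebra_simps fls_plus_const[symmetric]
        fls_const_mult_const[symmetric] del: fls_const_mult_const)

lemma module_of_y: "Modules.module (\<lambda>p g. of_y p * g)"
  by unfold_locales (simp_all add: of_y_simps algebra_simps)


section \<open>Hermite polynomials and Wronskians\<close>

definition exp_series :: "ratxy fps" where
  "exp_series = fps_exp 1 oo (fps_const var_x * fps_X + fps_const var_y * fps_X ^ 2)"

definition hermite :: "nat \<Rightarrow> ratxy" where
  "hermite n = of_nat (fact n) * fps_nth exp_series n"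

definition wronskian :: "('a::comm_ring_1 \<Rightarrow> 'a) \<Rightarrow> 'a list \<Rightarrow> 'a" where
  "wronskian D fs = det (mat (length fs) (length fs) (\<lambda>(i, j). (D ^^ i) (fs ! j)))"


section \<open>Partitions and the associated functions\<close>

text \<open>Parts are indexed from \<open>1\<close>; the value at \<open>0\<close> is never used.\<close>

definition is_partition :: "(nat \<Rightarrow> nat) \<Rightarrow> bool" where
  "is_partition lam \<longleftrightarrow> (\<forall>i\<ge>1. lam (Suc i) \<le> lam i) \<and> finite {i. 1 \<le> i \<and> lam i \<noteq> 0}"

definition plen :: "(nat \<Rightarrow> nat) \<Rightarrow> nat" where
  "plen lam = card {i. 1 \<le> i \<and> lam i \<noteq> 0}"

definition mseq :: "(nat \<Rightarrow> nat) \<Rightarrow> nat \<Rightarrow> int" where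
  "mseq lam i = int (lam i) - int i"

definition Jset :: "(nat \<Rightarrow> nat) \<Rightarrow> int set" where
  "Jset lam = UNIV - mseq lam ` {1..}"

text \<open>For \<open>1 \<le> i \<le> \<ell>\<close> and for \<open>m \<in> \<J>\<close> the integers converted by \<^const>\<open>nat\<close> in the next two
  definitions are nonnegative.\<close>

definition kseq :: "(nat \<Rightarrow> nat) \<Rightarrow> nat \<Rightarrow> nat" where
  "kseq lam i = nat (mseq lam i + int (plen lam))"

definition hermites :: "(nat \<Rightarrow> nat) \<Rightarrow> ratxy list" where
  "hermites lam = map (\<lambda>i. hermite (kseq lam i)) (rev [1..<Suc (plen lam)])"

definition Rfun :: "(nat \<Rightarrow> nat) \<Rightarrow> int \<Rightarrow> ratxy" where
  "Rfun lam m =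
     1 / (\<Prod>i = 1..plen lam. of_int (m - mseq lam i)) *
     (wronskian dx (hermites lam @ [hermite (nat (m + int (plen lam)))]) /
      wronskian dx (hermites lam))"

definition Psi :: "(nat \<Rightarrow> nat) \<Rightarrow> lseries" where
  "Psi lam =
     wronskian (coeffwise dx) (map fls_const (hermites lam) @ [fps_to_fls exp_series]) /
     (fls_X ^ plen lam * fls_const (wronskian dx (hermites lam)))"


section \<open>The spaces and operator algebras\<close>

text \<open>An operator is identified with the linear map it induces on \<open>\<complex>(x,y)\<close> (for \<open>D = d/dx\<close>) or on
  \<open>\<complex>(x,y)((z))\<close> (for \<open>D = d/dz\<close>), so the product is composition. No information is lost: in
  characteristic zero the coefficients \<open>a i\<close> are determined by this map.\<close>

definition diff_ops :: "('a::comm_ring_1 \<Rightarrow> 'a) \<Rightarrow> 'a set \<Rightarrow> ('a \<Rightarrow> 'a) set" where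
  "diff_ops D S = {(\<lambda>f. \<Sum>i\<le>n. a i * (D ^^ i) f) | n a. \<forall>i\<le>n. a i \<in> S}"

definition laurent_polys :: "lseries set" where
  "laurent_polys = Modules.module.span scale_C (range fls_X_intpow)"

definition W :: "(nat \<Rightarrow> nat) \<Rightarrow> lseries set" where
  "W lam = Modules.module.span scale_C (fls_X_intpow ` Jset lam)"

definition Wstar :: "(nat \<Rightarrow> nat) \<Rightarrow> ratxy set" where
  "Wstar lam = Modules.module.span (\<lambda>p g. of_y p * g) (Rfun lam ` Jset lam)"

definition A_alg :: "(nat \<Rightarrow> nat) \<Rightarrow> (lseries \<Rightarrow> lseries) set" where
  "A_alg lam = {P \<in> diff_ops fls_deriv laurent_polys. P ` W lam \<subseteq> W lam}"

text \<open>The tensor product of \<^term>\<open>A_alg lam\<close> with \<open>\<complex>[y]\<close>, as operators on Laurent series over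
  \<open>\<complex>(x,y)\<close>. The components \<open>P k\<close> have coefficients in \<open>\<complex>[z,1/z]\<close>, hence are determined by the sum.\<close>

definition A_alg_y :: "(nat \<Rightarrow> nat) \<Rightarrow> (lseries \<Rightarrow> lseries) set" where
  "A_alg_y lam = {(\<lambda>F. \<Sum>k\<le>n. fls_const (var_y ^ k) * P k F) | n P. \<forall>k\<le>n. P k \<in> A_alg lam}"

definition Astar_alg :: "(nat \<Rightarrow> nat) \<Rightarrow> (ratxy \<Rightarrow> ratxy) set" where
  "Astar_alg lam = {\<sigma> \<in> diff_ops dx UNIV. \<sigma> ` Wstar lam \<subseteq> Wstar lam}"


section \<open>Anti-isomorphisms of operator algebras\<close>

definition op_ring :: "('v::ab_group_add \<Rightarrow> 'v) set \<Rightarrow> ('v \<Rightarrow> 'v) ring" where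
  "op_ring A = \<lparr>carrier = A, mult = (\<lambda>P Q. P \<circ> Q), one = id,
                zero = (\<lambda>_. 0), add = (\<lambda>P Q v. P v + Q v)\<rparr>"

definition opposite :: "('a, 'b) ring_scheme \<Rightarrow> ('a, 'b) ring_scheme" where
  "opposite R = R\<lparr>mult := (\<lambda>a b. mult R b a)\<rparr>"

definition op_algebra :: "(complex \<Rightarrow> 'v::ab_group_add \<Rightarrow> 'v) \<Rightarrow> ('v \<Rightarrow> 'v) set \<Rightarrow> bool" where
  "op_algebra sc A \<longleftrightarrow> ring (op_ring A) \<and> (\<forall>c. \<forall>P\<in>A. (\<lambda>v. sc c (P v)) \<in> A)"

definition algebra_anti_iso ::
  "(complex \<Rightarrow> 'v::ab_group_add \<Rightarrow> 'v) \<Rightarrow> (complex \<Rightarrow> 'w::ab_group_add \<Rightarrow> 'w) \<Rightarrow>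
   ('v \<Rightarrow> 'v) set \<Rightarrow> ('w \<Rightarrow> 'w) set \<Rightarrow> (('v \<Rightarrow> 'v) \<Rightarrow> ('w \<Rightarrow> 'w)) \<Rightarrow> bool" where
  "algebra_anti_iso sv sw A B \<phi> \<longleftrightarrow>
     op_algebra sv A \<and> op_algebra sw B \<and>
     \<phi> \<in> ring_iso (op_ring A) (opposite (op_ring B)) \<and>
     (\<forall>c. \<forall>P\<in>A. \<phi> (\<lambda>v. sv c (P v)) = (\<lambda>w. sw c (\<phi> P w)))"

text \<open>The definite description is justified by the uniqueness part of the theorem.\<close>

definition flat :: "(nat \<Rightarrow> nat) \<Rightarrow> (lseries \<Rightarrow> lseries) \<Rightarrow> (ratxy \<Rightarrow> ratxy)" where
  "flat lam \<pi> = (THE \<sigma>. \<sigma> \<in> Astar_alg lam \<and> \<pi> (Psi lam) = coeffwise \<sigma> (Psi lam))"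

end

theory Submission
  imports Defs
begin

text \<open>Write \<open>l\<close> for the length of \<open>\<lambda>\<close>, \<open>\<tau>\<close> for the Wronskian of the Hermite polynomials attached to \<open>\<lambda>\<close>,
  \<open>T\<close> for the monic operator \<open>f \<mapsto> Wr[\<dots>, f] / \<tau>\<close> of order \<open>l\<close> and \<open>e = exp (x z + y z\<^sup>2)\<close>. Then
  \<open>\<Psi> = z\<^sup>-\<^sup>l T e = \<Sum> c\<^sub>m R\<^sub>m z\<^sup>m\<close> over \<open>m \<in> \<J>\<close> with nonzero constants \<open>c\<^sub>m\<close>, so an operator in \<open>z\<close>
  and an operator in \<open>x\<close> that agree on \<open>\<Psi>\<close> have transposed matrices with respect to \<open>z\<^sup>m\<close> and \<open>R\<^sub>m\<close>.

  Given \<open>\<pi>\<close>, one has \<open>z\<^sup>l\<^sup>+\<^sup>M \<pi> z\<^sup>-\<^sup>l e = \<rho> e\<close> for some operator \<open>\<rho>\<close> in \<open>x\<close>, and right division gives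
  \<open>T \<rho> = \<sigma> T \<partial>\<^sup>M + r\<close>. Because \<open>\<pi>\<close> preserves \<open>W\<close>, the remainder \<open>r\<close>, of order below \<open>l + M\<close>, kills
  \<open>l + M\<close> Hermite polynomials and vanishes, whence \<open>\<pi> \<Psi> = \<sigma> \<Psi>\<close>.

  Conversely, let \<open>\<sigma>\<close> preserve the span of the \<open>R\<^sub>m\<close>. Then \<open>\<tau> \<sigma> T\<close> has polynomial coefficients, and
  since \<open>\<tau>\<close> has a constant leading coefficient, left division by \<open>\<tau> T\<close> gives
  \<open>\<tau> \<sigma> T \<partial>\<^sup>M = \<tau> T \<rho> + s\<close> with the coefficients of \<open>s\<close> of smaller degree in \<open>x\<close> than \<open>\<tau>\<close>. Now \<open>s\<close>
  maps Hermite polynomials into \<open>\<tau>\<close> times the span of the \<open>R\<^sub>m\<close>, where only the degrees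
  \<open>deg \<tau> + m\<close> with \<open>m \<in> \<J>\<close> occur.

  Both remainders vanish for the same reason: with \<open>w\<close> the largest degree shift of the operator,
  the coefficient of \<open>x\<^sup>n\<^sup>+\<^sup>w\<close> in the image of a monic polynomial of degree \<open>n\<close> is a nonzero polynomial
  in \<open>n\<close>, and it would have more roots than its degree.\<close>

hide_const (open) Module.smult

text \<open>Characteristic zero passes to the fraction field, so that factors such as
  \<open>of_nat (Suc n)\<close> can be cancelled in \<open>ratxy\<close>.\<close>

instance fract :: ("{idom,ring_char_0}") field_char_0
proof
  have "of_nat n = Fract (of_nat n) (1::'a)" for n
    by (induction n) (simp_all add: Zero_fract_def One_fract_def)
  then show "inj (of_nat :: nat \<Rightarrow> 'a fract)"
    by (auto intro!: injI simp: eq_fract)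
qed

section \<open>Differential operators as polynomials\<close>

text \<open>The polynomial only stores the coefficients, so its degree is the order of the operator.
  Its ring product is in general not composition, which is described by \<open>dmul\<close>
  below.\<close>

definition dop :: "('a::comm_ring_1 \<Rightarrow> 'a) \<Rightarrow> 'a poly \<Rightarrow> 'a \<Rightarrow> 'a" where
  "dop D p f = (\<Sum>i\<le>degree p. coeff p i * (D ^^ i) f)"

lemma dop_bound: "degree p \<le> n \<Longrightarrow> dop D p f = (\<Sum>i\<le>n. coeff p i * (D ^^ i) f)"
  unfolding dop_def by (rule sum.mono_neutral_left) (auto simp: coeff_eq_0)

lemma dop_0 [simp]: "dop D 0 f = 0"
  by (simp add: dop_def)

lemma dop_add: "dop D (p + q) f = dop D p f + dop D q f"
proof -
  define n where "n = max (degree p) (degree q)"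
  have "degree (p + q) \<le> n" "degree p \<le> n" "degree q \<le> n"
    by (auto simp: n_def degree_add_le_max)
  then show ?thesis by (simp add: dop_bound sum.distrib algebra_simps)
qed

lemma dop_smult: "dop D (smult a p) f = a * dop D p f"
proof -
  have "dop D (smult a p) f = (\<Sum>i\<le>degree p. coeff (smult a p) i * (D ^^ i) f)"
    by (rule dop_bound) (rule degree_smult_le)
  then show ?thesis by (simp add: dop_def sum_distrib_left mult.assoc)
qed

lemma dop_minus: "dop D (- p) f = - dop D p f"
  using dop_smult[of D "-1" p f] by simp

lemma dop_diff: "dop D (p - q) f = dop D p f - dop D q f"
  using dop_add[of D p "- q" f] by (simp add: dop_minus)

lemma dop_sum: "dop D (\<Sum>i\<in>A. p i) f = (\<Sum>i\<in>A. dop D (p i) f)"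
  by (induction A rule: infinite_finite_induct) (simp_all add: dop_add)

lemma dop_monom: "dop D (monom a n) f = a * (D ^^ n) f"
proof -
  have "dop D (monom a n) f = (\<Sum>i\<le>n. coeff (monom a n) i * (D ^^ i) f)"
    by (rule dop_bound) (rule degree_monom_le)
  also have "\<dots> = (\<Sum>i\<in>{n}. coeff (monom a n) i * (D ^^ i) f)"
    by (rule sum.mono_neutral_right) auto
  finally show ?thesis by simp
qed

lemma dop_1 [simp]: "dop D 1 f = f"
  using dop_monom[of D 1 0 f] by (simp add: monom_0 one_pCons)

lemma dop_shift: "dop D (pCons 0 p) f = dop D p (D f)"
proof -
  have "dop D (pCons 0 p) f = (\<Sum>i\<le>Suc (degree p). coeff (pCons 0 p) i * (D ^^ i) f)"
    by (rule dop_bound) (simp add: degree_pCons_eq_if)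
  also have "\<dots> = (\<Sum>i\<le>degree p. coeff p i * (D ^^ Suc i) f)"
    by (subst sum.atMost_Suc_shift) (simp del: funpow.simps)
  finally show ?thesis by (simp add: dop_def funpow_Suc_right del: funpow.simps)
qed

text \<open>A polynomial has coefficients at all indices; \<open>0 \<in> S\<close> takes care of
  those beyond the order.\<close>

lemma diff_ops_iff:
  assumes "0 \<in> S"
  shows "P \<in> diff_ops D S \<longleftrightarrow> (\<exists>p. (\<forall>i. coeff p i \<in> S) \<and> P = dop D p)"
proof
  assume "P \<in> diff_ops D S"
  then obtain n a where P: "P = (\<lambda>f. \<Sum>i\<le>n. a i * (D ^^ i) f)" and a: "\<forall>i\<le>n. a i \<in> S"
    by (auto simp: diff_ops_def)
  define p where "p = (\<Sum>i\<le>n. monom (a i) i)"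
  have c: "coeff p j = (if j \<le> n then a j else 0)" for j
    by (simp add: p_def coeff_sum if_distrib sum.delta cong: if_cong)
  have "P = dop D p" by (rule ext) (simp add: P p_def dop_sum dop_monom)
  then show "\<exists>p. (\<forall>i. coeff p i \<in> S) \<and> P = dop D p" using a assms by (intro exI[of _ p]) (simp add: c)
next
  assume "\<exists>p. (\<forall>i. coeff p i \<in> S) \<and> P = dop D p"
  then obtain p where "\<forall>i. coeff p i \<in> S" "P = dop D p" by blast
  then show "P \<in> diff_ops D S"
    unfolding diff_ops_def by (auto simp: dop_def fun_eq_iff intro!: exI[of _ "degree p"] exI[of _ "coeff p"])
qed

section \<open>Composition and division of operators over a ring with a derivation\<close>

locale derivation =
  fixes D :: "'a::comm_ring_1 \<Rightarrow> 'a"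
  assumes D_add: "D (a + b) = D a + D b"
    and D_mult: "D (a * b) = D a * b + a * D b"
begin

lemma D_0 [simp]: "D 0 = 0"
  using D_add[of 0 0] by simp

lemma D_1 [simp]: "D 1 = 0"
  using D_mult[of 1 1] by simp

lemma D_sum: "D (\<Sum>i\<in>A. g i) = (\<Sum>i\<in>A. D (g i))"
  by (induction A rule: infinite_finite_induct) (simp_all add: D_add)

lemma funpow_add: "(D ^^ i) (a + b) = (D ^^ i) a + (D ^^ i) b"
  by (induction i) (simp_all add: D_add)

lemma funpow_const_mult: "D c = 0 \<Longrightarrow> (D ^^ i) (c * a) = c * (D ^^ i) a"
  by (induction i) (simp_all add: D_mult)

lemma dop_arg_add: "dop D p (f + g) = dop D p f + dop D p g"
  by (simp add: dop_def funpow_add sum.distrib algebra_simps)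

lemma dop_arg_const_mult: "D c = 0 \<Longrightarrow> dop D p (c * f) = c * dop D p f"
  by (simp add: dop_def funpow_const_mult sum_distrib_left algebra_simps)

lemma dop_arg_0 [simp]: "dop D p 0 = 0"
  using dop_arg_add[of p 0 0] by simp

lemma dop_arg_sum: "dop D p (\<Sum>i\<in>A. g i) = (\<Sum>i\<in>A. dop D p (g i))"
  by (induction A rule: infinite_finite_induct) (simp_all add: dop_arg_add)

text \<open>Composition with \<open>D\<close> on the left: by the Leibniz rule each term contributes
  its differentiated coefficient and a term of order one higher.\<close>

definition ddiff :: "'a poly \<Rightarrow> 'a poly" where
  "ddiff p = map_poly D p + pCons 0 p"

lemma coeff_ddiff: "coeff (ddiff p) i = D (coeff p i) + (case i of 0 \<Rightarrow> 0 | Suc j \<Rightarrow> coeff p j)"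
  by (simp add: ddiff_def coeff_map_poly coeff_pCons)

lemma D_dop: "D (dop D p f) = dop D (ddiff p) f"
proof -
  have "dop D (map_poly D p) f = (\<Sum>i\<le>degree p. D (coeff p i) * (D ^^ i) f)"
    by (subst dop_bound[of _ "degree p"]) (auto simp: coeff_map_poly coeff_eq_0 intro: degree_le)
  moreover have "dop D (pCons 0 p) f = (\<Sum>i\<le>degree p. coeff p i * D ((D ^^ i) f))"
    unfolding dop_shift by (simp add: dop_def funpow_swap1)
  ultimately show ?thesis
    by (simp add: ddiff_def dop_add) (simp add: dop_def D_sum D_mult sum.distrib)
qed

lemma degree_ddiff_le: "degree (ddiff p) \<le> Suc (degree p)"
  unfolding ddiff_def
  by (rule degree_add_le) (auto simp: degree_pCons_eq_if coeff_map_poly coeff_eq_0 intro!: degree_le)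

lemma funpow_dop: "(D ^^ n) (dop D p f) = dop D ((ddiff ^^ n) p) f"
  by (induction n) (simp_all add: D_dop)

text \<open>The product of operators: \<open>i\<close> applications of \<open>D\<close> after
  \<open>q\<close> amount to \<open>ddiff\<close> iterated \<open>i\<close> times.\<close>

definition dmul :: "'a poly \<Rightarrow> 'a poly \<Rightarrow> 'a poly" where
  "dmul p q = (\<Sum>i\<le>degree p. smult (coeff p i) ((ddiff ^^ i) q))"

lemma dop_dmul: "dop D (dmul p q) f = dop D p (dop D q f)"
  by (simp add: dmul_def dop_sum dop_smult flip: funpow_dop) (simp add: dop_def)

text \<open>The coefficients of a composition arise from those of the factors by sums, products and
  derivatives. With \<open>S\<close> the Laurent polynomials this closes the operators in z under
  composition.\<close>

lemma coeff_dmul_closed: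
  assumes S: "0 \<in> S" "\<And>a b. a \<in> S \<Longrightarrow> b \<in> S \<Longrightarrow> a + b \<in> S" "\<And>a b. a \<in> S \<Longrightarrow> b \<in> S \<Longrightarrow> a * b \<in> S"
      "\<And>a. a \<in> S \<Longrightarrow> D a \<in> S"
    and p: "\<And>i. coeff p i \<in> S" and q: "\<And>i. coeff q i \<in> S"
  shows "coeff (dmul p q) j \<in> S"
proof -
  have *: "coeff ((ddiff ^^ i) q) j \<in> S" for i j
    by (induction i arbitrary: j) (auto simp: q coeff_ddiff S split: nat.split)
  have sumS: "(\<Sum>i\<in>A. g i) \<in> S" if "\<And>i. g i \<in> S" for A :: "nat set" and g
    by (induction A rule: infinite_finite_induct) (auto simp: S that)
  show ?thesis unfolding dmul_def coeff_sum coeff_smult by (rule sumS) (intro S p *)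
qed

lemma ddiff_funpow_top:
  assumes "degree q \<le> d"
  shows "degree ((ddiff ^^ n) q) \<le> d + n" "coeff ((ddiff ^^ n) q) (d + n) = coeff q d"
proof -
  have d: "degree ((ddiff ^^ n) q) \<le> d + n" for n
    by (induction n) (use assms degree_ddiff_le le_trans in \<open>auto intro: le_trans[OF degree_ddiff_le]\<close>)
  then show "degree ((ddiff ^^ n) q) \<le> d + n" .
  show "coeff ((ddiff ^^ n) q) (d + n) = coeff q d"
  proof (induction n)
    case (Suc n)
    have "coeff ((ddiff ^^ n) q) (Suc (d + n)) = 0" using d[of n] by (intro coeff_eq_0) simp
    then show ?case using Suc by (simp add: coeff_ddiff)
  qed simp
qed

text \<open>Applying \<open>D\<close> raises the order by one and keeps the leading coefficient, so
  only the top term of \<open>p\<close> reaches this index. In particular a nonzero operator stays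
  nonzero after composition with a monic one.\<close>

lemma coeff_dmul_top:
  assumes "degree q \<le> d"
  shows "coeff (dmul p q) (degree p + d) = lead_coeff p * coeff q d"
proof -
  have z: "coeff ((ddiff ^^ i) q) (degree p + d) = 0" if "i < degree p" for i
    using ddiff_funpow_top(1)[OF assms, of i] that by (intro coeff_eq_0) linarith
  have "coeff (dmul p q) (degree p + d) = (\<Sum>i\<le>degree p. coeff p i * coeff ((ddiff ^^ i) q) (degree p + d))"
    by (simp add: dmul_def coeff_sum)
  also have "\<dots> = (\<Sum>i\<in>{degree p}. coeff p i * coeff ((ddiff ^^ i) q) (degree p + d))"
    by (rule sum.mono_neutral_right) (auto simp: z)
  finally show ?thesis using ddiff_funpow_top(2)[OF assms, of "degree p"] by (simp add: add.commute)
qed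

text \<open>Euclidean division: subtracting a multiple of \<open>D\<close> to the power
  \<open>n\<close> after \<open>q\<close> removes the top term, and the order falls because
  \<open>q\<close> is monic. Positivity of \<open>d\<close> leaves room for the remainder 0, whose
  degree counts as 0.\<close>

lemma right_division:
  assumes q: "degree q = d" "coeff q d = 1" "d > 0"
  shows "\<exists>s r. degree r < d \<and> (\<forall>f. dop D p f = dop D s (dop D q f) + dop D r f)"
proof (induction "degree p" arbitrary: p rule: less_induct)
  case less
  show ?case
  proof (cases "degree p < d")
    case True
    then show ?thesis by (intro exI[of _ 0] exI[of _ p]) simp
  next
    case False
    define n where "n = degree p - d"
    define p' where "p' = p - smult (lead_coeff p) ((ddiff ^^ n) q)"
    have n: "degree p = d + n" using False by (simp add: n_def)
    have "degree p' \<le> d + n" unfolding p'_def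
      by (rule degree_diff_le) (use n ddiff_funpow_top(1)[of q d n] q in
        \<open>auto intro: order.trans[OF degree_smult_le]\<close>)
    moreover have "coeff p' (d + n) = 0"
      using ddiff_funpow_top(2)[of q d n] q n by (simp add: p'_def)
    ultimately have "degree p' < degree p"
      using n q(3) by (metis add_gr_0 eq_zero_or_degree_less degree_0)
    from less[OF this] obtain s r where sr: "degree r < d"
      "\<And>f. dop D p' f = dop D s (dop D q f) + dop D r f" by blast
    have "dop D p f = dop D (s + monom (lead_coeff p) n) (dop D q f) + dop D r f" for f
    proof -
      have "p = p' + smult (lead_coeff p) ((ddiff ^^ n) q)" by (simp add: p'_def)
      then have "dop D p f = dop D p' f + lead_coeff p * dop D ((ddiff ^^ n) q) f"
        by (metis dop_add dop_smult)
      then show ?thesis by (simp add: sr dop_add dop_monom funpow_dop)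
    qed
    then show ?thesis using sr(1) by blast
  qed
qed

text \<open>If the coefficients of the right factor are constants, nothing is differentiated and
  composition is the commutative product of polynomials. This serves for powers of \<open>D\<close>
  and, in the left division, for coefficients free of x.\<close>

lemma dop_mult_const_coeffs:
  assumes "\<And>i. D (coeff g i) = 0"
  shows "dop D (p * g) f = dop D p (dop D g f)"
proof (induction p arbitrary: f)
  case 0
  then show ?case by simp
next
  case (pCons a p)
  have comm: "dop D g (D f) = D (dop D g f)" for f
  proof -
    have "map_poly D g = 0" by (rule poly_eqI) (simp add: coeff_map_poly assms)
    then show ?thesis by (simp add: D_dop ddiff_def dop_shift)
  qed
  have split: "dop D (pCons a q) h = a * h + dop D q (D h)" for q h
    using dop_add[of D "[:a:]" "pCons 0 q" h] dop_monom[of D a 0 h] by (simp add: dop_shift monom_0)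
  have "dop D (pCons a p * g) f = a * dop D g f + dop D (p * g) (D f)"
    by (simp add: dop_add dop_smult dop_shift)
  also have "\<dots> = dop D (pCons a p) (dop D g f)"
    by (simp add: pCons split comm)
  finally show ?case .
qed

end

section \<open>Falling factorials\<close>

definition fall :: "'a::comm_ring_1 \<Rightarrow> nat \<Rightarrow> 'a" where
  "fall x i = (\<Prod>j<i. x - of_nat j)"

text \<open>Falling factorials are monic of pairwise distinct degrees, hence independent, and a
  nonzero combination of degree at most \<open>d\<close> cannot have more than \<open>d\<close>
  roots. All later vanishing arguments end here.\<close>

lemma fall_combination_zero:
  fixes c :: "nat \<Rightarrow> 'a::{idom,ring_char_0}"
  assumes A: "d < card A" and z: "\<And>n. n \<in> A \<Longrightarrow> (\<Sum>i\<le>d. c i * fall (of_nat n) i) = 0"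
    and i: "i \<le> d"
  shows "c i = 0"
proof -
  define b :: "nat \<Rightarrow> 'a poly" where "b i = (\<Prod>j<i. [:- of_nat j, 1:])" for i
  have deg_b: "degree (b i) = i" for i
    by (simp add: b_def degree_prod_eq_sum_degree)
  have b: "lead_coeff (b i) = 1" "degree (b i) = i" for i
    by (fact deg_b | simp add: b_def lead_coeff_prod del: One_nat_def)+
  have pb: "poly (b i) x = fall x i" for i x
    by (simp add: b_def fall_def poly_prod)
  have zero: "(\<Sum>i\<le>d. smult (c i) (b i)) = 0 \<Longrightarrow> i \<le> d \<Longrightarrow> c i = 0" for d i
  proof (induction d arbitrary: i)
    case 0
    then show ?case by (simp add: b_def)
  next
    case (Suc d)
    have "coeff (\<Sum>i\<le>d. smult (c i) (b i)) (Suc d) = 0"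
      by (simp add: coeff_sum coeff_eq_0 b(2))
    moreover have "coeff (b (Suc d)) (Suc d) = 1" using b[of "Suc d"] by simp
    ultimately have "coeff (\<Sum>i\<le>Suc d. smult (c i) (b i)) (Suc d) = c (Suc d)" by simp
    then have cd: "c (Suc d) = 0" unfolding Suc.prems(1) by simp
    then show ?case using Suc.IH[of i] Suc.prems by (cases "i = Suc d") auto
  qed
  define P where "P = (\<Sum>i\<le>d. smult (c i) (b i))"
  have "P = 0"
  proof (rule ccontr)
    assume "P \<noteq> 0"
    have "of_nat ` A \<subseteq> {x. poly P x = 0}" using z by (auto simp: P_def poly_sum pb)
    then have "card ((of_nat :: nat \<Rightarrow> 'a) ` A) \<le> card {x. poly P x = 0}"
      using \<open>P \<noteq> 0\<close> by (intro card_mono) (simp_all add: poly_roots_finite)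
    also have "\<dots> \<le> degree P" by (rule card_poly_roots_bound) fact
    also have "\<dots> \<le> d" unfolding P_def
      by (rule degree_sum_le) (auto intro: order.trans[OF degree_smult_le] simp: b(2))
    finally show False using A by (simp add: card_image inj_on_def)
  qed
  then show ?thesis using zero i unfolding P_def by blast
qed

lemma fall_eq_0: "n < i \<Longrightarrow> fall (of_nat n :: 'a::comm_ring_1) i = 0"
  by (auto simp: fall_def intro!: prod_zero)

lemma coeff_funpow_pderiv:
  "coeff ((pderiv ^^ j) f) i = fall (of_nat (i + j)) j * coeff f (i + j)"
  for f :: "'a::{idom,ring_char_0} poly"
proof (induction j arbitrary: i)
  case 0
  then show ?case by (simp add: fall_def)
next
  case (Suc j)
  have "fall (of_nat (Suc i + j)) (Suc j) = (of_nat (Suc i) :: 'a) * fall (of_nat (Suc i + j)) j"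
    by (simp add: fall_def)
  then show ?case using Suc[of "Suc i"] by (simp add: coeff_pderiv mult.assoc)
qed

section \<open>Leading behaviour of operators with polynomial coefficients\<close>

lemma coeff_mult_degree_bound:
  fixes p q :: "'a::comm_semiring_1 poly"
  assumes "degree p \<le> a" "degree q \<le> b"
  shows "coeff (p * q) (a + b) = coeff p a * coeff q b"
proof (cases "degree p = a \<and> degree q = b")
  case True
  then show ?thesis using coeff_mult_degree_sum[of p q] by simp
next
  case False
  then have "degree p + degree q < a + b" using assms by linarith
  then have "coeff (p * q) (a + b) = 0"
    using degree_mult_le[of p q] by (intro coeff_eq_0) linarith
  moreover have "coeff p a = 0 \<or> coeff q b = 0" using False assms by (metis coeff_eq_0 le_neq_implies_less)
  ultimately show ?thesis by auto
qed

interpretation pderiv: derivation "pderiv :: 'a::{idom} poly \<Rightarrow> 'a poly"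
  by unfold_locales (simp_all add: pderiv_add pderiv_mult algebra_simps)

text \<open>The weight \<open>w\<close> is the largest degree shift \<open>deg p\<^sub>j - j\<close>; the operator sends a polynomial of
  degree \<open>n\<close> to degree at most \<open>n + w\<close>, with top coefficient a polynomial in \<open>n\<close>.\<close>

lemma operator_weight:
  fixes p :: "'a::{idom,ring_char_0} poly poly"
  assumes "p \<noteq> 0"
  obtains w c where "\<exists>j\<le>degree p. c j \<noteq> 0"
    and "\<And>j. c j \<noteq> 0 \<Longrightarrow> int (degree (coeff p j)) = int j + w \<and> c j = lead_coeff (coeff p j)"
    and "\<And>j. coeff p j \<noteq> 0 \<Longrightarrow> int (degree (coeff p j)) \<le> int j + w"
    and "\<And>j. coeff p j \<noteq> 0 \<Longrightarrow> int (degree (coeff p j)) = int j + w \<Longrightarrow> c j \<noteq> 0"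
    and "\<And>f n k. degree f \<le> n \<Longrightarrow> int k > int n + w \<Longrightarrow> coeff (dop pderiv p f) k = 0"
    and "\<And>f n k. degree f \<le> n \<Longrightarrow> int k = int n + w \<Longrightarrow>
           coeff (dop pderiv p f) k = coeff f n * (\<Sum>j\<le>degree p. c j * fall (of_nat n) j)"
    and "\<And>n. int n + w < 0 \<Longrightarrow> (\<Sum>j\<le>degree p. c j * fall (of_nat n) j) = 0"
proof -
  define I where "I = {j. j \<le> degree p \<and> coeff p j \<noteq> 0}"
  have I: "finite I" "I \<noteq> {}" using assms by (auto simp: I_def intro!: exI[of _ "degree p"])
  have Iiff: "j \<in> I \<longleftrightarrow> coeff p j \<noteq> 0" for j by (auto simp: I_def le_degree)
  define w where "w = Max ((\<lambda>j. int (degree (coeff p j)) - int j) ` I)"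
  have w_le: "int (degree (coeff p j)) \<le> int j + w" if "j \<in> I" for j
  proof -
    have "int (degree (coeff p j)) - int j \<le> w" unfolding w_def using I that by (intro Max_ge) auto
    then show ?thesis by simp
  qed
  have "w \<in> (\<lambda>j. int (degree (coeff p j)) - int j) ` I" unfolding w_def
    using I by (intro Max_in) auto
  then obtain j0 where j0: "j0 \<in> I" "int (degree (coeff p j0)) = int j0 + w" by auto
  \<comment> \<open>\<open>c\<close> keeps the leading coefficients of exactly those terms that
    attain the largest shift; only they contribute to the top degree of the image.\<close>
  define c where "c j = (if j \<in> I \<and> int (degree (coeff p j)) = int j + w then lead_coeff (coeff p j) else 0)" for j
  have deriv_deg: "(pderiv ^^ j) f = 0 \<or> (j \<le> n \<and> degree ((pderiv ^^ j) f) \<le> n - j)"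
    if "degree f \<le> n" for f :: "'a poly" and j n
  proof (cases "j \<le> n")
    case True
    then show ?thesis using that by (simp add: degree_higher_pderiv diff_le_mono)
  next
    case False
    then have "(pderiv ^^ j) f = 0" using that
      by (intro poly_eqI) (simp add: coeff_funpow_pderiv coeff_eq_0)
    then show ?thesis by simp
  qed
  show ?thesis
  proof (rule that[of c w])
    show "\<exists>j\<le>degree p. c j \<noteq> 0" using j0 by (auto simp: c_def I_def)
    show "int (degree (coeff p j)) = int j + w \<and> c j = lead_coeff (coeff p j)" if "c j \<noteq> 0" for j
      using that by (auto simp: c_def split: if_splits)
    show "int (degree (coeff p j)) \<le> int j + w" if "coeff p j \<noteq> 0" for j
      using w_le that Iiff by blast
    show "c j \<noteq> 0" if "coeff p j \<noteq> 0" "int (degree (coeff p j)) = int j + w" for j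
      using that by (simp add: c_def Iiff)
    have hi: "coeff (coeff p j * (pderiv ^^ j) f) k = 0"
      if "degree f \<le> n" "int k > int n + w" for f n j k
    proof (cases "coeff p j = 0 \<or> (pderiv ^^ j) f = 0")
      case False
      then have "int (degree (coeff p j)) \<le> int j + w" "j \<le> n" "degree ((pderiv ^^ j) f) \<le> n - j"
        using w_le Iiff deriv_deg[OF that(1)] by blast+
      then have "degree (coeff p j) + degree ((pderiv ^^ j) f) < k" using that by linarith
      then show ?thesis using degree_mult_le[of "coeff p j" "(pderiv ^^ j) f"]
        by (intro coeff_eq_0) linarith
    qed auto
    show "coeff (dop pderiv p f) k = 0" if "degree f \<le> n" "int k > int n + w" for f n k
      unfolding dop_def coeff_sum using hi[OF that] by simp
    have top: "coeff (coeff p j * (pderiv ^^ j) f) k = coeff f n * (c j * fall (of_nat n) j)"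
      if "degree f \<le> n" "int k = int n + w" for f n j k
    proof (cases "coeff p j = 0 \<or> n < j")
      case True
      then show ?thesis
      proof
        assume "n < j"
        then have "(pderiv ^^ j) f = 0" using deriv_deg[OF that(1), of j] by auto
        then show ?thesis using fall_eq_0[OF \<open>n < j\<close>, where 'a='a] by simp
      qed (simp add: c_def Iiff)
    next
      case False
      then have le: "int (degree (coeff p j)) \<le> int j + w" using w_le Iiff by blast
      define a where "a = nat (int j + w)"
      have a: "int a = int j + w" using le by (simp add: a_def)
      have k: "k = a + (n - j)" using that a False by linarith
      have dj: "degree ((pderiv ^^ j) f) \<le> n - j" using deriv_deg[OF that(1), of j] by auto
      have "degree (coeff p j) \<le> a" using le a by linarith
      then have "coeff (coeff p j * (pderiv ^^ j) f) k = coeff (coeff p j) a * coeff ((pderiv ^^ j) f) (n - j)"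
        unfolding k using dj by (rule coeff_mult_degree_bound)
      also have "coeff ((pderiv ^^ j) f) (n - j) = fall (of_nat n) j * coeff f n"
        using False by (simp add: coeff_funpow_pderiv)
      also have "coeff (coeff p j) a = c j"
      proof (cases "degree (coeff p j) = a")
        case True
        then show ?thesis using a False by (simp add: c_def Iiff)
      next
        case ne: False
        then have "degree (coeff p j) < a" using le a by linarith
        then show ?thesis using a by (simp add: c_def coeff_eq_0)
      qed
      finally show ?thesis by (simp add: algebra_simps)
    qed
    show "coeff (dop pderiv p f) k = coeff f n * (\<Sum>j\<le>degree p. c j * fall (of_nat n) j)"
      if "degree f \<le> n" "int k = int n + w" for f n k
      unfolding dop_def coeff_sum using top[OF that] by (simp add: sum_distrib_left)
    show "(\<Sum>j\<le>degree p. c j * fall (of_nat n) j) = 0" if "int n + w < 0" for n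
    proof (rule sum.neutral, rule ballI)
      fix j
      show "c j * fall (of_nat n) j = 0"
      proof (cases "c j = 0")
        case False
        then have "int (degree (coeff p j)) = int j + w" by (auto simp: c_def split: if_splits)
        \<comment> \<open>A degree is nonnegative, so \<open>j + w \<ge> 0 > n + w\<close>.\<close>
        then have "n < j" using that by linarith
        then show ?thesis by (simp add: fall_eq_0)
      qed simp
    qed
  qed
qed

text \<open>Every \<open>n\<close> in \<open>A\<close> is a root of the symbol: for
  \<open>n + w \<ge> 0\<close> it appears as a coefficient of the image 0, and for
  \<open>n + w < 0\<close> it vanishes by itself. That is more roots than its degree allows.\<close>

lemma operator_few_zeros:
  fixes p :: "'a::{idom,ring_char_0} poly poly"
  assumes deg: "degree p < card A"
    and z: "\<And>n. n \<in> A \<Longrightarrow> \<exists>f. degree f = n \<and> f \<noteq> 0 \<and> dop pderiv p f = 0"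
  shows "p = 0"
proof (rule ccontr)
  assume "p \<noteq> 0"
  then obtain w c where wc: "\<exists>j\<le>degree p. c j \<noteq> 0"
    "\<And>f n k. degree f \<le> n \<Longrightarrow> int k = int n + w \<Longrightarrow>
           coeff (dop pderiv p f) k = coeff f n * (\<Sum>j\<le>degree p. c j * fall (of_nat n) j)"
    "\<And>n. int n + w < 0 \<Longrightarrow> (\<Sum>j\<le>degree p. c j * fall (of_nat n) j) = 0"
    by (rule operator_weight) blast
  have "(\<Sum>j\<le>degree p. c j * fall (of_nat n) j) = 0" if n: "n \<in> A" for n
  proof (cases "int n + w < 0")
    case False
    obtain f where f: "degree f = n" "f \<noteq> 0" "dop pderiv p f = 0" using z[OF n] by blast
    have "coeff (dop pderiv p f) (nat (int n + w)) = coeff f n * (\<Sum>j\<le>degree p. c j * fall (of_nat n) j)"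
      by (rule wc(2)) (use f False in auto)
    then show ?thesis using f by auto
  qed (rule wc(3))
  then show False using fall_combination_zero[OF deg, of c] wc(1) by blast
qed

section \<open>The field of rational functions\<close>

lemma dx_to_fract: "dx (to_fract p) = to_fract (pderiv p)"
  by (simp add: to_fract_def dx_Fract)

interpretation dx: derivation dx
proof
  fix f g :: ratxy
  obtain a b where f: "f = Fract a b" "b \<noteq> 0" by (cases f) auto
  obtain c d where g: "g = Fract c d" "d \<noteq> 0" by (cases g) auto
  show "dx (f + g) = dx f + dx g" "dx (f * g) = dx f * g + f * dx g"
    using f(2) g(2) unfolding f(1) g(1)
    by (simp_all add: dx_Fract eq_fract pderiv_add pderiv_mult) (simp_all add: algebra_simps)
qed

lemma of_y_to_fract: "of_y p = to_fract [:p:]"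
  by (simp add: of_y_def to_fract_def)

lemma of_C_to_fract: "of_C c = to_fract [:[:c:]:]"
  by (simp add: of_C_def of_y_to_fract)

lemma var_x_to_fract: "var_x = to_fract [:0, 1:]"
  by (simp add: var_x_def to_fract_def)

lemma dx_of_y [simp]: "dx (of_y p) = 0"
  by (simp add: of_y_to_fract dx_to_fract pderiv_pCons)

lemma dx_of_C [simp]: "dx (of_C c) = 0"
  by (simp add: of_C_def)

lemma dx_var_y [simp]: "dx var_y = 0"
  by (simp add: var_y_def)

lemma dx_var_x [simp]: "dx var_x = 1"
  by (simp add: var_x_to_fract dx_to_fract pderiv_pCons flip: one_pCons)

lemma dx_of_nat [simp]: "dx (of_nat n) = 0"
  by (induction n) (simp_all add: dx.D_add)

lemma to_fract_of_nat: "to_fract (of_nat n) = of_nat n"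
  by (induction n) simp_all

lemma funpow_dx_to_fract: "(dx ^^ i) (to_fract f) = to_fract ((pderiv ^^ i) f)"
  by (induction i) (simp_all add: dx_to_fract)

lemma dop_to_fract: "dop dx (map_poly to_fract p) (to_fract f) = to_fract (dop pderiv p f)"
  for p :: "complex poly poly poly"
proof -
  have "dop dx (map_poly to_fract p) (to_fract f) =
      (\<Sum>i\<le>degree p. coeff (map_poly to_fract p) i * (dx ^^ i) (to_fract f))"
    by (rule dop_bound) (simp add: degree_map_poly)
  then show ?thesis
    by (simp add: coeff_map_poly funpow_dx_to_fract dop_def to_fract_sum)
qed

text \<open>The values on 1, x, x^2, ... determine the coefficients one after the other, since the
  \<open>j\<close>-th derivative of \<open>x^i\<close> is 0 for \<open>j > i\<close> and the unit
  \<open>i!\<close> for \<open>j = i\<close>. The choice \<open>V = {0}\<close> gives faithfulness,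
  and \<open>V = range to_fract\<close> gives polynomial coefficients.\<close>

lemma dop_coeffs_in:
  fixes p :: "ratxy poly"
  assumes V: "0 \<in> V" "\<And>a b. a \<in> V \<Longrightarrow> b \<in> V \<Longrightarrow> a - b \<in> V" "\<And>a f. a \<in> V \<Longrightarrow> a * to_fract f \<in> V"
    and p: "\<And>f. dop dx p (to_fract f) \<in> V"
  shows "coeff p i \<in> V"
proof (induction i rule: less_induct)
  case (less i)
  define x where "x = (monom 1 i :: complex poly poly)"
  have hi: "(pderiv ^^ j) x = 0" if "i < j" for j
    using that by (intro poly_eqI) (simp add: coeff_funpow_pderiv x_def)
  have "(pderiv ^^ i) x = [:fact i:]"
  proof (rule poly_eqI)
    fix k
    have "fall (of_nat i) i = (fact i :: complex poly)"
      by (simp add: fall_def fact_prod_rev atLeast0LessThan cong: prod.cong) (simp add: of_nat_diff)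
    then show "coeff ((pderiv ^^ i) x) k = coeff [:fact i:] k"
      by (cases k) (auto simp: coeff_funpow_pderiv x_def)
  qed
  then have xi: "(dx ^^ i) (to_fract x) = to_fract [:fact i:]"
    by (simp add: funpow_dx_to_fract)
  define n where "n = max i (degree p)"
  have "dop dx p (to_fract x) = (\<Sum>j\<le>n. coeff p j * (dx ^^ j) (to_fract x))"
    by (rule dop_bound) (simp add: n_def)
  also have "\<dots> = (\<Sum>j\<le>i. coeff p j * (dx ^^ j) (to_fract x))"
    by (rule sum.mono_neutral_right) (auto simp: n_def hi funpow_dx_to_fract)
  also have "\<dots> = (\<Sum>j<i. coeff p j * (dx ^^ j) (to_fract x)) + coeff p i * to_fract [:fact i:]"
    by (simp add: xi flip: lessThan_Suc_atMost)
  finally have e: "coeff p i * to_fract [:fact i:] =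
      dop dx p (to_fract x) - (\<Sum>j<i. coeff p j * (dx ^^ j) (to_fract x))" by simp
  have sumV: "(\<Sum>j\<in>A. g j) \<in> V" if "finite A" "\<And>j. j \<in> A \<Longrightarrow> g j \<in> V" for A :: "nat set" and g
    using that
  proof (induction A rule: finite_induct)
    case (insert a A)
    then have "g a - (0 - (\<Sum>j\<in>A. g j)) \<in> V" using V by blast
    then show ?case using insert by simp
  qed (simp add: V)
  have "(\<Sum>j<i. coeff p j * (dx ^^ j) (to_fract x)) \<in> V"
    by (rule sumV) (auto simp: funpow_dx_to_fract intro!: V less.IH)
  then have "coeff p i * to_fract [:fact i:] * to_fract [:[:1 / fact i:]:] \<in> V"
    unfolding e using V p by blast
  moreover have "[:fact i:] * [:[:1 / fact i:]:] = (1 :: complex poly poly)"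
  proof -
    have "(fact i :: complex poly) = [:fact i:]"
      by (metis of_nat_fact of_nat_poly)
    then show ?thesis by (simp add: one_pCons)
  qed
  then have "to_fract [:fact i:] * to_fract [:[:1 / fact i:]:] = (1::ratxy)"
    by (metis to_fract_mult to_fract_1)
  ultimately show ?case by (simp add: mult.assoc)
qed

lemma dop_eq_0I:
  assumes "\<And>f. dop dx p (to_fract f) = 0"
  shows "p = 0"
  using dop_coeffs_in[of "{0}" p] assms by (auto intro: poly_eqI)

lemma dop_eqI:
  assumes "\<And>f. dop dx p (to_fract f) = dop dx q (to_fract f)"
  shows "p = q"
  using dop_eq_0I[of "p - q"] assms by (simp add: dop_diff)

lemma dop_to_fract_coeffs:
  assumes "\<And>f. dop dx p (to_fract f) \<in> range to_fract"
  obtains q :: "complex poly poly poly" where "p = map_poly to_fract q"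
proof -
  have c: "coeff p i \<in> range to_fract" for i
  proof (rule dop_coeffs_in[of "range to_fract"])
    show "a - b \<in> range to_fract" if "a \<in> range to_fract" "b \<in> range to_fract" for a b :: ratxy
      using that by (auto simp flip: to_fract_diff)
    show "a * to_fract f \<in> range to_fract" if "a \<in> range to_fract" for a :: ratxy and f :: "complex poly poly"
      using that by (auto simp flip: to_fract_mult)
    show "(0::ratxy) \<in> range to_fract" by (rule range_eqI[of _ _ 0]) simp
  qed (rule assms)
  define g where "g = inv_into UNIV (to_fract :: _ \<Rightarrow> ratxy)"
  have "p = map_poly to_fract (map_poly g p)"
  proof (rule poly_eqI)
    fix i
    have "g 0 = 0" unfolding g_def by (metis inv_f_f injI to_fract_eq_iff to_fract_0)
    then show "coeff p i = coeff (map_poly to_fract (map_poly g p)) i"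
      using c[of i] by (simp add: coeff_map_poly g_def f_inv_into_f)
  qed
  then show ?thesis by (rule that)
qed

lemma common_denominator:
  fixes p :: "ratxy poly"
  obtains d q where "d \<noteq> 0" "map_poly to_fract q = smult (to_fract d) p"
proof -
  have "\<exists>d q. d \<noteq> 0 \<and> map_poly to_fract q = smult (to_fract d) p"
  proof (induction p)
    case 0
    show ?case by (intro exI[of _ 1] exI[of _ 0]) simp
  next
    case (pCons a p)
    then obtain d q where dq: "d \<noteq> 0" "map_poly to_fract q = smult (to_fract d) p" by blast
    obtain n m where a: "a = Fract n m" "m \<noteq> 0" by (cases a) auto
    have am: "to_fract m * a = to_fract n" using a by (simp add: to_fract_def eq_fract)
    show ?case
    proof (intro exI conjI)
      show "d * m \<noteq> 0" using dq a by simp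
      show "map_poly to_fract (pCons (d * n) (smult m q)) = smult (to_fract (d * m)) (pCons a p)"
        using dq(2) am
        by (simp add: map_poly_pCons map_poly_smult mult.assoc)
           (simp add: algebra_simps)
    qed
  qed
  then show ?thesis using that by blast
qed

text \<open>Multiplying by a common denominator changes neither the order nor the kernel of an
  operator.\<close>

lemma dx_operator_few_zeros:
  fixes p :: "ratxy poly"
  assumes deg: "degree p < card A"
    and z: "\<And>n. n \<in> A \<Longrightarrow> \<exists>f. degree f = n \<and> f \<noteq> 0 \<and> dop dx p (to_fract f) = 0"
  shows "p = 0"
proof -
  obtain d q where dq: "d \<noteq> 0" "map_poly to_fract q = smult (to_fract d) p"
    by (rule common_denominator)
  have "degree q = degree (map_poly to_fract q :: ratxy poly)" by (simp add: degree_map_poly)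
  also have "\<dots> = degree p" using dq by simp
  finally have dg: "degree q = degree p" .
  have "q = 0"
  proof (rule operator_few_zeros)
    show "degree q < card A" using deg dg by simp
    fix n assume "n \<in> A"
    then obtain f where f: "degree f = n" "f \<noteq> 0" "dop dx p (to_fract f) = 0" using z by blast
    have "to_fract (dop pderiv q f) = 0" using f by (simp add: dq(2) dop_smult flip: dop_to_fract)
    then show "\<exists>f. degree f = n \<and> f \<noteq> 0 \<and> dop pderiv q f = 0" using f by auto
  qed
  then show ?thesis using dq by auto
qed

section \<open>Hermite polynomials\<close>

text \<open>The Hermite polynomials by their three-term recurrence, as genuine elements of
  \<open>\<complex>[y][x]\<close>, so that degrees in x are available.\<close>

fun hpoly :: "nat \<Rightarrow> complex poly poly" where
  "hpoly 0 = 1"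
| "hpoly (Suc 0) = [:0, 1:]"
| "hpoly (Suc (Suc n)) = [:0, 1:] * hpoly (Suc n) + smult [:0, 2 * of_nat (Suc n):] (hpoly n)"

lemma degree_lead_hpoly: "degree (hpoly n) = n \<and> lead_coeff (hpoly n) = 1"
proof (induction n rule: hpoly.induct)
  case (3 n)
  define a where "a = pCons 0 (hpoly (Suc n))"
  define b where "b = smult [:0, 2 * of_nat (Suc n):] (hpoly n)"
  have h: "hpoly (Suc (Suc n)) = a + b" by (simp add: a_def b_def)
  have "hpoly (Suc n) \<noteq> 0" using 3 by auto
  then have a: "degree a = Suc (Suc n)" "lead_coeff a = 1"
    using 3 by (auto simp: a_def)
  have "degree b \<le> n" unfolding b_def using 3 by (intro order.trans[OF degree_smult_le]) simp
  then have "degree b < degree a" using a by simp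
  then show ?case using a by (simp only: h degree_add_eq_left lead_coeff_add_le) (simp add: coeff_eq_0)
qed auto

lemma degree_hpoly [simp]: "degree (hpoly n) = n"
  and coeff_hpoly [simp]: "coeff (hpoly n) n = 1"
  using degree_lead_hpoly[of n] by metis+

lemma hpoly_nonzero [simp]: "hpoly n \<noteq> 0"
  using coeff_hpoly[of n] by (auto simp del: coeff_hpoly)

text \<open>There is a monic Hermite polynomial in every degree, so they span all polynomials over
  the coefficients in y. Linear statements thus need to be checked on Hermite polynomials
  only.\<close>

lemma poly_hermite_induct [case_names zero add scale hermite]:
  assumes "P 0" "\<And>f g. P f \<Longrightarrow> P g \<Longrightarrow> P (f + g)" "\<And>c f. P f \<Longrightarrow> P (smult c f)" "\<And>n. P (hpoly n)"
  shows "P f"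
proof (induction "degree f" arbitrary: f rule: less_induct)
  case less
  define g where "g = f - smult (lead_coeff f) (hpoly (degree f))"
  have fg: "f = g + smult (lead_coeff f) (hpoly (degree f))" by (simp add: g_def)
  have "P g"
  proof (cases "degree f = 0")
    case True
    then have "g = 0" by (auto simp: g_def elim: degree_eq_zeroE)
    then show ?thesis using assms by simp
  next
    case False
    have "degree g \<le> degree f" unfolding g_def
      by (rule degree_diff_le) (auto intro: order.trans[OF degree_smult_le] simp: degree_hpoly)
    moreover have "coeff g (degree f) = 0"
      by (simp add: g_def)
    ultimately have "degree g < degree f" using False by (metis eq_zero_or_degree_less degree_0 gr0I)
    then show ?thesis by (rule less)
  qed
  then show ?case using assms fg by metis
qed

section \<open>The generating function and its recurrence\<close>

lemma exp_series_deriv: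
  "fps_deriv exp_series = (fps_const var_x + fps_const (2 * var_y) * fps_X) * exp_series"
proof -
  define q where "q = fps_const var_x * fps_X + fps_const var_y * fps_X ^ 2"
  have "q $ 0 = 0" by (simp add: q_def)
  then have "fps_deriv exp_series = (fps_exp 1 oo q) * fps_deriv q"
    unfolding exp_series_def q_def[symmetric] by (simp add: fps_compose_deriv)
  moreover have "fps_deriv q = fps_const var_x + fps_const (2 * var_y) * fps_X"
    unfolding q_def by (simp add: power2_eq_square algebra_simps flip: fps_const_mult)
  ultimately show ?thesis by (simp add: exp_series_def q_def mult.commute)
qed

lemma exp_series_0: "exp_series $ 0 = 1"
  by (simp add: exp_series_def fps_exp_def)

lemma exp_series_rec:
  "of_nat (Suc n) * exp_series $ Suc n =
     var_x * exp_series $ n + 2 * var_y * (if n = 0 then 0 else exp_series $ (n - 1))"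
proof -
  have "fps_deriv exp_series $ n = ((fps_const var_x + fps_const (2 * var_y) * fps_X) * exp_series) $ n"
    by (simp only: exp_series_deriv)
  moreover have "(fps_const (2 * var_y) * fps_X * exp_series) $ n = 2 * var_y * (if n = 0 then 0 else exp_series $ (n - 1))"
    by (simp only: mult.assoc fps_mult_left_const_nth fps_X_mult_nth)
  ultimately show ?thesis by (simp only: distrib_right fps_add_nth fps_mult_left_const_nth fps_deriv_nth Suc_eq_plus1)
qed

lemma hermite_rec:
  "hermite (Suc n) = var_x * hermite n + 2 * of_nat n * var_y * (if n = 0 then 0 else hermite (n - 1))"
proof -
  have "hermite (Suc n) = of_nat (fact n) * (of_nat (Suc n) * exp_series $ Suc n)"
    by (simp add: hermite_def algebra_simps)
  also have "\<dots> = var_x * hermite n + 2 * of_nat n * var_y * (if n = 0 then 0 else hermite (n - 1))"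
    unfolding exp_series_rec by (cases n) (simp_all add: hermite_def algebra_simps)
  finally show ?thesis .
qed

lemma hermite_hpoly: "hermite n = to_fract (hpoly n)"
proof (induction n rule: hpoly.induct)
  case 1
  show ?case by (simp add: hermite_def exp_series_0)
next
  case 2
  show ?case using hermite_rec[of 0] by (simp add: hermite_def exp_series_0 var_x_to_fract)
next
  case (3 n)
  have "to_fract [:[:0, 2 * of_nat (Suc n):]:] = 2 * of_nat (Suc n) * var_y"
  proof -
    have "[:[:0, 2 * of_nat (Suc n):]:] = (of_nat (2 * Suc n) :: complex poly poly) * [:[:0, 1:]:]"
      by (simp add: of_nat_poly)
    then show ?thesis
      by (simp only: to_fract_mult to_fract_of_nat) (simp add: var_y_def of_y_to_fract)
  qed
  moreover have "smult c p = [:c:] * p" for c and p :: "complex poly poly" by simp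
  ultimately show ?case using 3
    by (simp only: hermite_rec[of "Suc n"] hpoly.simps to_fract_add to_fract_mult)
       (simp add: var_x_to_fract)
qed

text \<open>In coefficients this says that d/dx multiplies the exponential by z, or that the
  derivative of H_(n+1) is (n+1) H_n. The recurrence is differentiated, and the factor
  \<open>of_nat (Suc n)\<close> is cancelled at the end.\<close>

lemma dx_exp_series: "dx (exp_series $ Suc n) = exp_series $ n"
proof (induction n rule: less_induct)
  case (less n)
  define e where "e k = exp_series $ k" for k
  have "dx (of_nat (Suc n) * e (Suc n)) = of_nat (Suc n) * dx (e (Suc n))"
    by (simp add: dx.D_mult del: of_nat_Suc)
  moreover have "dx (of_nat (Suc n) * e (Suc n)) = of_nat (Suc n) * e n"
  proof (cases n)
    case 0
    then show ?thesis unfolding e_def exp_series_rec by (simp add: exp_series_0 dx.D_mult)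
  next
    case (Suc m)
    have m: "dx (e (Suc m)) = e m" using less Suc by (simp add: e_def)
    have 2: "dx 2 = 0" using dx_of_nat[of 2] by simp
    have "dx (of_nat (Suc n) * e (Suc n)) = e n + var_x * dx (e (Suc m)) + 2 * var_y * dx (e m)"
      unfolding e_def exp_series_rec by (simp add: Suc dx.D_mult dx.D_add 2)
    \<comment> \<open>The induction hypothesis lowers the index of \<open>e m\<close>, and the
      recurrence one step earlier evaluates the result.\<close>
    also have "2 * var_y * dx (e m) = of_nat n * e n - var_x * e m"
    proof (cases m)
      case 0
      then show ?thesis using exp_series_rec[of 0] Suc by (simp add: e_def exp_series_0)
    next
      case (Suc k)
      then have "dx (e m) = e k" using less \<open>n = Suc m\<close> by (simp add: e_def)
      then show ?thesis using exp_series_rec[of m] Suc \<open>n = Suc m\<close> by (simp add: e_def algebra_simps)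
    qed
    finally show ?thesis by (simp add: m algebra_simps)
  qed
  ultimately have "of_nat (Suc n) * dx (e (Suc n)) = of_nat (Suc n) * e n" by metis
  then show ?case by (simp add: e_def del: of_nat_Suc)
qed

lemma exp_series_hermite: "exp_series $ n = of_C (1 / fact n) * hermite n"
proof -
  have "of_C (1 / fact n) * of_nat (fact n) = 1"
  proof -
    have "of_nat m = of_C (of_nat m)" for m
      by (induction m) (simp_all add: of_C_simps, simp add: of_C_def of_y_def Zero_fract_def)
    then have "of_C (1 / fact n) * of_nat (fact n) = of_C (1 / fact n * of_nat (fact n))"
      by (simp only: of_C_simps)
    then show ?thesis by (simp add: of_C_simps)
  qed
  then show ?thesis by (simp add: hermite_def flip: mult.assoc)
qed

section \<open>Wronskians as differential operators\<close>

text \<open>The minor left when row \<open>i\<close> and the last column are deleted from the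
  Wronskian matrix of \<open>gs\<close> extended by one function: the derivative orders run up to
  \<open>length gs\<close> and skip \<open>i\<close>.\<close>

definition wminor :: "('a::comm_ring_1 \<Rightarrow> 'a) \<Rightarrow> 'a list \<Rightarrow> nat \<Rightarrow> 'a" where
  "wminor D gs i = det (mat (length gs) (length gs) (\<lambda>(r, j). (D ^^ (if r < i then r else Suc r)) (gs ! j)))"

text \<open>Laplace expansion of the Wronskian along the column of its last argument, read as a
  differential operator acting on that argument.\<close>

definition wop :: "('a::comm_ring_1 \<Rightarrow> 'a) \<Rightarrow> 'a list \<Rightarrow> 'a poly" where
  "wop D gs = (\<Sum>i\<le>length gs. monom ((- 1) ^ (i + length gs) * wminor D gs i) i)"

lemma coeff_wop: "coeff (wop D gs) i = (if i \<le> length gs then (- 1) ^ (i + length gs) * wminor D gs i else 0)"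
  by (simp add: wop_def coeff_sum if_distrib sum.delta cong: if_cong)

lemma degree_wop_le: "degree (wop D gs) \<le> length gs"
  by (rule degree_le) (simp add: coeff_wop)

lemma coeff_wop_top: "coeff (wop D gs) (length gs) = wronskian D gs"
proof -
  have "wminor D gs (length gs) = wronskian D gs"
    unfolding wminor_def wronskian_def by (rule arg_cong[of _ _ det]) (auto intro!: eq_matI)
  then show ?thesis by (simp add: coeff_wop flip: mult_2)
qed

lemma dop_wop: "dop D (wop D gs) f = wronskian D (gs @ [f])"
proof -
  define l where "l = length gs"
  define A where "A = mat (Suc l) (Suc l) (\<lambda>(i, j). (D ^^ i) ((gs @ [f]) ! j))"
  have A: "A \<in> carrier_mat (Suc l) (Suc l)" by (simp add: A_def)
  have minor: "det (mat_delete A i l) = wminor D gs i" if "i \<le> l" for i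
    unfolding wminor_def l_def[symmetric] using that
    by (intro arg_cong[of _ _ det] eq_matI) (auto simp: mat_delete_def A_def nth_append l_def)
  have "wronskian D (gs @ [f]) = det A" by (simp add: wronskian_def A_def l_def)
  also have "\<dots> = (\<Sum>i<Suc l. A $$ (i, l) * cofactor A i l)"
    by (rule laplace_expansion_column[OF A]) simp
  also have "\<dots> = (\<Sum>i\<le>l. (- 1) ^ (i + l) * wminor D gs i * (D ^^ i) f)"
    unfolding lessThan_Suc_atMost
    by (rule sum.cong) (simp_all add: cofactor_def minor, simp add: A_def nth_append l_def)
  also have "\<dots> = dop D (wop D gs) f"
    by (simp add: wop_def dop_sum dop_monom l_def)
  finally show ?thesis by simp
qed

lemma wminor_hom:
  assumes "comm_ring_hom h" "\<And>f. D' (h f) = h (D f)"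
  shows "wminor D' (map h gs) i = h (wminor D gs i)"
proof -
  interpret comm_ring_hom h by fact
  have pow: "(D' ^^ n) (h f) = h ((D ^^ n) f)" for n f
    by (induction n) (simp_all add: assms(2))
  show ?thesis unfolding wminor_def
    by (subst hom_det[symmetric], rule arg_cong[of _ _ det], rule eq_matI) (auto simp: pow simp del: funpow.simps)
qed

text \<open>Used twice: to pass from polynomials to rational functions, and from rational functions
  to constant Laurent series.\<close>

lemma wop_hom:
  assumes "comm_ring_hom h" "\<And>f. D' (h f) = h (D f)"
  shows "wop D' (map h gs) = map_poly h (wop D gs)"
proof -
  interpret comm_ring_hom h by fact
  show ?thesis
    by (rule poly_eqI) (simp add: coeff_map_poly coeff_wop wminor_hom[of h D' D, OF assms] hom_distribs)
qed

lemma wronskian_repeated: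
  assumes "f \<in> set gs"
  shows "wronskian D (gs @ [f]) = 0"
proof -
  obtain k where k: "k < length gs" "gs ! k = f" using assms by (auto simp: in_set_conv_nth)
  define n where "n = Suc (length gs)"
  define B where "B = mat n n (\<lambda>(j, i). (D ^^ i) ((gs @ [f]) ! j))"
  have "det B = 0"
  proof (rule det_identical_rows)
    show "B \<in> carrier_mat n n" by (simp add: B_def)
    show "k \<noteq> length gs" "k < n" "length gs < n" using k by (auto simp: n_def)
    show "row B k = row B (length gs)" using k by (auto simp: B_def n_def nth_append)
  qed
  moreover have "wronskian D (gs @ [f]) = det (transpose_mat B)"
    unfolding wronskian_def by (rule arg_cong[of _ _ det]) (auto simp: B_def n_def)
  moreover have "det (transpose_mat B) = det B" by (rule det_transpose[of B n]) (simp add: B_def)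
  ultimately show ?thesis by simp
qed

section \<open>Wronskians of Hermite polynomials\<close>

text \<open>A vector in the kernel of the transposed matrix is a combination of \<open>n\<close>
  falling factorials, of degree below \<open>n\<close>, that vanishes at the \<open>n\<close>
  distinct elements of \<open>ks\<close>.\<close>

lemma det_fall_nonzero:
  assumes "distinct ks"
  shows "det (mat (length ks) (length ks) (\<lambda>(i, j). fall (of_nat (ks ! j)) i :: int)) \<noteq> 0"
proof
  define n where "n = length ks"
  define B where "B = mat n n (\<lambda>(j, i). fall (of_nat (ks ! j)) i :: int)"
  have B: "B \<in> carrier_mat n n" by (simp add: B_def)
  assume "det (mat (length ks) (length ks) (\<lambda>(i, j). fall (of_nat (ks ! j)) i :: int)) = 0"
  moreover have "mat (length ks) (length ks) (\<lambda>(i, j). fall (of_nat (ks ! j)) i :: int) = transpose_mat B"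
    by (auto simp: B_def n_def)
  ultimately have "det B = 0" using det_transpose[OF B] by simp
  then obtain v where v: "v \<in> carrier_vec n" "v \<noteq> 0\<^sub>v n" "B *\<^sub>v v = 0\<^sub>v n"
    using det_0_iff_vec_prod_zero[OF B] by blast
  have "n \<noteq> 0" using v by auto
  have eq: "(\<Sum>i\<le>n - 1. v $ i * fall (of_nat k) i) = 0" if k: "k \<in> set ks" for k
  proof -
    obtain j where j: "j < n" "ks ! j = k" using k by (auto simp: in_set_conv_nth n_def)
    have "0 = (B *\<^sub>v v) $ j" using v j by simp
    also have "\<dots> = (\<Sum>i<n. v $ i * fall (of_nat k) i)"
      using j v(1) by (auto simp: B_def scalar_prod_def atLeast0LessThan mult.commute intro!: sum.cong)
    also have "{..<n} = {..n - 1}" using \<open>n \<noteq> 0\<close> by auto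
    finally show ?thesis by simp
  qed
  have "v $ i = 0" if "i < n" for i
    by (rule fall_combination_zero[where A="set ks" and d="n - 1" and c="($) v"])
       (use eq that \<open>n \<noteq> 0\<close> distinct_card[OF assms] in \<open>auto simp: n_def\<close>)
  then have "v = 0\<^sub>v n" using v(1) by auto
  then show False using v by simp
qed

lemma coeff_prod_degree_bound:
  fixes f :: "'b \<Rightarrow> 'a::comm_semiring_1 poly"
  assumes "finite I" "\<And>i. i \<in> I \<Longrightarrow> degree (f i) \<le> d i"
  shows "degree (\<Prod>i\<in>I. f i) \<le> (\<Sum>i\<in>I. d i) \<and> coeff (\<Prod>i\<in>I. f i) (\<Sum>i\<in>I. d i) = (\<Prod>i\<in>I. coeff (f i) (d i))"
  using assms
proof (induction I rule: finite_induct)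
  case (insert a I)
  then have IH: "degree (\<Prod>i\<in>I. f i) \<le> (\<Sum>i\<in>I. d i)"
      "coeff (\<Prod>i\<in>I. f i) (\<Sum>i\<in>I. d i) = (\<Prod>i\<in>I. coeff (f i) (d i))" and a: "degree (f a) \<le> d a" by auto
  have "degree (f a * (\<Prod>i\<in>I. f i)) \<le> d a + (\<Sum>i\<in>I. d i)"
    using degree_mult_le[of "f a" "\<Prod>i\<in>I. f i"] IH(1) a by linarith
  then show ?case using insert.hyps coeff_mult_degree_bound[OF a IH(1)] IH(2) by simp
qed simp

lemma monom_prod: "(\<Prod>i\<in>I. monom 1 (g i)) = monom 1 (\<Sum>i\<in>I. g i)"
  by (induction I rule: infinite_finite_induct) (simp_all add: mult_monom monom_0 one_pCons)

lemma of_int_fall: "of_int (fall x i) = fall (of_int x) i"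
  by (simp add: fall_def)

text \<open>After row \<open>i\<close> is multiplied by \<open>x^i\<close>, the coefficient at the
  sum \<open>K\<close> of all \<open>ks\<close> is the determinant of falling factorials. That it is
  an integer, free of y, is what later permits division by it in polynomials.\<close>

lemma lead_coeff_wronskian_hermite:
  assumes "distinct ks"
  obtains c :: int where "c \<noteq> 0" "lead_coeff (wronskian pderiv (map hpoly ks)) = of_int c"
proof -
  define n where "n = length ks"
  define A where "A = mat n n (\<lambda>(i, j). (pderiv ^^ i) (hpoly (ks ! j)))"
  define S K where "S = (\<Sum>i=0..<n. i)" and "K = (\<Sum>j=0..<n. ks ! j)"
  define F where "F = mat n n (\<lambda>(i, j). fall (of_nat (ks ! j)) i :: int)"
  define c where "c = det F"
  have c0: "c \<noteq> 0" unfolding c_def F_def n_def by (rule det_fall_nonzero[OF assms])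
  have A: "A \<in> carrier_mat n n" and F: "F \<in> carrier_mat n n" by (simp_all add: A_def F_def)
  have W: "wronskian pderiv (map hpoly ks) = det A"
    unfolding wronskian_def A_def n_def by (rule arg_cong[of _ _ det]) auto
  \<comment> \<open>With the extra factor the degree bound \<open>ks ! j\<close> depends on the
    column only, so all terms of the determinant expansion share the bound \<open>K\<close>.\<close>
  define b where "b i j = monom 1 i * (pderiv ^^ i) (hpoly (ks ! j))" for i j
  have cb: "coeff (b i j) m = fall (of_nat m) i * coeff (hpoly (ks ! j)) m" for i j m
    by (auto simp: b_def coeff_monom_mult coeff_funpow_pderiv fall_eq_0)
  have b: "degree (b i j) \<le> ks ! j" for i j
    by (rule degree_le) (simp add: cb coeff_eq_0)
  have perm: "degree (\<Prod>i=0..<n. b i (p i)) \<le> K \<and>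
      coeff (\<Prod>i=0..<n. b i (p i)) K = (\<Prod>i=0..<n. fall (of_nat (ks ! p i)) i)"
    if "p permutes {0..<n}" for p
  proof -
    have "K = (\<Sum>i=0..<n. ks ! p i)"
      unfolding K_def by (subst sum.permute[OF that]) simp
    then show ?thesis
      using coeff_prod_degree_bound[of "{0..<n}" "\<lambda>i. b i (p i)" "\<lambda>i. ks ! p i"] b by (simp add: cb)
  qed
  have "monom 1 S * det A = (\<Sum>p | p permutes {0..<n}. signof p * (\<Prod>i=0..<n. b i (p i)))"
  proof -
    have "monom 1 S * (signof p * (\<Prod>i=0..<n. A $$ (i, p i))) = signof p * (\<Prod>i=0..<n. b i (p i))"
      if "p permutes {0..<n}" for p
    proof -
      have "(\<Prod>i=0..<n. b i (p i)) = (\<Prod>i=0..<n. monom 1 i) * (\<Prod>i=0..<n. A $$ (i, p i))"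
        unfolding prod.distrib[symmetric]
        using that by (intro prod.cong) (auto simp: b_def A_def permutes_in_image[OF that, simplified] dest: permutes_in_image)
      then show ?thesis by (simp add: monom_prod S_def algebra_simps)
    qed
    then show ?thesis unfolding det_def'[OF A] sum_distrib_left by (intro sum.cong) auto
  qed
  note expand = this
  have csign: "coeff (signof p * q) m = signof p * coeff q m" for p m and q :: "complex poly poly"
    by (simp add: sign_def)
  have dsign: "degree (signof p * q) = degree q" for p and q :: "complex poly poly"
    by (simp add: sign_def)
  have "coeff (monom 1 S * det A) K = det (map_mat of_int F)"
    unfolding expand coeff_sum
    by (subst det_def'[of _ n]) (auto simp: F_def csign perm of_int_fall permutes_in_image intro!: sum.cong prod.cong)
  also have "\<dots> = of_int c" by (simp add: c_def of_int_hom.hom_det)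
  finally have cK: "coeff (monom 1 S * det A) K = of_int c" .
  have "degree (monom 1 S * det A) \<le> K"
    unfolding expand by (rule degree_sum_le) (auto simp: dsign perm finite_permutations)
  then have "degree (monom 1 S * det A) = K"
    using cK c0 by (metis le_antisym le_degree of_int_eq_0_iff)
  then have "lead_coeff (monom 1 S * det A) = of_int c" using cK by simp
  then have "lead_coeff (monom 1 S :: complex poly poly) * lead_coeff (det A) = of_int c"
    unfolding lead_coeff_mult .
  moreover have "lead_coeff (monom 1 S :: complex poly poly) = 1" by (subst degree_monom_eq) simp_all
  ultimately have "lead_coeff (det A) = of_int c" by (simp only: mult_1)
  then show ?thesis unfolding W[symmetric] by (rule that[OF c0])
qed

section \<open>The Hermite Wronskian operator and its degree shift\<close>

locale hermite_wronskian =
  fixes ks :: "nat list"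
  assumes distinct_ks: "distinct ks"
begin

definition "l = length ks"
definition "tau = wronskian pderiv (map hpoly ks)"
text \<open>The operator \<open>\<tau> T\<close>, kept over the polynomials; its leading coefficient
  is \<open>tau\<close>.\<close>

definition "b = wop pderiv (map hpoly ks)"
definition "N = degree tau"

lemma tau_nonzero [simp]: "tau \<noteq> 0"
proof -
  obtain c :: int where "c \<noteq> 0" "lead_coeff tau = of_int c"
    using lead_coeff_wronskian_hermite[OF distinct_ks] unfolding tau_def by blast
  then show ?thesis by auto
qed

lemma coeff_b_l: "coeff b l = tau"
  using coeff_wop_top[of pderiv "map hpoly ks"] by (simp add: b_def tau_def l_def)

lemma degree_b [simp]: "degree b = l"
proof (rule antisym)
  show "degree b \<le> l" using degree_wop_le[of pderiv "map hpoly ks"] by (simp add: b_def l_def)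
  show "l \<le> degree b" by (rule le_degree) (simp add: coeff_b_l)
qed

lemma dop_b: "dop pderiv b f = wronskian pderiv (map hpoly ks @ [f])"
  unfolding b_def by (rule dop_wop)

lemma dop_b_kernel: "k \<in> set ks \<Longrightarrow> dop pderiv b (hpoly k) = 0"
  unfolding dop_b by (rule wronskian_repeated) simp

lemma card_ks: "card (set ks) = l"
  using distinct_card[OF distinct_ks] by (simp add: l_def)

text \<open>The symbol \<open>Q\<close> has the \<open>l\<close> elements of \<open>ks\<close> as
  roots. Were \<open>c l\<close> zero, its degree would be below \<open>l\<close> and it would
  vanish; so the leading term, with coefficient \<open>tau\<close>, attains the largest shift, which
  is therefore \<open>N - l\<close>. A further root would again be one too many, so outside
  \<open>ks\<close> the shift is exact.\<close>

lemma weight_b: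
  shows degree_coeff_b_le: "coeff b j \<noteq> 0 \<Longrightarrow> int (degree (coeff b j)) \<le> int j + (int N - int l)"
    and degree_dop_b: "n \<notin> set ks \<Longrightarrow> degree f = n \<Longrightarrow> f \<noteq> 0 \<Longrightarrow>
      dop pderiv b f \<noteq> 0 \<and> int (degree (dop pderiv b f)) = int n + (int N - int l)"
proof -
  have "b \<noteq> 0" using coeff_b_l by force
  then obtain w c where c: "\<exists>j\<le>degree b. c j \<noteq> 0"
    and c_nz: "\<And>j. c j \<noteq> 0 \<Longrightarrow> int (degree (coeff b j)) = int j + w \<and> c j = lead_coeff (coeff b j)"
    and le: "\<And>j. coeff b j \<noteq> 0 \<Longrightarrow> int (degree (coeff b j)) \<le> int j + w"
    and hi: "\<And>f n k. degree f \<le> n \<Longrightarrow> int k > int n + w \<Longrightarrow> coeff (dop pderiv b f) k = 0"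
    and top: "\<And>f n k. degree f \<le> n \<Longrightarrow> int k = int n + w \<Longrightarrow>
           coeff (dop pderiv b f) k = coeff f n * (\<Sum>j\<le>degree b. c j * fall (of_nat n) j)"
    and neg: "\<And>n. int n + w < 0 \<Longrightarrow> (\<Sum>j\<le>degree b. c j * fall (of_nat n) j) = 0"
    by (rule operator_weight) blast
  define Q where "Q n = (\<Sum>j\<le>l. c j * fall (of_nat n) j)" for n
  have Qk: "Q k = 0" if "k \<in> set ks" for k
  proof (cases "int k + w < 0")
    case False
    have "coeff (dop pderiv b (hpoly k)) (nat (int k + w)) = coeff (hpoly k) k * Q k"
      unfolding Q_def using False top[of "hpoly k" k "nat (int k + w)"] by simp
    then show ?thesis using dop_b_kernel[OF that] by simp
  qed (use neg[of k] in \<open>simp add: Q_def\<close>)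
  have "c l \<noteq> 0"
  proof
    assume cl: "c l = 0"
    have "l \<noteq> 0" using c cl by (cases l) auto
    then have "{..l} = insert l {..l - 1}" by auto
    then have Q: "Q n = (\<Sum>j\<le>l - 1. c j * fall (of_nat n) j)" for n
      using \<open>l \<noteq> 0\<close> by (simp add: Q_def cl)
    have "c j = 0" if "j \<le> l - 1" for j
      by (rule fall_combination_zero[where A="set ks" and d="l - 1" and c=c])
         (use that card_ks \<open>l \<noteq> 0\<close> Qk Q in auto)
    then have "c j = 0" if "j \<le> l" for j using that cl by (cases "j = l") auto
    then show False using c by auto
  qed
  from c_nz[OF this] have N: "int N = int l + w" by (simp add: N_def coeff_b_l)
  have Q_nz: "Q n \<noteq> 0" if "n \<notin> set ks" for n
  proof
    assume "Q n = 0"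
    have "c l = 0"
      by (rule fall_combination_zero[where A="insert n (set ks)" and d=l and c=c])
         (use that card_ks \<open>Q n = 0\<close> Qk Q_def in auto)
    then show False using \<open>c l \<noteq> 0\<close> by simp
  qed
  have w: "w = int N - int l" using N by simp
  show "int (degree (coeff b j)) \<le> int j + (int N - int l)" if "coeff b j \<noteq> 0"
    using le[OF that] by (simp add: w)
  show "dop pderiv b f \<noteq> 0 \<and> int (degree (dop pderiv b f)) = int n + (int N - int l)"
    if n: "n \<notin> set ks" and f: "degree f = n" "f \<noteq> 0"
  proof -
    \<comment> \<open>A negative target degree would make the symbol vanish at
      \<open>n\<close>.\<close>
    have "int n + w \<ge> 0" using neg[of n] Q_nz[OF n] unfolding Q_def degree_b by linarith
    then obtain m where m: "int m = int n + w" by (metis nonneg_int_cases)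
    have cm: "coeff (dop pderiv b f) m = coeff f n * Q n" using top[of f n m] f m by (simp add: Q_def)
    then have nz: "coeff (dop pderiv b f) m \<noteq> 0" using Q_nz[OF n] f by auto
    have "degree (dop pderiv b f) \<le> m"
      using hi[of f n] f m by (intro degree_le) auto
    then have "degree (dop pderiv b f) = m" by (rule antisym) (rule le_degree[OF nz])
    moreover have "dop pderiv b f \<noteq> 0" using nz by (metis coeff_0)
    ultimately show ?thesis using m w by simp
  qed
qed

text \<open>In x-degree the leading coefficient strictly dominates all the others. This is why
  division by x-degree works.\<close>

lemma degree_coeff_b: "j < l \<Longrightarrow> coeff b j = 0 \<or> degree (coeff b j) < N"
  using degree_coeff_b_le[of j] by linarith

end

section \<open>Division by the Hermite Wronskian operator\<close>

text \<open>Every coefficient has degree below \<open>d\<close> in x. Stated through vanishing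
  coefficients, so that \<open>d = 0\<close> forces the operator to be 0.\<close>

definition lowx :: "nat \<Rightarrow> 'a::zero poly poly \<Rightarrow> bool" where
  "lowx d p \<longleftrightarrow> (\<forall>i m. d \<le> m \<longrightarrow> coeff (coeff p i) m = 0)"

lemma lowx_0 [simp]: "lowx 0 p \<longleftrightarrow> p = 0"
  by (auto simp: lowx_def poly_eq_iff)

lemma lowx_add: "lowx d p \<Longrightarrow> lowx d q \<Longrightarrow> lowx d (p + q)"
  by (simp add: lowx_def)

lemma lowx_diff: "lowx d p \<Longrightarrow> lowx d q \<Longrightarrow> lowx d (p - q)"
  for p :: "'a::ab_group_add poly poly"
  by (simp add: lowx_def)

lemma lowx_sum: "(\<And>i. i \<in> A \<Longrightarrow> lowx d (p i)) \<Longrightarrow> lowx d (\<Sum>i\<in>A. p i)"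
  for p :: "'b \<Rightarrow> 'a::comm_monoid_add poly poly"
  by (simp add: lowx_def coeff_sum)

lemma lowx_exists: "\<exists>d. lowx d p"
  for p :: "'a::comm_monoid_add poly poly"
proof (induction p)
  case (pCons a p)
  then obtain d where "lowx d p" by blast
  then have "lowx (max d (Suc (degree a))) (pCons a p)"
    by (auto simp: lowx_def coeff_pCons coeff_eq_0 split: nat.split)
  then show ?case by blast
qed (auto simp: lowx_def)

lemma lowx_smult: "degree a \<le> n \<Longrightarrow> lowx d p \<Longrightarrow> lowx (n + d) (smult a p)"
  for p :: "'a::comm_semiring_1 poly poly"
  unfolding lowx_def
proof (intro allI impI)
  fix i m assume a: "degree a \<le> n" and p: "\<forall>i m. d \<le> m \<longrightarrow> coeff (coeff p i) m = 0" and m: "n + d \<le> m"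
  have "coeff a j * coeff (coeff p i) (m - j) = 0" for j
    using a p m by (cases "j \<le> n") (auto simp: coeff_eq_0)
  then show "coeff (coeff (smult a p) i) m = 0" by (simp add: coeff_mult)
qed

lemma lowx_mult_const:
  fixes g p :: "'a::comm_semiring_1 poly poly"
  assumes "\<And>i. degree (coeff g i) = 0" "lowx d p"
  shows "lowx d (p * g)"
proof -
  have "coeff (a * coeff g i) m = coeff a m * coeff (coeff g i) 0" for a i m
    using degree_eq_zeroE[OF assms(1)[of i]] by (metis coeff_pCons_0 coeff_smult mult.commute mult_pCons_right mult_zero_right add.right_neutral pCons_0_0)
  then show ?thesis using assms(2) by (simp add: lowx_def coeff_mult coeff_sum)
qed

lemma lowx_ddiff: "lowx d p \<Longrightarrow> lowx d (pderiv.ddiff p)"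
  by (auto simp: lowx_def pderiv.coeff_ddiff coeff_pderiv split: nat.split)

text \<open>Moving derivatives past \<open>x^e\<close> leaves \<open>x^e\<close> in front, up to
  terms in which a derivative has hit the power and lowered its degree.\<close>

lemma funpow_ddiff_x_power:
  "\<exists>u :: 'a::idom poly poly. lowx e u \<and> (pderiv.ddiff ^^ i) [:monom 1 e:] = monom (monom 1 e) i + u"
proof (induction i)
  case 0
  then show ?case by (intro exI[of _ 0]) (simp add: lowx_def monom_0)
next
  case (Suc i)
  then obtain u :: "'a poly poly" where u: "lowx e u" "(pderiv.ddiff ^^ i) [:monom 1 e:] = monom (monom 1 e) i + u"
    by blast
  define v where "v = monom (pderiv (monom (1::'a) e)) i + pderiv.ddiff u"
  have "lowx e (monom (pderiv (monom (1::'a) e)) i)" by (auto simp: lowx_def coeff_pderiv)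
  then have "lowx e v" unfolding v_def using lowx_ddiff[OF u(1)] by (rule lowx_add)
  moreover have "(pderiv.ddiff ^^ Suc i) [:monom 1 e:] = monom (monom 1 e) (Suc i) + v"
    by (rule poly_eqI) (simp add: u(2) v_def pderiv.coeff_ddiff pderiv_add split: nat.split)
  ultimately show ?case by blast
qed

lemma coeff_times_monom_1: "coeff (p * monom 1 e) m = (if e \<le> m then coeff p (m - e) else 0)"
  for p :: "'a::comm_semiring_1 poly"
  by (subst mult.commute) (simp add: coeff_monom_mult)

context hermite_wronskian
begin

text \<open>Of the terms of \<open>b\<close> composed with multiplication by \<open>x^e\<close>,
  only the one of order \<open>l\<close> with coefficient \<open>tau * x^e\<close> reaches x-degree
  \<open>N + e\<close>: the other coefficients of \<open>b\<close> have degree below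
  \<open>N\<close>.\<close>

lemma b_times_x_power:
  obtains u where "lowx (N + e) u"
    "\<And>f. dop pderiv b (monom 1 e * f) = dop pderiv (monom (tau * monom 1 e) l + u) f"
proof -
  obtain v where v: "\<And>i. lowx e (v i)"
      "\<And>i. (pderiv.ddiff ^^ i) [:monom 1 e:] = monom (monom 1 e) i + (v i :: complex poly poly poly)"
    using funpow_ddiff_x_power[of e] by metis
  have bN: "degree (coeff b i) \<le> N" for i
    using degree_coeff_b[of i] coeff_b_l
    by (cases i l rule: linorder_cases) (auto simp: N_def coeff_eq_0)
  define u where "u = (\<Sum>i\<le>l. smult (coeff b i) (v i)) + (\<Sum>i<l. monom (coeff b i * monom 1 e) i)"
  have "lowx (N + e) (\<Sum>i\<le>l. smult (coeff b i) (v i))"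
    by (intro lowx_sum lowx_smult bN v)
  moreover have "lowx (N + e) (\<Sum>i<l. monom (coeff b i * monom 1 e) i)"
  proof (rule lowx_sum)
    fix i assume "i \<in> {..<l}"
    then have "coeff b i = 0 \<or> degree (coeff b i) < N" using degree_coeff_b by simp
    then have "coeff (coeff b i * monom 1 e) m = 0" if "N + e \<le> m" for m
      using that by (auto simp: coeff_times_monom_1 coeff_eq_0)
    then show "lowx (N + e) (monom (coeff b i * monom 1 e) i)" by (auto simp: lowx_def)
  qed
  ultimately have "lowx (N + e) u" unfolding u_def by (rule lowx_add)
  moreover have "dop pderiv b (monom 1 e * f) = dop pderiv (monom (tau * monom 1 e) l + u) f" for f
  proof -
    have "monom 1 e * f = dop pderiv [:monom 1 e:] f"
      using dop_monom[of pderiv "monom 1 e" 0 f] by (simp add: monom_0)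
    moreover have "pderiv.dmul b [:monom 1 e:] =
        (\<Sum>i\<le>l. smult (coeff b i) (v i)) + (\<Sum>i\<le>l. monom (coeff b i * monom 1 e) i)"
      by (simp add: pderiv.dmul_def v(2) smult_add_right smult_monom sum.distrib)
    moreover have "(\<Sum>i\<le>l. monom (coeff b i * monom 1 e) i) =
        (\<Sum>i<l. monom (coeff b i * monom 1 e) i) + monom (tau * monom 1 e) l"
      by (simp add: coeff_b_l flip: lessThan_Suc_atMost)
    ultimately show ?thesis by (simp add: u_def algebra_simps flip: pderiv.dop_dmul)
  qed
  ultimately show ?thesis by (rule that)
qed

text \<open>The quantity that decreases is the degree in x, not the order. One round multiplies the
  dividend by the \<open>l\<close>-th power of the derivative on the right, to match the order of
  \<open>b\<close>, and then subtracts a multiple of \<open>b\<close>; the powers spent add up to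
  \<open>M\<close>.\<close>

lemma left_division:
  "\<exists>M r s. lowx N s \<and>
     (\<forall>f. dop pderiv a ((pderiv ^^ M) f) = dop pderiv b (dop pderiv r f) + dop pderiv s f)"
proof -
  obtain c0 :: int where c0: "c0 \<noteq> 0" "lead_coeff tau = of_int c0"
    using lead_coeff_wronskian_hermite[OF distinct_ks] unfolding tau_def by blast
  define c where "c = [:1 / of_int c0 :: complex:]"
  have c: "coeff tau N * c = 1"
    using c0 by (simp add: N_def c_def of_int_poly one_pCons)
  have "\<exists>M r s. lowx N s \<and>
     (\<forall>f. dop pderiv a ((pderiv ^^ M) f) = dop pderiv b (dop pderiv r f) + dop pderiv s f)"
    if "lowx d a" for d and a :: "complex poly poly poly"
    using that
  proof (induction d arbitrary: a)
    case 0
    then have "a = 0" by simp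
    then show ?case by (intro exI[of _ 0]) (simp add: lowx_def)
  next
    case (Suc d)
    show ?case
    proof (cases "Suc d \<le> N")
      case True
      then have "lowx N a" using Suc.prems by (auto simp: lowx_def)
      then show ?thesis by (intro exI[of _ 0] exI[of _ a]) simp
    next
      case False
      define e where "e = d - N"
      have d: "d = N + e" using False by (simp add: e_def)
      obtain u where u: "lowx (N + e) u"
        "\<And>f. dop pderiv b (monom 1 e * f) = dop pderiv (monom (tau * monom 1 e) l + u) f"
        by (rule b_times_x_power[of e]) blast
      \<comment> \<open>The coefficients of \<open>x^d\<close> in \<open>a\<close>, divided by the
        constant leading coefficient of \<open>tau\<close>. They are free of x, so composing with
        \<open>g\<close> on the right is an ordinary product.\<close>
      define g where "g = map_poly (\<lambda>q. [:c * coeff q d:]) a"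
      have cg: "coeff g i = [:c * coeff (coeff a i) d:]" for i by (simp add: g_def coeff_map_poly)
      have g0: "degree (coeff g i) = 0" "pderiv (coeff g i) = 0" for i by (simp_all add: cg pderiv_pCons)
      define r0 where "r0 = smult (monom 1 e) g"
      \<comment> \<open>What is left of \<open>a\<close> times the \<open>l\<close>-th derivative
        after \<open>b\<close> applied to \<open>r0\<close> is subtracted. In the first part the
        terms of degree \<open>d\<close> cancel, and \<open>u * g\<close> has degree below
        \<open>N + e = d\<close>.\<close>
      define a' where "a' = (a - smult (tau * monom 1 e) g) * monom 1 l - u * g"
      have "lowx d (a - smult (tau * monom 1 e) g)"
        unfolding lowx_def
      proof (intro allI impI)
        fix i m assume m: "d \<le> m"
        have eq: "coeff (coeff (a - smult (tau * monom 1 e) g) i) m =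
            coeff (coeff a i) m - coeff tau (m - e) * (c * coeff (coeff a i) d)"
          using m d by (simp add: cg coeff_times_monom_1 mult.commute)
        show "coeff (coeff (a - smult (tau * monom 1 e) g) i) m = 0"
        proof (cases "m = d")
          case True
          then show ?thesis unfolding eq using c d by (simp flip: mult.assoc)
        next
          case False
          then have "coeff (coeff a i) m = 0" using Suc.prems m by (simp add: lowx_def)
          moreover have "coeff tau (m - e) = 0" using False m d by (intro coeff_eq_0) (simp add: N_def)
          ultimately show ?thesis unfolding eq by simp
        qed
      qed
      then have "lowx d ((a - smult (tau * monom 1 e) g) * monom 1 l)"
        by (rule lowx_mult_const[rotated]) simp
      moreover have "lowx d (u * g)"
        by (rule lowx_mult_const) (use u(1) d g0 in auto)
      ultimately have "lowx d a'" unfolding a'_def by (rule lowx_diff)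
      from Suc.IH[OF this] obtain M r s where IH: "lowx N s"
        "\<And>f. dop pderiv a' ((pderiv ^^ M) f) = dop pderiv b (dop pderiv r f) + dop pderiv s f" by blast
      have r0: "dop pderiv b (dop pderiv r0 f) = dop pderiv (monom (tau * monom 1 e) l * g + u * g) f" for f
        by (simp add: r0_def dop_smult u(2) pderiv.dop_mult_const_coeffs g0(2) flip: distrib_right)
      have const: "dop pderiv (p * monom 1 M) f = dop pderiv p ((pderiv ^^ M) f)"
        for p :: "complex poly poly poly" and f M
        by (subst pderiv.dop_mult_const_coeffs) (auto simp: dop_monom)
      have a'r0: "dop pderiv a ((pderiv ^^ l) f) = dop pderiv b (dop pderiv r0 f) + dop pderiv a' f" for f
      proof -
        have "monom (tau * monom 1 e) l * g = smult (tau * monom 1 e) g * monom 1 l"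
        proof -
          have "monom (tau * monom 1 e) l = smult (tau * monom 1 e) (monom 1 l)"
            by (simp add: smult_monom)
          then show ?thesis by (simp only: mult_smult_left mult.commute[of g])
        qed
        then have "a * monom 1 l = (monom (tau * monom 1 e) l * g + u * g) + a'"
          unfolding a'_def left_diff_distrib by (simp only:) simp
        then show ?thesis unfolding r0 const[symmetric] by (simp add: dop_add)
      qed
      have "dop pderiv a ((pderiv ^^ (l + M)) f) =
          dop pderiv b (dop pderiv (r0 * monom 1 M + r) f) + dop pderiv s f" for f
      proof -
        have "(pderiv ^^ (l + M)) f = (pderiv ^^ l) ((pderiv ^^ M) f)" by (simp add: funpow_add)
        then have "dop pderiv a ((pderiv ^^ (l + M)) f) =
            dop pderiv b (dop pderiv r0 ((pderiv ^^ M) f)) + (dop pderiv b (dop pderiv r f) + dop pderiv s f)"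
          by (simp only: a'r0 IH(2))
        then show ?thesis by (simp only: dop_add const pderiv.dop_arg_add add.assoc)
      qed
      then show ?thesis using IH(1) by blast
    qed
  qed
  then show ?thesis using lowx_exists[of a] by blast
qed

text \<open>The degrees occurring on the right are \<open>N + k - l\<close> with \<open>k \<notin> set ks\<close>; the weight argument
  turns each of the missing degrees into a root of the leading symbol.\<close>

lemma low_operator_zero:
  assumes s: "lowx N s"
    and gaps: "\<And>n. dop pderiv s (hpoly n) \<noteq> 0 \<Longrightarrow>
      \<exists>k. k \<notin> set ks \<and> int (degree (dop pderiv s (hpoly n))) = int N + int k - int l"
  shows "s = 0"
proof (rule ccontr)
  assume "s \<noteq> 0"
  then obtain w c where c: "\<exists>j\<le>degree s. c j \<noteq> 0"
    and c_nz: "\<And>j. c j \<noteq> 0 \<Longrightarrow> int (degree (coeff s j)) = int j + w \<and> c j = lead_coeff (coeff s j)"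
    and hi: "\<And>f n k. degree f \<le> n \<Longrightarrow> int k > int n + w \<Longrightarrow> coeff (dop pderiv s f) k = 0"
    and top: "\<And>f n k. degree f \<le> n \<Longrightarrow> int k = int n + w \<Longrightarrow>
           coeff (dop pderiv s f) k = coeff f n * (\<Sum>j\<le>degree s. c j * fall (of_nat n) j)"
    and neg: "\<And>n. int n + w < 0 \<Longrightarrow> (\<Sum>j\<le>degree s. c j * fall (of_nat n) j) = 0"
    by (rule operator_weight) blast
  have small: "int j < int N - w" if "c j \<noteq> 0" for j
  proof -
    have "lead_coeff (coeff s j) \<noteq> 0" using c_nz[OF that] that by auto
    then have "degree (coeff s j) < N" using s unfolding lowx_def by (meson not_le)
    then show ?thesis using c_nz[OF that] by linarith
  qed
  obtain j0 where j0: "c j0 \<noteq> 0" using c by blast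
  \<comment> \<open>Terms attaining the shift have \<open>j + w < N\<close>, so the symbol has
    degree at most \<open>B - 1\<close> in \<open>n\<close>, whatever the order of
    \<open>s\<close>.\<close>
  define B where "B = nat (int N - w)"
  have B: "int B = int N - w" "B > 0" using small[OF j0] by (auto simp: B_def)
  define Q where "Q n = (\<Sum>j\<le>B - 1. c j * fall (of_nat n) j)" for n
  have Q: "(\<Sum>j\<le>degree s. c j * fall (of_nat n) j) = Q n" for n
  proof -
    have cd: "c j = 0" if "j > degree s" for j
      using c_nz[of j] that by (cases "c j = 0") (auto simp: coeff_eq_0)
    have "(\<Sum>j\<le>degree s. c j * fall (of_nat n) j) = (\<Sum>j\<le>max (degree s) (B - 1). c j * fall (of_nat n) j)"
      by (rule sum.mono_neutral_left) (auto simp: cd)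
    also have "\<dots> = Q n" unfolding Q_def
      by (rule sum.mono_neutral_right) (use small B in \<open>force+\<close>)
    finally show ?thesis .
  qed
  \<comment> \<open>A nonzero symbol at \<open>n\<close> forces \<open>n + l = k + B\<close> with
    \<open>k \<notin> set ks\<close>. \<open>K\<close> collects the \<open>B + l\<close> values of
    \<open>n + l\<close> that this rules out; at most \<open>l\<close> of them lie below
    \<open>l\<close>, so at least \<open>B\<close> values of \<open>n\<close> remain as
    roots.\<close>
  define K where "K = {..<B} \<union> (\<lambda>k. k + B) ` set ks"
  define A where "A = (\<lambda>v. v - l) ` (K - {..<l})"
  have "card K = B + l" unfolding K_def
    by (subst card_Un_disjoint) (auto simp: card_image card_ks)
  moreover have "card A = card (K - {..<l})" unfolding A_def
    by (rule card_image) (auto simp: inj_on_def)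
  moreover have "card K - card {..<l} \<le> card (K - {..<l})" by (rule diff_card_le_card_Diff) simp
  ultimately have cardA: "B - 1 < card A" using B by simp
  have "Q n = 0" if nA: "n \<in> A" for n
  proof (rule ccontr)
    assume Qn: "Q n \<noteq> 0"
    then have "int n + w \<ge> 0" using neg[of n] Q by force
    then obtain m where m: "int m = int n + w" by (metis nonneg_int_cases)
    have cm: "coeff (dop pderiv s (hpoly n)) m = Q n" using top[of "hpoly n" n m] m by (simp add: Q)
    have "degree (dop pderiv s (hpoly n)) = m"
    proof (rule antisym)
      show "degree (dop pderiv s (hpoly n)) \<le> m" using hi[of "hpoly n" n] m by (intro degree_le) auto
      show "m \<le> degree (dop pderiv s (hpoly n))" using cm Qn by (intro le_degree) simp
    qed
    moreover have "dop pderiv s (hpoly n) \<noteq> 0" using cm Qn by auto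
    ultimately obtain k where k: "k \<notin> set ks" "int m = int N + int k - int l" using gaps[of n] by auto
    then have "int (n + l) = int (k + B)" using m B by simp
    then have nl: "n + l = k + B" by linarith
    obtain v where v: "v \<in> K" "\<not> v < l" "n = v - l" using nA by (auto simp: A_def)
    then have "v = k + B" using nl by simp
    then show False using v k by (auto simp: K_def)
  qed
  then have "c j = 0" if "j \<le> B - 1" for j
    using fall_combination_zero[OF cardA, of c j] that by (simp add: Q_def)
  then have "c j = 0" for j using small[of j] B by (cases "c j = 0") force+
  then show False using j0 by simp
qed

end

section \<open>Operators on Laurent series\<close>

definition zpow :: "int \<Rightarrow> lseries" where
  "zpow k = fls_X_intpow k"

lemma zpow_nth [simp]: "fls_nth (zpow k) m = (if m = k then 1 else 0)"
  by (auto simp: zpow_def)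

lemma zpow_mult_nth [simp]: "fls_nth (zpow k * F) m = fls_nth F (m - k)"
  unfolding zpow_def fls_X_intpow_times_conv_shift by simp

lemma zpow_mult: "zpow j * zpow k = zpow (j + k)"
  unfolding zpow_def by (rule fls_X_intpow_times_fls_X_intpow)

lemma zpow_0 [simp]: "zpow 0 = 1"
  by (simp add: zpow_def)

lemma zpow_1: "zpow 1 = fls_X"
  by (rule fls_eqI) simp

lemma zpow_nonzero [simp]: "zpow k \<noteq> 0"
  by (simp add: zpow_def)

lemma fls_deriv_zpow: "fls_deriv (zpow k) = of_int k * zpow (k - 1)"
  unfolding zpow_def by (rule fls_deriv_X_intpow)

lemma of_C_closed: "of_C 0 = 0" "of_int n = of_C (of_int n)"
proof -
  show 0: "of_C 0 = 0" by (simp add: of_C_to_fract)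
  have "of_nat m = of_C (of_nat m)" for m
    by (induction m) (simp_all add: of_C_simps 0)
  moreover have "of_C (- a) = - of_C a" for a
    using of_C_simps(1)[of a "- a"] 0 by (simp add: eq_neg_iff_add_eq_0 add.commute)
  ultimately show "of_int n = of_C (of_int n)" by (cases n rule: int_cases2) simp_all
qed

lemma of_y_0 [simp]: "of_y 0 = 0"
  by (simp add: of_y_to_fract)

lemma of_y_eq_0_iff [simp]: "of_y p = 0 \<longleftrightarrow> p = 0"
  by (simp add: of_y_to_fract)

lemma of_y_minus: "of_y (- p) = - of_y p"
  using of_y_simps(1)[of p "- p"] by (simp add: eq_neg_iff_add_eq_0 add.commute)

lemma of_y_sum: "of_y (\<Sum>i\<in>A. g i) = (\<Sum>i\<in>A. of_y (g i))"
  by (induction A rule: infinite_finite_induct) (simp_all add: of_y_simps)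

subsection \<open>Action of operators in \<open>x\<close> on coefficients\<close>

text \<open>\<open>\<sigma> 0 = 0\<close> keeps the support bounded below, so that the result is
  again a Laurent series.\<close>

lemma coeffwise_nth:
  assumes "\<sigma> 0 = 0"
  shows "fls_nth (coeffwise \<sigma> F) n = \<sigma> (fls_nth F n)"
proof -
  obtain N where N: "\<forall>n<N. fls_nth F n = 0" by (rule fls_nth_vanishes_belowE)
  show ?thesis unfolding coeffwise_def
    by (rule nth_Abs_fls_ex_lower_bound) (use N assms in \<open>auto intro!: exI[of _ N]\<close>)
qed

definition cw :: "ratxy poly \<Rightarrow> lseries \<Rightarrow> lseries" where
  "cw p = coeffwise (dop dx p)"

lemma cw_nth [simp]: "fls_nth (cw p F) n = dop dx p (fls_nth F n)"
  by (simp add: cw_def coeffwise_nth)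

lemma cw_1 [simp]: "cw 1 F = F"
  by (rule fls_eqI) simp

lemma cw_0 [simp]: "cw 0 F = 0"
  by (rule fls_eqI) simp

lemma cw_op_add: "cw (p + q) F = cw p F + cw q F"
  by (rule fls_eqI) (simp add: dop_add)

lemma cw_op_diff: "cw (p - q) F = cw p F - cw q F"
  by (rule fls_eqI) (simp add: dop_diff)

lemma cw_smult: "cw (smult a p) F = fls_const a * cw p F"
  by (rule fls_eqI) (simp add: dop_smult)

lemma cw_dmul: "cw (dx.dmul p q) F = cw p (cw q F)"
  by (rule fls_eqI) (simp add: dx.dop_dmul)

lemma cw_add: "cw p (F + G) = cw p F + cw p G"
  by (rule fls_eqI) (simp add: dx.dop_arg_add)

lemma cw_zpow: "cw p (zpow k * F) = zpow k * cw p F"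
  by (rule fls_eqI) simp

lemma dx_of_int [simp]: "dx (of_int n) = 0"
  unfolding of_C_closed(2) by simp

lemma cw_fls_deriv: "cw p (fls_deriv F) = fls_deriv (cw p F)"
  by (rule fls_eqI) (simp add: dx.dop_arg_const_mult dx.D_add)

lemma cw_shift: "cw (pCons 0 p) F = cw p (coeffwise dx F)"
  by (rule fls_eqI) (simp add: dop_shift coeffwise_nth)

lemma cw_const_arg: "cw p (fls_const a * F) = cw (dx.dmul p [:a:]) F"
  unfolding cw_dmul by (rule arg_cong[of _ _ "cw p"], rule fls_eqI) (simp add: dop_def)

definition exp_ls :: lseries where
  "exp_ls = fps_to_fls exp_series"

lemma exp_ls_nth: "fls_nth exp_ls n = (if n < 0 then 0 else exp_series $ nat n)"
  by (simp add: exp_ls_def)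

lemma coeffwise_dx_exp: "coeffwise dx exp_ls = zpow 1 * exp_ls"
proof (rule fls_eqI)
  fix n
  show "fls_nth (coeffwise dx exp_ls) n = fls_nth (zpow 1 * exp_ls) n"
  proof (cases "n \<le> 0")
    case True
    then show ?thesis by (auto simp: coeffwise_nth exp_ls_nth exp_series_0)
  next
    case False
    then have "nat n = Suc (nat (n - 1))" by simp
    then show ?thesis using False by (simp add: coeffwise_nth exp_ls_nth dx_exp_series)
  qed
qed

lemma fls_deriv_exp: "fls_deriv exp_ls = fls_const var_x * exp_ls + fls_const (2 * var_y) * (zpow 1 * exp_ls)"
  unfolding exp_ls_def fls_deriv_fps_to_fls exp_series_deriv
  by (simp add: fls_times_fps_to_fls zpow_1 fps_const_to_fls algebra_simps
      flip: fls_const_mult_const)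

text \<open>Since d/dx multiplies the exponential by z, a derivative composed on the right comes out
  as a factor z.\<close>

lemma cw_shift_exp: "cw (pCons 0 p) exp_ls = zpow 1 * cw p exp_ls"
  by (simp only: cw_shift coeffwise_dx_exp cw_zpow)

lemma cw_shift_exp_power: "cw (p * monom 1 k) exp_ls = zpow (int k) * cw p exp_ls"
proof (induction k arbitrary: p)
  case 0
  then show ?case by (simp add: monom_0 one_pCons[symmetric])
next
  case (Suc k)
  have "p * monom 1 (Suc k) = pCons 0 (p * monom 1 k)"
    by (simp add: monom_Suc mult_pCons_right)
  then have "cw (p * monom 1 (Suc k)) exp_ls = zpow 1 * (zpow (int k) * cw p exp_ls)"
    using Suc by (simp only: cw_shift_exp)
  then show ?case by (simp add: zpow_mult add.commute flip: mult.assoc)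
qed

subsection \<open>Banded operators\<close>

text \<open>An operator in z seen as a matrix of finite bandwidth with entries in \<open>S\<close>:
  each coefficient of the image is a finite sum, which lets infinite series such as
  \<open>Psi\<close> be treated entrywise.\<close>

definition bandop :: "ratxy set \<Rightarrow> (lseries \<Rightarrow> lseries) \<Rightarrow> bool" where
  "bandop S P \<longleftrightarrow> (\<exists>B K. (\<forall>m d. K m d \<in> S) \<and>
     (\<forall>F m. fls_nth (P F) m = (\<Sum>d\<in>{-B..B::int}. K m d * fls_nth F (m + d))))"

definition coeff_ring :: "ratxy set \<Rightarrow> bool" where
  "coeff_ring S \<longleftrightarrow> (\<forall>a\<in>S. \<forall>b\<in>S. a + b \<in> S \<and> a * b \<in> S) \<and> range of_int \<subseteq> S"

lemma coeff_ring_of_C: "coeff_ring (range of_C)"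
  unfolding coeff_ring_def using of_C_closed(2) by (auto simp flip: of_C_simps)

lemma coeff_ring_of_y: "coeff_ring (range of_y)"
  unfolding coeff_ring_def using of_C_closed(2) by (auto simp: of_C_def simp flip: of_y_simps)

context
  fixes S assumes S: "coeff_ring S"
begin

lemma coeff_ring_0: "0 \<in> S"
  using S unfolding coeff_ring_def by (metis of_int_0 rangeI subsetD)

text \<open>With entries set to 0 outside the band, the band may be widened at will; two operators
  can then be given a common width.\<close>

lemma bandop_obtain:
  assumes "bandop S P"
  obtains B K where "\<And>m d. K m d \<in> S" "B \<ge> (0::int)" "\<And>m d. d \<notin> {-B..B} \<Longrightarrow> K m d = 0"
    "\<And>F m B'. B' \<ge> B \<Longrightarrow> fls_nth (P F) m = (\<Sum>d\<in>{-B'..B'}. K m d * fls_nth F (m + d))"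
proof -
  obtain B K where BK: "\<And>m d. K m d \<in> S"
    "\<And>F m. fls_nth (P F) m = (\<Sum>d\<in>{-B..B::int}. K m d * fls_nth F (m + d))"
    using assms unfolding bandop_def by blast
  define K' where "K' m d = (if d \<in> {-B..B} then K m d else 0)" for m d
  show ?thesis
  proof (rule that[of K' "max B 0"])
    show "K' m d \<in> S" for m d using BK(1) coeff_ring_0 by (simp add: K'_def)
    fix F m B' assume B': "B' \<ge> max B 0"
    have "(\<Sum>d\<in>{-B..B}. K m d * fls_nth F (m + d)) = (\<Sum>d\<in>{-B..B}. K' m d * fls_nth F (m + d))"
      by (rule sum.cong) (simp_all add: K'_def)
    also have "\<dots> = (\<Sum>d\<in>{-B'..B'}. K' m d * fls_nth F (m + d))"
      by (rule sum.mono_neutral_left) (use B' in \<open>auto simp: K'_def\<close>)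
    finally show "fls_nth (P F) m = (\<Sum>d\<in>{-B'..B'}. K' m d * fls_nth F (m + d))" by (simp add: BK(2))
  qed (auto simp: K'_def)
qed

lemma bandop_zero: "bandop S (\<lambda>F. 0)"
  unfolding bandop_def by (rule exI[of _ 0], rule exI[of _ "\<lambda>_ _. 0"]) (simp add: coeff_ring_0)

lemma bandop_id: "bandop S (\<lambda>F. F)"
proof -
  have "1 \<in> S" using S unfolding coeff_ring_def by (metis of_int_1 rangeI subsetD)
  then show ?thesis
    unfolding bandop_def by (intro exI[of _ 0] exI[of _ "\<lambda>_ _. 1"]) simp
qed

lemma bandop_add:
  assumes "bandop S P" "bandop S Q"
  shows "bandop S (\<lambda>F. P F + Q F)"
proof -
  obtain B K where BK: "\<And>m d. K m d \<in> S" "B \<ge> (0::int)" "\<And>m d. d \<notin> {-B..B} \<Longrightarrow> K m d = 0"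
    "\<And>F m B'. B' \<ge> B \<Longrightarrow> fls_nth (P F) m = (\<Sum>d\<in>{-B'..B'}. K m d * fls_nth F (m + d))"
    by (rule bandop_obtain[OF assms(1)]) (rule that)
  obtain C L where CL: "\<And>m d. L m d \<in> S" "C \<ge> (0::int)" "\<And>m d. d \<notin> {-C..C} \<Longrightarrow> L m d = 0"
    "\<And>F m B'. B' \<ge> C \<Longrightarrow> fls_nth (Q F) m = (\<Sum>d\<in>{-B'..B'}. L m d * fls_nth F (m + d))"
    by (rule bandop_obtain[OF assms(2)]) (rule that)
  show ?thesis unfolding bandop_def
  proof (intro exI[of _ "max B C"] exI[of _ "\<lambda>m d. K m d + L m d"] conjI allI)
    show "K m d + L m d \<in> S" for m d using BK(1) CL(1) S unfolding coeff_ring_def by blast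
  qed (simp add: BK(4)[of "max B C"] CL(4)[of "max B C"] sum.distrib distrib_right)
qed

lemma bandop_sum: "(\<And>i. i \<in> A \<Longrightarrow> bandop S (P i)) \<Longrightarrow> bandop S (\<lambda>F. \<Sum>i\<in>A. P i F)"
  by (induction A rule: infinite_finite_induct) (simp_all add: bandop_zero bandop_add)

lemma bandop_const:
  assumes "bandop S P" "a \<in> S"
  shows "bandop S (\<lambda>F. fls_const a * P F)"
proof -
  obtain B K where BK: "\<And>m d. K m d \<in> S"
    "\<And>F m. fls_nth (P F) m = (\<Sum>d\<in>{-B..B::int}. K m d * fls_nth F (m + d))"
    using assms unfolding bandop_def by blast
  show ?thesis unfolding bandop_def
  proof (intro exI[of _ B] exI[of _ "\<lambda>m d. a * K m d"] conjI allI)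
    show "a * K m d \<in> S" for m d using BK(1) assms(2) S unfolding coeff_ring_def by blast
  qed (simp add: BK(2) sum_distrib_left mult.assoc)
qed

lemma bandop_zpow:
  assumes "bandop S P"
  shows "bandop S (\<lambda>F. zpow k * P F)"
proof -
  obtain B K where BK: "\<And>m d. K m d \<in> S" "B \<ge> (0::int)" "\<And>m d. d \<notin> {-B..B} \<Longrightarrow> K m d = 0"
    "\<And>F m B'. B' \<ge> B \<Longrightarrow> fls_nth (P F) m = (\<Sum>d\<in>{-B'..B'}. K m d * fls_nth F (m + d))"
    by (rule bandop_obtain[OF assms]) (rule that)
  show ?thesis unfolding bandop_def
  proof (intro exI[of _ "B + \<bar>k\<bar>"] exI[of _ "\<lambda>m d. K (m - k) (d + k)"] conjI allI)
    fix F m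
    have "fls_nth (zpow k * P F) m = (\<Sum>d\<in>{-B..B}. K (m - k) d * fls_nth F (m - k + d))"
      by (simp add: BK(4)[of B])
    also have "\<dots> = (\<Sum>d\<in>(\<lambda>d. d - k) ` {-B..B}. K (m - k) (d + k) * fls_nth F (m + d))"
      by (subst sum.reindex) (auto simp: inj_on_def algebra_simps)
    also have "\<dots> = (\<Sum>d\<in>{-(B + \<bar>k\<bar>)..B + \<bar>k\<bar>}. K (m - k) (d + k) * fls_nth F (m + d))"
    proof (rule sum.mono_neutral_left)
      show "\<forall>i\<in>{- (B + \<bar>k\<bar>)..B + \<bar>k\<bar>} - (\<lambda>d. d - k) ` {- B..B}. K (m - k) (i + k) * fls_nth F (m + i) = 0"
      proof
        fix i assume "i \<in> {- (B + \<bar>k\<bar>)..B + \<bar>k\<bar>} - (\<lambda>d. d - k) ` {- B..B}"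
        then have "i + k \<notin> {-B..B}" by (metis DiffE add_diff_cancel_right' imageI)
        then show "K (m - k) (i + k) * fls_nth F (m + i) = 0" by (simp add: BK(3))
      qed
    qed auto
    finally show "fls_nth (zpow k * P F) m = (\<Sum>d\<in>{-(B + \<bar>k\<bar>)..B + \<bar>k\<bar>}. K (m - k) (d + k) * fls_nth F (m + d))" .
  qed (rule BK)
qed

lemma bandop_deriv:
  assumes "bandop S P"
  shows "bandop S (\<lambda>F. P (fls_deriv F))"
proof -
  obtain B K where BK: "\<And>m d. K m d \<in> S" "B \<ge> (0::int)" "\<And>m d. d \<notin> {-B..B} \<Longrightarrow> K m d = 0"
    "\<And>F m B'. B' \<ge> B \<Longrightarrow> fls_nth (P F) m = (\<Sum>d\<in>{-B'..B'}. K m d * fls_nth F (m + d))"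
    by (rule bandop_obtain[OF assms]) (rule that)
  show ?thesis unfolding bandop_def
  proof (intro exI[of _ "B + 1"] exI[of _ "\<lambda>m d. K m (d - 1) * of_int (m + d)"] conjI allI)
    show "K m (d - 1) * of_int (m + d) \<in> S" for m d using BK(1) S unfolding coeff_ring_def by blast
    fix F m
    have "fls_nth (P (fls_deriv F)) m = (\<Sum>d\<in>{-B..B}. K m d * (of_int (m + d + 1) * fls_nth F (m + d + 1)))"
      by (simp add: BK(4)[of B])
    also have "\<dots> = (\<Sum>d\<in>(\<lambda>d. d + 1) ` {-B..B}. K m (d - 1) * of_int (m + d) * fls_nth F (m + d))"
      by (subst sum.reindex) (auto simp: inj_on_def algebra_simps)
    also have "\<dots> = (\<Sum>d\<in>{-(B + 1)..B + 1}. K m (d - 1) * of_int (m + d) * fls_nth F (m + d))"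
    proof (rule sum.mono_neutral_left)
      show "\<forall>i\<in>{- (B + 1)..B + 1} - (\<lambda>d. d + 1) ` {- B..B}. K m (i - 1) * of_int (m + i) * fls_nth F (m + i) = 0"
      proof
        fix i assume "i \<in> {- (B + 1)..B + 1} - (\<lambda>d. d + 1) ` {- B..B}"
        then have "i - 1 \<notin> {-B..B}" by (metis DiffE diff_add_cancel imageI)
        then show "K m (i - 1) * of_int (m + i) * fls_nth F (m + i) = 0" by (simp add: BK(3))
      qed
    qed auto
    finally show "fls_nth (P (fls_deriv F)) m = (\<Sum>d\<in>{-(B + 1)..B + 1}. K m (d - 1) * of_int (m + d) * fls_nth F (m + d))" .
  qed
qed

text \<open>The entries of the band are the coefficients of the images of powers of z, so those
  images determine the operator on all series.\<close>

lemma bandop_matrix: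
  assumes "bandop S P"
  obtains B where "\<And>m k. fls_nth (P (zpow k)) m \<in> S"
    "\<And>F m. fls_nth (P F) m = (\<Sum>k\<in>{m - B..m + B}. fls_nth (P (zpow k)) m * fls_nth F k)"
proof -
  obtain B K where BK: "\<And>m d. K m d \<in> S" "B \<ge> (0::int)" "\<And>m d. d \<notin> {-B..B} \<Longrightarrow> K m d = 0"
    "\<And>F m B'. B' \<ge> B \<Longrightarrow> fls_nth (P F) m = (\<Sum>d\<in>{-B'..B'}. K m d * fls_nth F (m + d))"
    by (rule bandop_obtain[OF assms]) (rule that)
  have M: "fls_nth (P (zpow k)) m = K m (k - m)" for m k
  proof -
    have "fls_nth (P (zpow k)) m = (\<Sum>d\<in>{-B..B}. if d = k - m then K m d else 0)"
      unfolding BK(4)[OF order_refl] by (rule sum.cong) auto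
    also have "\<dots> = K m (k - m)" using BK(3)[of "k - m" m] by (auto simp: sum.delta)
    finally show ?thesis .
  qed
  show ?thesis
  proof (rule that[of B])
    show "fls_nth (P (zpow k)) m \<in> S" for m k using BK(1) by (simp add: M)
    fix F m
    have "(\<Sum>k\<in>{m - B..m + B}. K m (k - m) * fls_nth F k) = (\<Sum>d\<in>{-B..B}. K m d * fls_nth F (m + d))"
      by (rule sum.reindex_bij_witness[of _ "\<lambda>d. m + d" "\<lambda>k. k - m"]) auto
    then show "fls_nth (P F) m = (\<Sum>k\<in>{m - B..m + B}. fls_nth (P (zpow k)) m * fls_nth F k)"
      unfolding M using BK(4)[of B F m] by simp
  qed
qed

end

lemma bandop_mono: "bandop S P \<Longrightarrow> S \<subseteq> T \<Longrightarrow> bandop T P"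
  unfolding bandop_def by (meson subsetD)

text \<open>The matrix entries lie in \<open>\<complex>[y]\<close>, are constants for d/dx, and
  occur in finite sums only.\<close>

lemma bandop_cw_commute:
  assumes "bandop (range of_y) P"
  shows "P (cw p F) = cw p (P F)"
proof (rule fls_eqI)
  fix m
  obtain B where B: "\<And>m k. fls_nth (P (zpow k)) m \<in> range of_y"
    "\<And>F m. fls_nth (P F) m = (\<Sum>k\<in>{m - B..m + B}. fls_nth (P (zpow k)) m * fls_nth F k)"
    by (rule bandop_matrix[OF coeff_ring_of_y assms]) (rule that)
  have "dx (fls_nth (P (zpow k)) m) = 0" for k using B(1)[of k m] by auto
  then show "fls_nth (P (cw p F)) m = fls_nth (cw p (P F)) m"
    by (simp add: B(2)[of "cw p F"] B(2)[of F] dx.dop_arg_sum dx.dop_arg_const_mult)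
qed

subsection \<open>Laurent polynomial coefficients\<close>

interpretation sC: Modules.module scale_C
  by (rule module_scale_C)

lemma laurent_polys_def': "laurent_polys = sC.span (range zpow)"
  by (simp add: laurent_polys_def zpow_def[abs_def])

lemma laurent_induct [consumes 1, case_names zero step]:
  assumes "a \<in> laurent_polys" "h 0" "\<And>c k a. h a \<Longrightarrow> h (fls_const (of_C c) * zpow k + a)"
  shows "h a"
  using assms(1) unfolding laurent_polys_def'
  by (induction rule: sC.span_induct_alt) (use assms(2,3) in \<open>auto simp: scale_C_def\<close>)

lemma laurent_0 [simp]: "0 \<in> laurent_polys"
  unfolding laurent_polys_def' by (rule sC.span_zero)

lemma laurent_add: "a \<in> laurent_polys \<Longrightarrow> b \<in> laurent_polys \<Longrightarrow> a + b \<in> laurent_polys"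
  unfolding laurent_polys_def' by (rule sC.span_add)

lemma laurent_zpow: "zpow k \<in> laurent_polys"
  unfolding laurent_polys_def' by (rule sC.span_base) simp

lemma laurent_const: "a \<in> laurent_polys \<Longrightarrow> fls_const (of_C c) * a \<in> laurent_polys"
  using sC.span_scale[of a "range zpow" c] unfolding laurent_polys_def' scale_C_def by simp

lemma laurent_mult:
  assumes "a \<in> laurent_polys" "b \<in> laurent_polys"
  shows "a * b \<in> laurent_polys"
  using assms(1)
proof (induction rule: laurent_induct)
  case (step c k a)
  have "zpow k * b \<in> laurent_polys"
    using assms(2)
  proof (induction rule: laurent_induct)
    case (step c' k' b)
    have "zpow k * (fls_const (of_C c') * zpow k' + b) = fls_const (of_C c') * zpow (k + k') + zpow k * b"
      by (simp add: algebra_simps flip: zpow_mult)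
    then show ?case using step by (simp add: laurent_add laurent_const laurent_zpow)
  qed simp
  then show ?case using step by (simp add: distrib_right mult.assoc laurent_add laurent_const)
qed simp

lemma laurent_deriv: "a \<in> laurent_polys \<Longrightarrow> fls_deriv a \<in> laurent_polys"
proof (induction rule: laurent_induct)
  case (step c k a)
  have "of_int k = fls_const (of_C (of_int k))"
    by (simp add: fls_of_int flip: of_C_closed(2))
  then have "of_int k * zpow (k - 1) \<in> laurent_polys"
    using laurent_const[OF laurent_zpow] by metis
  then show ?case using step laurent_const[of "of_int k * zpow (k - 1)" c]
    by (simp add: fls_deriv_zpow laurent_add)
qed simp

interpretation fd: derivation "fls_deriv :: lseries \<Rightarrow> lseries"
  by unfold_locales (simp_all add: algebra_simps)

definition zops :: "(lseries \<Rightarrow> lseries) set" where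
  "zops = diff_ops fls_deriv laurent_polys"

lemma zops_iff: "P \<in> zops \<longleftrightarrow> (\<exists>p. (\<forall>i. coeff p i \<in> laurent_polys) \<and> P = dop fls_deriv p)"
  unfolding zops_def by (rule diff_ops_iff) simp

lemma bandop_laurent_mult:
  assumes "a \<in> laurent_polys" "bandop (range of_C) P"
  shows "bandop (range of_C) (\<lambda>F. a * P F)"
  using assms(1)
proof (induction rule: laurent_induct)
  case zero
  then show ?case by (simp add: bandop_zero coeff_ring_of_C)
next
  case (step c k a)
  have "bandop (range of_C) (\<lambda>F. fls_const (of_C c) * (zpow k * P F))"
    by (intro bandop_const bandop_zpow coeff_ring_of_C assms) simp
  then show ?case using bandop_add[OF coeff_ring_of_C _ step] by (simp add: distrib_right mult.assoc)
qed

lemma bandop_zops: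
  assumes "P \<in> zops"
  shows "bandop (range of_C) P"
proof -
  obtain p where p: "\<forall>i. coeff p i \<in> laurent_polys" "P = dop fls_deriv p"
    using assms zops_iff by blast
  have d: "bandop (range of_C) (\<lambda>F. (fls_deriv ^^ i) F)" for i
  proof (induction i)
    case (Suc i)
    then show ?case using bandop_deriv[OF coeff_ring_of_C Suc] by (simp add: funpow_swap1)
  qed (simp add: bandop_id coeff_ring_of_C)
  have "bandop (range of_C) (\<lambda>F. \<Sum>i\<le>degree p. coeff p i * (fls_deriv ^^ i) F)"
    by (intro bandop_sum coeff_ring_of_C bandop_laurent_mult d) (use p in auto)
  then show ?thesis by (simp add: p(2) dop_def[abs_def])
qed

subsection \<open>Polynomial dependence on \<open>y\<close>\<close>

text \<open>The extension by \<open>\<complex>[y]\<close> for an arbitrary family, so that it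
  applies both to \<open>A_alg lam\<close> and to all of \<open>zops\<close>, where no space has to
  be preserved.\<close>

definition ytensor :: "(lseries \<Rightarrow> lseries) set \<Rightarrow> (lseries \<Rightarrow> lseries) set" where
  "ytensor PP = {(\<lambda>F. \<Sum>k\<le>n. fls_const (var_y ^ k) * P k F) | n P. \<forall>k\<le>n. P k \<in> PP}"

lemma A_alg_y_ytensor: "A_alg_y lam = ytensor (A_alg lam)"
  by (simp add: A_alg_y_def ytensor_def)

lemma var_y_power: "var_y ^ k = of_y (monom 1 k)"
proof (induction k)
  case 0
  then show ?case by (simp add: monom_0 of_y_simps flip: one_pCons)
next
  case (Suc k)
  have "of_y [:0, 1:] * of_y (monom 1 k) = of_y (monom 1 (Suc k))"
    by (simp add: monom_Suc flip: of_y_simps)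
  moreover have "var_y ^ Suc k = var_y * of_y (monom 1 k)" by (simp only: power_Suc Suc)
  ultimately show ?case by (simp add: var_y_def)
qed

lemma of_y_expand: "of_y p = (\<Sum>k\<le>degree p. var_y ^ k * of_C (coeff p k))"
proof -
  have "of_y p = of_y (\<Sum>k\<le>degree p. monom (coeff p k) k)" by (simp add: poly_as_sum_of_monoms)
  also have "\<dots> = (\<Sum>k\<le>degree p. of_y (monom 1 k * [:coeff p k:]))"
    by (simp add: of_y_sum mult.commute[of "monom 1 _"] smult_monom)
  finally show ?thesis by (simp only: of_y_simps var_y_power of_C_def)
qed

text \<open>The closure properties common to \<open>zops\<close> and \<open>A_alg lam\<close>, from
  which those of \<open>ytensor\<close> follow. Linearity over all constants of \<open>ratxy\<close>
  allows powers of y to be collected in front.\<close>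

locale op_family =
  fixes PP :: "(lseries \<Rightarrow> lseries) set"
  assumes zero: "(\<lambda>F. 0) \<in> PP"
    and id: "(\<lambda>F. F) \<in> PP"
    and add: "P \<in> PP \<Longrightarrow> Q \<in> PP \<Longrightarrow> (\<lambda>F. P F + Q F) \<in> PP"
    and comp: "P \<in> PP \<Longrightarrow> Q \<in> PP \<Longrightarrow> (\<lambda>F. P (Q F)) \<in> PP"
    and scale: "P \<in> PP \<Longrightarrow> (\<lambda>F. fls_const (of_C c) * P F) \<in> PP"
    and lin_add: "P \<in> PP \<Longrightarrow> P (F + G) = P F + P G"
    and lin_const: "P \<in> PP \<Longrightarrow> P (fls_const a * F) = fls_const a * P F"
begin

lemma ytensor_monom: "P \<in> PP \<Longrightarrow> (\<lambda>F. fls_const (var_y ^ k) * P F) \<in> ytensor PP"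
  unfolding ytensor_def
proof (intro CollectI exI conjI)
  assume P: "P \<in> PP"
  define Q where "Q i = (if i = k then P else (\<lambda>F. 0))" for i
  show "(\<lambda>F. fls_const (var_y ^ k) * P F) = (\<lambda>F. \<Sum>i\<le>k. fls_const (var_y ^ i) * Q i F)"
  proof (rule ext)
    fix F
    have "(\<Sum>i\<le>k. fls_const (var_y ^ i) * Q i F) = (\<Sum>i\<in>{k}. fls_const (var_y ^ i) * Q i F)"
      by (rule sum.mono_neutral_right) (auto simp: Q_def)
    then show "fls_const (var_y ^ k) * P F = (\<Sum>i\<le>k. fls_const (var_y ^ i) * Q i F)"
      by (simp add: Q_def)
  qed
  show "\<forall>i\<le>k. Q i \<in> PP" using P zero by (simp add: Q_def)
qed

lemma ytensor_base: "P \<in> PP \<Longrightarrow> P \<in> ytensor PP"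
  using ytensor_monom[of P 0] by simp

lemma ytensor_add:
  assumes "P \<in> ytensor PP" "Q \<in> ytensor PP"
  shows "(\<lambda>F. P F + Q F) \<in> ytensor PP"
proof -
  obtain n p where p: "P = (\<lambda>F. \<Sum>k\<le>n. fls_const (var_y ^ k) * p k F)" "\<forall>k\<le>n. p k \<in> PP"
    using assms(1) unfolding ytensor_def by blast
  obtain m q where q: "Q = (\<lambda>F. \<Sum>k\<le>m. fls_const (var_y ^ k) * q k F)" "\<forall>k\<le>m. q k \<in> PP"
    using assms(2) unfolding ytensor_def by blast
  define p' where "p' k = (if k \<le> n then p k else (\<lambda>F. 0))" for k
  define q' where "q' k = (if k \<le> m then q k else (\<lambda>F. 0))" for k
  have P: "P F = (\<Sum>k\<le>max n m. fls_const (var_y ^ k) * p' k F)" for F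
    unfolding p(1) by (rule sum.mono_neutral_cong_left) (auto simp: p'_def)
  have Q: "Q F = (\<Sum>k\<le>max n m. fls_const (var_y ^ k) * q' k F)" for F
    unfolding q(1) by (rule sum.mono_neutral_cong_left) (auto simp: q'_def)
  have "(\<lambda>F. P F + Q F) = (\<lambda>F. \<Sum>k\<le>max n m. fls_const (var_y ^ k) * (p' k F + q' k F))"
    by (rule ext) (simp add: P Q sum.distrib distrib_left)
  moreover have "\<forall>k\<le>max n m. (\<lambda>F. p' k F + q' k F) \<in> PP"
    using p(2) q(2) zero by (auto simp: p'_def q'_def intro!: add)
  ultimately show ?thesis unfolding ytensor_def by (intro CollectI exI conjI)
qed

lemma ytensor_sum: "(\<And>i. i \<in> A \<Longrightarrow> P i \<in> ytensor PP) \<Longrightarrow> (\<lambda>F. \<Sum>i\<in>A. P i F) \<in> ytensor PP"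
  by (induction A rule: infinite_finite_induct) (simp_all add: ytensor_base zero ytensor_add)

lemma lin_sum: "P \<in> PP \<Longrightarrow> P (\<Sum>i\<in>A. F i) = (\<Sum>i\<in>A. P (F i))"
proof (induction A rule: infinite_finite_induct)
  case (infinite A)
  then show ?case using lin_const[of P 0 0] by simp
next
  case empty
  then show ?case using lin_const[of P 0 0] by simp
qed (simp add: lin_add)

lemma ytensor_comp:
  assumes "P \<in> ytensor PP" "Q \<in> ytensor PP"
  shows "(\<lambda>F. P (Q F)) \<in> ytensor PP"
proof -
  obtain n p where p: "P = (\<lambda>F. \<Sum>k\<le>n. fls_const (var_y ^ k) * p k F)" "\<forall>k\<le>n. p k \<in> PP"
    using assms(1) unfolding ytensor_def by blast
  obtain m q where q: "Q = (\<lambda>F. \<Sum>k\<le>m. fls_const (var_y ^ k) * q k F)" "\<forall>k\<le>m. q k \<in> PP"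
    using assms(2) unfolding ytensor_def by blast
  have "(\<lambda>F. P (Q F)) = (\<lambda>F. \<Sum>k\<le>n. \<Sum>j\<le>m. fls_const (var_y ^ (k + j)) * p k (q j F))"
  proof (rule ext)
    fix F
    have "fls_const (var_y ^ k) * p k (\<Sum>j\<le>m. fls_const (var_y ^ j) * q j F) =
        (\<Sum>j\<le>m. fls_const (var_y ^ (k + j)) * p k (q j F))" if "k \<le> n" for k
    proof -
      have pk: "p k \<in> PP" using p(2) that by blast
      show ?thesis
        by (simp only: lin_sum[OF pk] lin_const[OF pk] sum_distrib_left power_add
            fls_const_mult_const[symmetric] mult.assoc)
    qed
    then show "P (Q F) = (\<Sum>k\<le>n. \<Sum>j\<le>m. fls_const (var_y ^ (k + j)) * p k (q j F))"
      unfolding p(1) q(1) by (intro sum.cong refl) simp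
  qed
  moreover have "\<dots> \<in> ytensor PP"
  proof (rule ytensor_sum, rule ytensor_sum)
    fix k j assume "k \<in> {..n}" "j \<in> {..m}"
    then have "(\<lambda>F. p k (q j F)) \<in> PP" using p(2) q(2) by (intro comp[of "p k" "q j"]) auto
    then show "(\<lambda>F. fls_const (var_y ^ (k + j)) * p k (q j F)) \<in> ytensor PP"
      by (rule ytensor_monom)
  qed
  ultimately show ?thesis by simp
qed

lemma ytensor_const: "(\<lambda>F. fls_const (of_y c) * F) \<in> ytensor PP"
proof -
  have "(\<lambda>F. fls_const (of_y c) * F) =
      (\<lambda>F. \<Sum>k\<le>degree c. fls_const (var_y ^ k) * (fls_const (of_C (coeff c k)) * F))"
  proof (rule ext)
    fix F
    have "fls_const (\<Sum>k\<in>A. g k) = (\<Sum>k\<in>A. fls_const (g k))" for A :: "nat set" and g :: "nat \<Rightarrow> ratxy"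
      by (induction A rule: infinite_finite_induct) (simp_all flip: fls_plus_const)
    then show "fls_const (of_y c) * F =
        (\<Sum>k\<le>degree c. fls_const (var_y ^ k) * (fls_const (of_C (coeff c k)) * F))"
      by (simp add: of_y_expand[of c] sum_distrib_right mult.assoc flip: fls_const_mult_const)
  qed
  then show ?thesis using ytensor_sum[OF ytensor_monom[OF scale[OF id]]] by simp
qed

lemma ytensor_scale: "P \<in> ytensor PP \<Longrightarrow> (\<lambda>F. fls_const (of_y c) * P F) \<in> ytensor PP"
  using ytensor_comp[OF ytensor_const] .

lemma ytensor_lin:
  assumes "P \<in> ytensor PP"
  shows "P (F + G) = P F + P G" "P (fls_const a * F) = fls_const a * P F"
proof -
  obtain n p where p: "P = (\<lambda>F. \<Sum>k\<le>n. fls_const (var_y ^ k) * p k F)" "\<forall>k\<le>n. p k \<in> PP"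
    using assms(1) unfolding ytensor_def by blast
  have *: "p k (F + G) = p k F + p k G" "p k (fls_const a * F) = fls_const a * p k F" if "k \<le> n" for k
    using that p(2) lin_add lin_const by blast+
  show "P (F + G) = P F + P G"
    unfolding p(1) sum.distrib[symmetric] by (rule sum.cong) (simp_all add: * distrib_left)
  show "P (fls_const a * F) = fls_const a * P F"
    unfolding p(1) sum_distrib_left by (rule sum.cong) (simp_all add: * mult.left_commute)
qed

end

lemma zops_lin:
  assumes "P \<in> zops"
  shows "P (F + G) = P F + P G" "P (fls_const a * F) = fls_const a * P F"
  using assms by (auto simp: zops_iff fd.dop_arg_add fd.dop_arg_const_mult)

interpretation zops: op_family zops
proof
  show "(\<lambda>F. 0) \<in> zops" unfolding zops_iff by (intro exI[of _ 0]) (auto simp: fun_eq_iff)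
  have "(1::lseries) \<in> laurent_polys" using laurent_zpow[of 0] by simp
  then show "(\<lambda>F. F) \<in> zops" unfolding zops_iff
    by (intro exI[of _ 1]) (auto simp: fun_eq_iff coeff_1)
  fix P Q assume P: "P \<in> zops"
  then obtain p where p: "\<forall>i. coeff p i \<in> laurent_polys" "P = dop fls_deriv p" by (auto simp: zops_iff)
  show "(\<lambda>F. fls_const (of_C c) * P F) \<in> zops" for c unfolding zops_iff
    by (intro exI[of _ "smult (fls_const (of_C c)) p"])
      (auto simp: fun_eq_iff dop_smult p laurent_const)
  assume "Q \<in> zops"
  then obtain q where q: "\<forall>i. coeff q i \<in> laurent_polys" "Q = dop fls_deriv q" by (auto simp: zops_iff)
  show "(\<lambda>F. P F + Q F) \<in> zops" unfolding zops_iff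
    by (intro exI[of _ "p + q"]) (auto simp: fun_eq_iff dop_add p q laurent_add)
  show "(\<lambda>F. P (Q F)) \<in> zops" unfolding zops_iff
  proof (intro exI[of _ "fd.dmul p q"] conjI allI)
    show "coeff (fd.dmul p q) i \<in> laurent_polys" for i
      by (rule fd.coeff_dmul_closed) (use p q in \<open>auto simp: laurent_add laurent_mult laurent_deriv\<close>)
  qed (auto simp: fun_eq_iff fd.dop_dmul p q)
qed (auto dest: zops_lin)

lemma zops_zpow: "(\<lambda>F. zpow k * F) \<in> zops"
  unfolding zops_iff
proof (intro exI[of _ "[:zpow k:]"] conjI allI)
  show "coeff [:zpow k:] i \<in> laurent_polys" for i by (cases i) (auto simp: laurent_zpow)
qed (auto simp: dop_def)

lemma zops_deriv: "fls_deriv \<in> zops"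
  unfolding zops_iff
proof (intro exI[of _ "[:0, 1:]"] conjI allI)
  have "(1::lseries) \<in> laurent_polys" using laurent_zpow[of 0] by simp
  then show "coeff [:0, 1:] i \<in> laurent_polys" for i by (auto simp: coeff_pCons split: nat.split)
qed (auto simp: fun_eq_iff dop_shift simp flip: one_pCons)

lemma bandop_ytensor:
  assumes "P \<in> ytensor zops"
  shows "bandop (range of_y) P"
proof -
  obtain n p where p: "P = (\<lambda>F. \<Sum>k\<le>n. fls_const (var_y ^ k) * p k F)" "\<forall>k\<le>n. p k \<in> zops"
    using assms unfolding ytensor_def by blast
  have "range of_C \<subseteq> range of_y" by (auto simp: of_C_def)
  then have "bandop (range of_y) (p k)" if "k \<le> n" for k
    using bandop_mono[OF bandop_zops] p(2) that by blast
  then show ?thesis unfolding p(1)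
    by (intro bandop_sum bandop_const coeff_ring_of_y) (auto simp: var_y_power)
qed

subsection \<open>Transfer of operators through the exponential\<close>

text \<open>The series obtained from the exponential by an operator in x and a power of 1/z.\<close>

definition xform :: "lseries \<Rightarrow> bool" where
  "xform G \<longleftrightarrow> (\<exists>n p. zpow (int n) * G = cw p exp_ls)"

lemma xform_exp: "xform exp_ls"
  unfolding xform_def by (rule exI[of _ 0], rule exI[of _ 1]) simp

lemma xform_raise:
  assumes "zpow (int n) * G = cw p exp_ls" "n \<le> m"
  shows "zpow (int m) * G = cw (p * monom 1 (m - n)) exp_ls"
proof -
  have "zpow (int m) * G = zpow (int (m - n)) * (zpow (int n) * G)"
    using assms(2) by (simp add: zpow_mult of_nat_diff flip: mult.assoc)
  then show ?thesis by (simp add: assms(1) cw_shift_exp_power)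
qed

lemma xform_add:
  assumes "xform F" "xform G"
  shows "xform (F + G)"
proof -
  obtain n p where p: "zpow (int n) * F = cw p exp_ls" using assms(1) unfolding xform_def by blast
  obtain m q where q: "zpow (int m) * G = cw q exp_ls" using assms(2) unfolding xform_def by blast
  have "zpow (int (max n m)) * (F + G) = cw (p * monom 1 (max n m - n) + q * monom 1 (max n m - m)) exp_ls"
    by (simp add: distrib_left xform_raise[OF p, of "max n m"] xform_raise[OF q, of "max n m"] cw_op_add)
  then show ?thesis unfolding xform_def by blast
qed

lemma xform_const: "xform G \<Longrightarrow> xform (fls_const a * G)"
  unfolding xform_def by (metis cw_smult mult.left_commute)

lemma xform_0 [simp]: "xform 0"
  using xform_const[OF xform_exp, of 0] by simp

lemma xform_sum: "(\<And>i. i \<in> A \<Longrightarrow> xform (g i)) \<Longrightarrow> xform (\<Sum>i\<in>A. g i)"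
  by (induction A rule: infinite_finite_induct) (simp_all add: xform_add)

lemma xform_zpow:
  assumes "xform G"
  shows "xform (zpow k * G)"
proof -
  obtain n p where p: "zpow (int n) * G = cw p exp_ls" using assms unfolding xform_def by blast
  define m where "m = n + nat (- k)"
  have "zpow (int m) * (zpow k * G) = zpow (int (nat (int m + k))) * G"
    by (simp add: zpow_mult m_def flip: mult.assoc)
  also have "\<dots> = cw (p * monom 1 (nat (int m + k) - n)) exp_ls"
    by (rule xform_raise[OF p]) (cases "k \<le> 0"; simp add: m_def)
  finally show ?thesis unfolding xform_def by blast
qed

text \<open>The derivative in z commutes with operators in x and multiplies the exponential by x + 2
  y z; both factors can be absorbed into an operator in x and a power of z.\<close>

lemma xform_deriv:
  assumes "xform G"
  shows "xform (fls_deriv G)"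
proof -
  obtain n p where p: "zpow (int n) * G = cw p exp_ls" using assms unfolding xform_def by blast
  have "fls_deriv (zpow (int n) * G) = cw p (fls_const var_x * exp_ls) + cw p (fls_const (2 * var_y) * (zpow 1 * exp_ls))"
    by (simp add: p fls_deriv_exp cw_add flip: cw_fls_deriv)
  also have "cw p (fls_const var_x * exp_ls) = cw (dx.dmul p [:var_x:]) exp_ls" by (rule cw_const_arg)
  also have "cw p (fls_const (2 * var_y) * (zpow 1 * exp_ls)) = zpow 1 * cw (dx.dmul p [:2 * var_y:]) exp_ls"
    by (simp only: cw_const_arg cw_zpow)
  finally have d: "fls_deriv (zpow (int n) * G) =
      cw (dx.dmul p [:var_x:]) exp_ls + zpow 1 * cw (dx.dmul p [:2 * var_y:]) exp_ls" .
  have cwx: "xform (cw q exp_ls)" for q unfolding xform_def by (rule exI[of _ 0]) auto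
  have "xform (fls_deriv (zpow (int n) * G))" unfolding d by (intro xform_add xform_zpow cwx)
  \<comment> \<open>This cancels the product-rule term of the derivative of
    \<open>zpow (int n) * G\<close> and leaves \<open>zpow (int n) * fls_deriv G\<close>.\<close>
  moreover have "xform (fls_const (- of_int (int n)) * (zpow (int n - 1) * G))"
    by (intro xform_const xform_zpow assms)
  ultimately have "xform (fls_deriv (zpow (int n) * G) + fls_const (- of_int (int n)) * (zpow (int n - 1) * G))"
    by (rule xform_add)
  moreover have "fls_deriv (zpow (int n) * G) + fls_const (- of_int (int n)) * (zpow (int n - 1) * G)
      = zpow (int n) * fls_deriv G"
    by (simp add: fls_deriv_zpow fls_of_nat mult.assoc)
  ultimately have "xform (zpow (- int n) * (zpow (int n) * fls_deriv G))"
    using xform_zpow by metis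
  then show ?thesis by (simp add: zpow_mult flip: mult.assoc)
qed

lemma xform_ytensor:
  assumes "P \<in> ytensor zops" "xform G"
  shows "xform (P G)"
proof -
  have "xform (P G)" if "P \<in> zops" for P
  proof -
    obtain p where p: "\<forall>i. coeff p i \<in> laurent_polys" "P = dop fls_deriv p" using \<open>P \<in> zops\<close> by (auto simp: zops_iff)
    have m: "xform (a * F)" if "a \<in> laurent_polys" "xform F" for a F
      using that(1)
    proof (induction rule: laurent_induct)
      case (step c k a)
      have "xform (fls_const (of_C c) * (zpow k * F) + a * F)"
        by (intro xform_add xform_const xform_zpow that(2) step)
      then show ?case by (simp add: distrib_right mult.assoc)
    qed simp
    have "xform ((fls_deriv ^^ i) G)" for i
      by (induction i) (simp_all add: assms(2) xform_deriv)
    then show ?thesis unfolding p(2) dop_def by (intro xform_sum m) (use p(1) in auto)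
  qed
  moreover obtain n p where "P = (\<lambda>F. \<Sum>k\<le>n. fls_const (var_y ^ k) * p k F)" "\<forall>k\<le>n. p k \<in> zops"
    using assms(1) unfolding ytensor_def by blast
  ultimately show ?thesis by (auto intro!: xform_sum xform_const)
qed

text \<open>Here \<open>x\<close> acts on the exponential as \<open>\<partial>\<^sub>z - 2 y z\<close> and \<open>\<partial>\<^sub>x\<close> as \<open>z\<close>.\<close>

lemma polynomial_operator_transfer:
  "\<exists>P\<in>ytensor zops. cw (map_poly to_fract r) exp_ls = P exp_ls"
proof -
  define T where "T p \<longleftrightarrow> (\<exists>P\<in>ytensor zops. cw p exp_ls = P exp_ls)" for p
  have T0: "T 0" unfolding T_def by (rule bexI[OF _ zops.ytensor_base[OF zops.zero]]) simp
  have T_1: "T 1" unfolding T_def by (rule bexI[OF _ zops.ytensor_base[OF zops.id]]) simp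
  have T_add: "T (p + q)" if "T p" "T q" for p q
    using that zops.ytensor_add unfolding T_def by (fastforce simp: cw_op_add)
  have T_shift: "T (pCons 0 p)" if "T p" for p
  proof -
    obtain P where "P \<in> ytensor zops" "cw p exp_ls = P exp_ls" using \<open>T p\<close> unfolding T_def by blast
    then show ?thesis unfolding T_def
      by (intro bexI[OF _ zops.ytensor_comp[OF zops.ytensor_base[OF zops_zpow[of 1]]]]) (simp add: cw_shift_exp)
  qed
  have T_y: "T (smult (of_y c) p)" if "T p" for p c
  proof -
    obtain P where "P \<in> ytensor zops" "cw p exp_ls = P exp_ls" using \<open>T p\<close> unfolding T_def by blast
    then show ?thesis unfolding T_def
      by (intro bexI[OF _ zops.ytensor_scale[of P c]]) (simp_all add: cw_smult)
  qed
  have T_x: "T (smult var_x p)" if "T p" for p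
  proof -
    obtain P where P: "P \<in> ytensor zops" "cw p exp_ls = P exp_ls" using \<open>T p\<close> unfolding T_def by blast
    define X where "X = (\<lambda>F. fls_deriv F + fls_const (of_y [:0, - 2:]) * (zpow 1 * F))"
    have X: "X \<in> ytensor zops" unfolding X_def
      by (intro zops.ytensor_add zops.ytensor_scale zops.ytensor_base zops_deriv zops_zpow)
    have "of_y [:0, - 2:] = - (2 * var_y)"
    proof -
      have "of_y [:0, - 2:] = of_y (- ([:0, 1:] + [:0, 1:]))" by simp
      then show ?thesis by (simp only: of_y_minus of_y_simps) (simp add: var_y_def)
    qed
    then have "X exp_ls = fls_const var_x * exp_ls"
      by (simp add: X_def fls_deriv_exp algebra_simps)
    \<comment> \<open>\<open>P\<close> is linear over \<open>ratxy\<close>, so the factor x moves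
      inside and is realized by \<open>X\<close> before \<open>P\<close> acts: the order of the
      factors is reversed.\<close>
    then have "cw (smult var_x p) exp_ls = P (X exp_ls)"
      by (simp add: cw_smult P zops.ytensor_lin(2)[OF P(1)])
    then show ?thesis unfolding T_def using zops.ytensor_comp[OF P(1) X] by auto
  qed
  have T_poly: "T (smult (to_fract a) p)" if "T p" for a p
  proof (induction a)
    case 0
    then show ?case by (simp add: T0)
  next
    case (pCons c a)
    have "to_fract (pCons c a) = of_y c + var_x * to_fract a"
      by (simp add: of_y_to_fract var_x_to_fract flip: to_fract_mult to_fract_add)
    then have "smult (to_fract (pCons c a)) p =
        smult (of_y c) p + smult var_x (smult (to_fract a) p)"
      by (simp add: smult_add_left)
    then show ?case using T_add[OF T_y[OF that, of c] T_x[OF pCons(2)]] by simp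
  qed
  have "T (map_poly to_fract r)"
  proof (induction r)
    case 0
    then show ?case by (simp add: T0)
  next
    case (pCons a r)
    have "map_poly to_fract (pCons a r) = smult (to_fract a) 1 + pCons 0 (map_poly to_fract r)"
      by (simp add: map_poly_pCons)
    then show ?case using T_add[OF T_poly[OF T_1, of a] T_shift[OF pCons(2)]] by (simp only:)
  qed
  then show ?thesis by (simp add: T_def)
qed

section \<open>Rings of operators\<close>

text \<open>Additivity of the operators gives distributivity over sums in the right factor of a
  composition; on the left it holds pointwise.\<close>

lemma ring_op_ring:
  assumes zero: "(\<lambda>_. 0) \<in> A" and id: "id \<in> A"
    and add: "\<And>P Q. P \<in> A \<Longrightarrow> Q \<in> A \<Longrightarrow> (\<lambda>v. P v + Q v) \<in> A"
    and comp: "\<And>P Q. P \<in> A \<Longrightarrow> Q \<in> A \<Longrightarrow> P \<circ> Q \<in> A"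
    and neg: "\<And>P. P \<in> A \<Longrightarrow> (\<lambda>v. - P v) \<in> A"
    and lin: "\<And>P v w. P \<in> A \<Longrightarrow> P (v + w) = P v + P w"
  shows "ring (op_ring A)"
proof (rule ringI)
  show "abelian_group (op_ring A)"
  proof (rule abelian_groupI)
    fix P assume "P \<in> carrier (op_ring A)"
    then have "(\<lambda>v. - P v) \<in> carrier (op_ring A)" using neg by (simp add: op_ring_def)
    then show "\<exists>Q\<in>carrier (op_ring A). Q \<oplus>\<^bsub>op_ring A\<^esub> P = \<zero>\<^bsub>op_ring A\<^esub>"
      by (rule bexI[rotated]) (simp add: op_ring_def)
  qed (auto simp: op_ring_def zero add add.assoc add.commute)
  show "Group.monoid (op_ring A)"
    by (rule monoidI) (auto simp: op_ring_def id comp comp_assoc)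
qed (auto simp: op_ring_def fun_eq_iff lin)

interpretation yM: Modules.module "\<lambda>p g. of_y p * g"
  by (rule module_of_y)

section \<open>Partitions\<close>

locale partition =
  fixes lam :: "nat \<Rightarrow> nat"
  assumes is_partition: "is_partition lam"
begin

lemma lam_antimono: "1 \<le> i \<Longrightarrow> i \<le> j \<Longrightarrow> lam j \<le> lam i"
proof (induction j)
  case (Suc j)
  show ?case
  proof (cases "i = Suc j")
    case False
    then have "lam j \<le> lam i" "1 \<le> j" using Suc by auto
    then show ?thesis using is_partition le_trans unfolding is_partition_def by blast
  qed simp
qed simp

lemma nonzero_parts: "{i. 1 \<le> i \<and> lam i \<noteq> 0} = {1..plen lam}"
proof -
  define S where "S = {i. 1 \<le> i \<and> lam i \<noteq> 0}"
  have fin: "finite S" using is_partition unfolding S_def is_partition_def by blast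
  define n where "n = (if S = {} then 0 else Max S)"
  have "S = {1..n}"
  proof (cases "S = {}")
    case False
    then have n: "n = Max S" "n \<in> S" using fin by (simp_all add: n_def)
    show ?thesis
    proof (intro equalityI subsetI)
      show "i \<in> {1..n}" if "i \<in> S" for i using that fin n by (auto simp: S_def)
      fix i assume i: "i \<in> {1..n}"
      then have "lam n \<le> lam i" by (intro lam_antimono) auto
      then show "i \<in> S" using n(2) i by (auto simp: S_def)
    qed
  qed (simp add: n_def)
  moreover from this have "plen lam = n" unfolding plen_def S_def[symmetric] by simp
  ultimately show ?thesis by (simp add: S_def)
qed

lemma lam_eq_0: "i > plen lam \<Longrightarrow> lam i = 0"
  using nonzero_parts by (auto simp: set_eq_iff dest!: spec[of _ i])

lemma mseq_strict: "1 \<le> i \<Longrightarrow> i < j \<Longrightarrow> mseq lam j < mseq lam i"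
  using lam_antimono[of i j] by (simp add: mseq_def)

lemma int_kseq: "1 \<le> i \<Longrightarrow> i \<le> plen lam \<Longrightarrow> int (kseq lam i) = mseq lam i + int (plen lam)"
  by (simp add: kseq_def mseq_def)

definition "kl = map (kseq lam) (rev [1..<Suc (plen lam)])"

lemma set_kl: "set kl = kseq lam ` {1..plen lam}"
  by (auto simp: kl_def)

lemma length_kl [simp]: "length kl = plen lam"
  by (simp add: kl_def)

lemma distinct_kl: "distinct kl"
  unfolding kl_def distinct_map
proof
  show "inj_on (kseq lam) (set (rev [1..<Suc (plen lam)]))"
  proof (rule linorder_inj_onI)
    fix i j assume ij: "i < j" "i \<in> set (rev [1..<Suc (plen lam)])" "j \<in> set (rev [1..<Suc (plen lam)])"
    then have "mseq lam j < mseq lam i" by (intro mseq_strict) auto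
    then show "kseq lam i \<noteq> kseq lam j" using int_kseq[of i] int_kseq[of j] ij by auto
  qed auto
qed simp

sublocale hermite_wronskian kl
  by unfold_locales (rule distinct_kl)

lemma l_plen: "l = plen lam"
  by (simp add: l_def)

text \<open>For \<open>i \<le> l\<close> the numbers \<open>m_i\<close> are \<open>k_i - l\<close>;
  for \<open>i > l\<close> they are \<open>-i\<close> and exhaust the integers below
  \<open>-l\<close>.\<close>

lemma Jset_iff: "m \<in> Jset lam \<longleftrightarrow> (\<exists>n. n \<notin> set kl \<and> m = int n - int l)"
proof
  assume m: "m \<in> Jset lam"
  have "m \<ge> - int l"
  proof (rule ccontr)
    assume "\<not> m \<ge> - int l"
    then have "mseq lam (nat (- m)) = m" "nat (- m) \<ge> 1"
      using lam_eq_0[of "nat (- m)"] by (simp_all add: mseq_def l_plen)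
    then show False using m unfolding Jset_def by (metis DiffE atLeast_iff imageI)
  qed
  then have e: "m = int (nat (m + int l)) - int l" by simp
  moreover have "nat (m + int l) \<notin> set kl"
  proof
    assume "nat (m + int l) \<in> set kl"
    then obtain i where i: "1 \<le> i" "i \<le> plen lam" "nat (m + int l) = kseq lam i" by (auto simp: set_kl)
    then have "m = mseq lam i" using int_kseq[of i] e by (simp add: l_plen)
    then show False using m i unfolding Jset_def by auto
  qed
  ultimately show "\<exists>n. n \<notin> set kl \<and> m = int n - int l" by blast
next
  assume "\<exists>n. n \<notin> set kl \<and> m = int n - int l"
  then obtain n where n: "n \<notin> set kl" "m = int n - int l" by blast
  have "m \<noteq> mseq lam i" if "i \<ge> 1" for i
  proof (cases "i \<le> plen lam")
    case True
    then have "kseq lam i \<noteq> n" using n(1) that by (auto simp: set_kl)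
    then show ?thesis using int_kseq[OF that True] n(2) by (auto simp: l_plen)
  next
    case False
    then have "mseq lam i < - int l" using lam_eq_0[of i] by (simp add: mseq_def l_plen)
    then show ?thesis using n(2) by simp
  qed
  then show "m \<in> Jset lam" unfolding Jset_def by auto
qed

section \<open>The wave function and the functions R_m through one monic operator\<close>

lemma hermites_kl: "hermites lam = map to_fract (map hpoly kl)"
  by (simp add: hermites_def kl_def hermite_hpoly)

lemma wop_hermites: "wop dx (hermites lam) = map_poly to_fract b"
  unfolding hermites_kl b_def
  by (rule wop_hom) (unfold_locales, simp_all add: dx_to_fract)

lemma wronskian_hermites: "wronskian dx (hermites lam) = to_fract tau"
proof -
  have "length (hermites lam) = l" by (simp add: hermites_kl l_def)
  then have "wronskian dx (hermites lam) = coeff (map_poly to_fract b) l"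
    using coeff_wop_top[of dx "hermites lam"] wop_hermites by simp
  then show ?thesis by (simp add: coeff_map_poly coeff_b_l)
qed

text \<open>The monic operator \<open>T\<close>, with rational coefficients.\<close>

definition t :: "ratxy poly" where
  "t = smult (inverse (to_fract tau)) (map_poly to_fract b)"

lemma degree_t: "degree t = l" and coeff_t: "coeff t l = 1"
  by (simp_all add: t_def degree_map_poly coeff_map_poly coeff_b_l)

lemma dop_t: "dop dx t (to_fract f) = inverse (to_fract tau) * to_fract (dop pderiv b f)"
  by (simp add: t_def dop_smult dop_to_fract)

lemma dop_t_wronskian: "dop dx t f = wronskian dx (hermites lam @ [f]) / wronskian dx (hermites lam)"
  by (simp add: t_def dop_smult wronskian_hermites divide_inverse flip: wop_hermites dop_wop)

lemma dop_t_kernel: "k \<in> set kl \<Longrightarrow> dop dx t (hermite k) = 0"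
  by (simp add: hermite_hpoly dop_t dop_b_kernel)

lemma coeffwise_dx_funpow_nth: "fls_nth ((coeffwise dx ^^ i) F) n = (dx ^^ i) (fls_nth F n)"
  by (induction i) (simp_all add: coeffwise_nth)

text \<open>The Wronskian is expanded along the column of the exponential; the cofactors are
  constant Laurent series, so the expansion is the coefficientwise action of an operator in
  x.\<close>

lemma Psi_cw: "Psi lam = zpow (- int l) * cw t exp_ls"
proof -
  have hom: "comm_ring_hom (fls_const :: ratxy \<Rightarrow> lseries)"
    by unfold_locales (simp_all add: fls_plus_const)
  have "wronskian (coeffwise dx) (map fls_const (hermites lam) @ [exp_ls]) =
      dop (coeffwise dx) (map_poly fls_const (wop dx (hermites lam))) exp_ls"
    unfolding dop_wop[symmetric]
    by (subst wop_hom[OF hom]) (auto intro!: fls_eqI simp: coeffwise_nth)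
  also have "\<dots> = cw (wop dx (hermites lam)) exp_ls"
  proof (rule fls_eqI)
    fix n
    define p where "p = wop dx (hermites lam)"
    have "degree (map_poly fls_const p) \<le> degree p" by (intro degree_le) (simp add: coeff_map_poly coeff_eq_0)
    then show "fls_nth (dop (coeffwise dx) (map_poly fls_const (wop dx (hermites lam))) exp_ls) n = fls_nth (cw (wop dx (hermites lam)) exp_ls) n"
      unfolding p_def[symmetric]
      by (simp add: dop_bound[of _ "degree p"] fls_nth_sum coeff_map_poly coeffwise_dx_funpow_nth)
  qed
  also have "\<dots> = fls_const (to_fract tau) * cw t exp_ls"
    by (simp add: t_def cw_smult wop_hermites fls_const_mult_const flip: mult.assoc)
  finally have w: "wronskian (coeffwise dx) (map fls_const (hermites lam) @ [exp_ls]) = fls_const (to_fract tau) * cw t exp_ls" .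
  have X: "fls_X ^ plen lam = zpow (int l)"
    by (rule fls_eqI) (simp add: l_plen)
  have "Psi lam = (fls_const (to_fract tau) * cw t exp_ls) / (zpow (int l) * fls_const (to_fract tau))"
    unfolding Psi_def exp_ls_def[symmetric] w X wronskian_hermites ..
  also have "\<dots> = cw t exp_ls / zpow (int l)"
    by (simp add: mult.commute)
  also have "\<dots> = zpow (- int l) * cw t exp_ls"
  proof -
    have "zpow (int l) * (zpow (- int l) * cw t exp_ls) = cw t exp_ls" by (simp add: zpow_mult flip: mult.assoc)
    then show ?thesis by (metis nonzero_mult_div_cancel_left zpow_nonzero)
  qed
  finally show ?thesis .
qed

lemma Psi_nth: "fls_nth (Psi lam) m = (if m < - int l then 0 else dop dx t (exp_series $ nat (m + int l)))"
  by (auto simp: Psi_cw exp_ls_nth)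

lemma dop_t_exp: "dop dx t (exp_series $ n) = of_C (1 / fact n) * dop dx t (hermite n)"
  unfolding exp_series_hermite by (rule dx.dop_arg_const_mult) simp

text \<open>Outside \<open>Jset lam\<close> either the exponential contributes nothing or its
  coefficient is a Hermite polynomial in the kernel of \<open>T\<close>.\<close>

lemma Psi_off_J: "m \<notin> Jset lam \<Longrightarrow> fls_nth (Psi lam) m = 0"
proof -
  assume m: "m \<notin> Jset lam"
  show ?thesis
  proof (cases "m < - int l")
    case False
    then have "nat (m + int l) \<in> set kl" using m Jset_iff[of m] by force
    then show ?thesis using False by (simp add: Psi_nth dop_t_exp dop_t_kernel)
  qed (simp add: Psi_nth)
qed

lemma Rfun_dop_t:
  assumes "m \<in> Jset lam"
  obtains z :: int where "z \<noteq> 0" "Rfun lam m = of_C (1 / of_int z) * dop dx t (hermite (nat (m + int l)))"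
proof -
  define z where "z = (\<Prod>i = 1..plen lam. m - mseq lam i)"
  have z0: "z \<noteq> 0" using assms unfolding z_def Jset_def by auto
  have "of_C (of_int z) * of_C (1 / of_int z) = 1"
    using z0 by (simp add: of_C_simps flip: of_C_simps(2))
  moreover have "of_C (of_int z) = of_int z" using of_C_closed(2)[of z] by simp
  ultimately have "1 / of_int z = of_C (1 / of_int z)"
    using z0 by (simp add: field_simps)
  then have "Rfun lam m = of_C (1 / of_int z) * dop dx t (hermite (nat (m + int l)))"
    unfolding Rfun_def dop_t_wronskian l_plen by (simp add: z_def)
  with z0 show ?thesis by (rule that)
qed

text \<open>The constant is the product of all \<open>m - m_i\<close> with \<open>i \<le> l\<close>,
  divided by \<open>(m + l)!\<close>. It is nonzero because \<open>m\<close> differs from every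
  \<open>m_i\<close>.\<close>

lemma Psi_Rfun:
  obtains c where "\<And>m. m \<in> Jset lam \<Longrightarrow> c m \<noteq> 0 \<and> fls_nth (Psi lam) m = of_C (c m) * Rfun lam m"
proof -
  have "\<exists>c. c \<noteq> 0 \<and> fls_nth (Psi lam) m = of_C c * Rfun lam m" if m: "m \<in> Jset lam" for m
  proof -
    obtain z :: int where z: "z \<noteq> 0" "Rfun lam m = of_C (1 / of_int z) * dop dx t (hermite (nat (m + int l)))"
      using m by (rule Rfun_dop_t)
    define n where "n = nat (m + int l)"
    have "\<not> m < - int l" using m Jset_iff[of m] by auto
    then have "fls_nth (Psi lam) m = of_C (1 / fact n) * dop dx t (hermite n)"
      by (simp add: Psi_nth dop_t_exp n_def)
    also have "of_C (1 / fact n) = of_C (of_int z / fact n) * of_C (1 / of_int z)"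
      using z(1) by (simp flip: of_C_simps)
    finally have "fls_nth (Psi lam) m = of_C (of_int z / fact n) * Rfun lam m"
      using z(2) by (simp add: n_def mult.assoc)
    moreover have "of_int z / fact n \<noteq> (0::complex)" using z(1) by simp
    ultimately show ?thesis by blast
  qed
  then show ?thesis using that by metis
qed

subsection \<open>The space spanned by the exceptional Hermite functions\<close>

text \<open>The degree comes from \<open>degree_dop_b\<close> at \<open>n = m + l\<close>; it
  determines \<open>m\<close>.\<close>

lemma tau_Rfun:
  assumes "m \<in> Jset lam"
  obtains r where "to_fract tau * Rfun lam m = to_fract r" "r \<noteq> 0" "int (degree r) = int N + m"
proof -
  obtain z :: int where z: "z \<noteq> 0" "Rfun lam m = of_C (1 / of_int z) * dop dx t (hermite (nat (m + int l)))"
    using assms by (rule Rfun_dop_t)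
  obtain n where n: "n \<notin> set kl" "m = int n - int l" using assms Jset_iff by blast
  define r where "r = smult [:1 / of_int z:] (dop pderiv b (hpoly n))"
  have nn: "nat (m + int l) = n" using n by simp
  have "to_fract tau * Rfun lam m = of_C (1 / of_int z) * to_fract (dop pderiv b (hpoly n))"
    unfolding z(2) nn hermite_hpoly dop_t by simp
  also have "\<dots> = to_fract r"
    by (simp add: of_C_to_fract r_def flip: to_fract_mult)
  finally have e: "to_fract tau * Rfun lam m = to_fract r" .
  have d: "dop pderiv b (hpoly n) \<noteq> 0" "int (degree (dop pderiv b (hpoly n))) = int n + (int N - int l)"
    using degree_dop_b[OF n(1), of "hpoly n"] by simp_all
  show ?thesis by (rule that[OF e]) (use z d n in \<open>auto simp: r_def\<close>)
qed

lemma sum_distinct_degrees: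
  fixes r :: "'b \<Rightarrow> 'a::idom poly"
  assumes "finite A" "A \<noteq> {}" "\<And>m. m \<in> A \<Longrightarrow> s m \<noteq> 0 \<and> r m \<noteq> 0" "inj_on (\<lambda>m. degree (r m)) A"
  obtains m where "m \<in> A" "(\<Sum>m\<in>A. smult (s m) (r m)) \<noteq> 0"
    "degree (\<Sum>m\<in>A. smult (s m) (r m)) = degree (r m)"
proof -
  define d where "d = Max ((\<lambda>m. degree (r m)) ` A)"
  have "d \<in> (\<lambda>m. degree (r m)) ` A" unfolding d_def using assms by (intro Max_in) auto
  then obtain m where m: "m \<in> A" "degree (r m) = d" by auto
  have le: "degree (r k) \<le> d" if "k \<in> A" for k unfolding d_def using that assms by (intro Max_ge) auto
  define f where "f = (\<Sum>m\<in>A. smult (s m) (r m))"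
  have "coeff f d = (\<Sum>k\<in>A. s k * coeff (r k) d)" by (simp add: f_def coeff_sum)
  also have "\<dots> = (\<Sum>k\<in>{m}. s k * coeff (r k) d)"
  proof (rule sum.mono_neutral_right)
    show "\<forall>k\<in>A - {m}. s k * coeff (r k) d = 0"
    proof
      fix k assume k: "k \<in> A - {m}"
      then have "degree (r k) \<noteq> d" using assms(4) m by (auto dest: inj_onD)
      then have "degree (r k) < d" using le[of k] k by simp
      then show "s k * coeff (r k) d = 0" by (simp add: coeff_eq_0)
    qed
  qed (use assms m in auto)
  finally have "coeff f d \<noteq> 0" using assms(3)[OF m(1)] m(2) by auto
  moreover have "degree f \<le> d" unfolding f_def
    by (rule degree_sum_le) (use assms le in \<open>auto intro: order.trans[OF degree_smult_le]\<close>)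
  ultimately have "degree f = d" "f \<noteq> 0" using le_degree by (auto intro: antisym)
  then show ?thesis using that m unfolding f_def by auto
qed

text \<open>Multiplied by \<open>tau\<close>, distinct functions have distinct degrees in x, so
  coefficients in y cannot cancel the highest one. Both independence and the admissible degrees
  follow from this.\<close>

lemma Rfun_combination:
  assumes "finite A" "A \<noteq> {}" "A \<subseteq> Jset lam" "\<And>m. m \<in> A \<Longrightarrow> s m \<noteq> 0"
  obtains m f where "m \<in> A" "to_fract tau * (\<Sum>m\<in>A. of_y (s m) * Rfun lam m) = to_fract f" "f \<noteq> 0"
    "int (degree f) = int N + m"
proof -
  have "\<exists>r. to_fract tau * Rfun lam m = to_fract r \<and> r \<noteq> 0 \<and> int (degree r) = int N + m" if "m \<in> Jset lam" for m
    using tau_Rfun[OF that] by metis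
  then obtain r where r: "\<And>m. m \<in> Jset lam \<Longrightarrow> to_fract tau * Rfun lam m = to_fract (r m) \<and> r m \<noteq> 0 \<and> int (degree (r m)) = int N + m"
    by metis
  have inj: "inj_on (\<lambda>m. degree (r m)) A"
  proof (rule inj_onI)
    fix i j assume ij: "i \<in> A" "j \<in> A" "degree (r i) = degree (r j)"
    have "i \<in> Jset lam" "j \<in> Jset lam" using ij assms(3) by auto
    then have "int (degree (r i)) = int N + i" "int (degree (r j)) = int N + j" using r by blast+
    then show "i = j" using ij(3) by linarith
  qed
  have sr: "s m \<noteq> 0 \<and> r m \<noteq> 0" if m: "m \<in> A" for m
    using assms(4)[OF m] r[OF subsetD[OF assms(3) m]] by simp
  obtain m where m: "m \<in> A" "(\<Sum>m\<in>A. smult (s m) (r m)) \<noteq> 0"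
    "degree (\<Sum>m\<in>A. smult (s m) (r m)) = degree (r m)"
    by (rule sum_distinct_degrees[OF assms(1,2) sr inj]) (assumption | rule that)+
  have "to_fract tau * (\<Sum>m\<in>A. of_y (s m) * Rfun lam m) = (\<Sum>m\<in>A. of_y (s m) * (to_fract tau * Rfun lam m))"
    by (simp add: sum_distrib_left algebra_simps)
  also have "\<dots> = (\<Sum>m\<in>A. of_y (s m) * to_fract (r m))"
    by (rule sum.cong) (use r assms(3) in auto)
  also have "\<dots> = to_fract (\<Sum>m\<in>A. smult (s m) (r m))"
    by (simp add: to_fract_sum of_y_to_fract flip: to_fract_mult)
  finally have e: "to_fract tau * (\<Sum>m\<in>A. of_y (s m) * Rfun lam m) = to_fract (\<Sum>m\<in>A. smult (s m) (r m))" .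
  have "int (degree (r m)) = int N + m" using r[OF subsetD[OF assms(3) m(1)]] by blast
  then show ?thesis using m(3) by (intro that[OF m(1) e m(2)]) (simp only:)
qed

lemma Rfun_independent:
  assumes "finite A" "A \<subseteq> Jset lam" "(\<Sum>m\<in>A. of_y (s m) * Rfun lam m) = 0" "m \<in> A"
  shows "s m = 0"
proof (rule ccontr)
  assume "s m \<noteq> 0"
  define B where "B = {m \<in> A. s m \<noteq> 0}"
  have "(\<Sum>m\<in>B. of_y (s m) * Rfun lam m) = (\<Sum>m\<in>A. of_y (s m) * Rfun lam m)"
    by (rule sum.mono_neutral_left) (use assms in \<open>auto simp: B_def\<close>)
  then have z: "(\<Sum>m\<in>B. of_y (s m) * Rfun lam m) = 0" using assms by simp
  have B: "finite B" "B \<noteq> {}" "B \<subseteq> Jset lam" "\<And>m. m \<in> B \<Longrightarrow> s m \<noteq> 0"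
    using assms \<open>s m \<noteq> 0\<close> by (auto simp: B_def)
  obtain k f where "to_fract tau * (\<Sum>m\<in>B. of_y (s m) * Rfun lam m) = to_fract f" "f \<noteq> 0"
    by (rule Rfun_combination[OF B]) (assumption | rule that)+
  then show False using z by simp
qed

text \<open>Invariance of \<open>Wstar lam\<close> is used in this form: the first conclusion
  provides polynomial coefficients, the second the missing degrees for
  \<open>low_operator_zero\<close>.\<close>

lemma Wstar_gaps:
  assumes "g \<in> Wstar lam"
  obtains f where "to_fract tau * g = to_fract f"
    "f \<noteq> 0 \<Longrightarrow> \<exists>k. k \<notin> set kl \<and> int (degree f) = int N + int k - int l"
proof (cases "g = 0")
  case True
  then show ?thesis using that[of 0] by simp
next
  case False
  obtain S u where S: "finite S" "S \<subseteq> Rfun lam ` Jset lam" "g = (\<Sum>v\<in>S. of_y (u v) * v)"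
    using assms unfolding Wstar_def yM.span_explicit by blast
  obtain C where C: "C \<subseteq> Jset lam" "inj_on (Rfun lam) C" "S = Rfun lam ` C"
    using S(2) unfolding subset_image_inj by blast
  have finC: "finite C" using S(1) C finite_imageD by blast
  define s where "s m = u (Rfun lam m)" for m
  define A where "A = {m \<in> C. s m \<noteq> 0}"
  have "g = (\<Sum>m\<in>C. of_y (s m) * Rfun lam m)" by (simp add: S(3) C(3) sum.reindex[OF C(2)] s_def)
  also have "\<dots> = (\<Sum>m\<in>A. of_y (s m) * Rfun lam m)"
    by (rule sum.mono_neutral_right) (auto simp: A_def finC)
  finally have g: "g = (\<Sum>m\<in>A. of_y (s m) * Rfun lam m)" .
  have A: "finite A" "A \<noteq> {}" "A \<subseteq> Jset lam" "\<And>m. m \<in> A \<Longrightarrow> s m \<noteq> 0"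
  proof -
    show "A \<noteq> {}" using False g by auto
  qed (use finC C(1) in \<open>auto simp: A_def\<close>)
  obtain m f where mf: "m \<in> A" "to_fract tau * (\<Sum>m\<in>A. of_y (s m) * Rfun lam m) = to_fract f" "f \<noteq> 0"
    "int (degree f) = int N + m"
    by (rule Rfun_combination[OF A]) (assumption | rule that)+
  have "m \<in> Jset lam" using mf(1) C(1) by (auto simp: A_def)
  then show ?thesis using that[of f] mf g Jset_iff[of m] by auto
qed

lemma Wstar_of_y: "g \<in> Wstar lam \<Longrightarrow> of_y p * g \<in> Wstar lam"
  unfolding Wstar_def by (rule yM.span_scale)

lemma Wstar_add: "g \<in> Wstar lam \<Longrightarrow> h \<in> Wstar lam \<Longrightarrow> g + h \<in> Wstar lam"
  unfolding Wstar_def by (rule yM.span_add)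

lemma Wstar_diff: "g \<in> Wstar lam \<Longrightarrow> h \<in> Wstar lam \<Longrightarrow> g - h \<in> Wstar lam"
  unfolding Wstar_def by (rule yM.span_diff)

lemma Wstar_0 [simp]: "0 \<in> Wstar lam"
  unfolding Wstar_def by (rule yM.span_zero)

lemma Wstar_sum: "(\<And>i. i \<in> A \<Longrightarrow> g i \<in> Wstar lam) \<Longrightarrow> (\<Sum>i\<in>A. g i) \<in> Wstar lam"
  unfolding Wstar_def by (rule yM.span_sum)

lemma Wstar_Rfun: "m \<in> Jset lam \<Longrightarrow> Rfun lam m \<in> Wstar lam"
  unfolding Wstar_def by (rule yM.span_base) simp

lemma Psi_in_Wstar: "fls_nth (Psi lam) m \<in> Wstar lam"
proof (cases "m \<in> Jset lam")
  case True
  obtain c where "\<And>m. m \<in> Jset lam \<Longrightarrow> c m \<noteq> 0 \<and> fls_nth (Psi lam) m = of_C (c m) * Rfun lam m"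
    by (rule Psi_Rfun) blast
  then show ?thesis using True Wstar_of_y[OF Wstar_Rfun] by (simp add: of_C_def)
qed (simp add: Psi_off_J)

lemma hermite_exp_series: "hermite n = of_C (fact n) * exp_series $ n"
  unfolding exp_series_hermite by (simp flip: of_C_simps mult.assoc)

text \<open>On Hermite polynomials the value is a multiple of a coefficient of \<open>Psi\<close>,
  and Hermite polynomials span.\<close>

lemma dop_t_in_Wstar: "dop dx t (to_fract f) \<in> Wstar lam"
proof (induction f rule: poly_hermite_induct)
  case (hermite n)
  have "fls_nth (Psi lam) (int n - int l) \<in> Wstar lam" by (rule Psi_in_Wstar)
  then have "of_C (fact n) * dop dx t (exp_series $ n) \<in> Wstar lam"
    using Wstar_of_y by (simp add: Psi_nth of_C_def)
  then show ?case unfolding hermite_hpoly[symmetric] hermite_exp_series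
    by (subst dx.dop_arg_const_mult) simp_all
next
  case (scale c f)
  have "to_fract (smult c f) = of_y c * to_fract f"
    by (simp add: of_y_to_fract flip: to_fract_mult)
  then show ?case using Wstar_of_y[OF scale] by (simp add: dx.dop_arg_const_mult)
qed (simp_all add: dx.dop_arg_add Wstar_add)

end

section \<open>Operators in z are determined by their action on large powers of z\<close>

lemma fls_deriv_funpow_zpow: "(fls_deriv ^^ i) (zpow (int n)) = fall (of_nat n) i * zpow (int n - int i)"
proof (induction i)
  case 0
  then show ?case by (simp add: fall_def)
next
  case (Suc i)
  have "fls_deriv (fall (of_nat n) i :: lseries) = 0"
    unfolding fall_def
  proof (induction i)
    case (Suc i)
    then show ?case by (simp add: fls_deriv_of_nat del: fls_deriv_mult) (simp add: Suc)
  qed simp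
  moreover have "int n - int (Suc i) = int n - int i - 1" by simp
  ultimately show ?case using Suc
    by (simp only: funpow.simps o_apply fls_deriv_mult fls_deriv_zpow) (simp add: fall_def mult.assoc)
qed

text \<open>With \<open>c j = coeff p j * z^(-j)\<close>, the value on \<open>z^n\<close> is
  \<open>z^n\<close> times a combination of falling factorials of \<open>n\<close> over the Laurent
  series; it has too many roots.\<close>

lemma dop_fls_deriv_eq_0:
  assumes "\<And>n. n \<ge> n0 \<Longrightarrow> dop fls_deriv p (zpow (int n)) = 0"
  shows "p = 0"
proof (rule poly_eqI)
  fix i
  define c where "c j = coeff p j * zpow (- int j)" for j
  have z: "(\<Sum>j\<le>degree p. c j * fall (of_nat n) j) = 0" if "n \<in> {n0..n0 + degree p}" for n
  proof -
    have "0 = dop fls_deriv p (zpow (int n))" using assms that by simp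
    also have "\<dots> = (\<Sum>j\<le>degree p. coeff p j * (fall (of_nat n) j * zpow (int n - int j)))"
      by (simp add: dop_def fls_deriv_funpow_zpow)
    also have "\<dots> = zpow (int n) * (\<Sum>j\<le>degree p. c j * fall (of_nat n) j)"
      unfolding sum_distrib_left c_def
    proof (rule sum.cong[OF refl])
      fix j
      have "zpow (int n - int j) = zpow (int n) * zpow (- int j)" by (simp add: zpow_mult)
      then show "coeff p j * (fall (of_nat n) j * zpow (int n - int j)) =
          zpow (int n) * (coeff p j * zpow (- int j) * fall (of_nat n) j)" by (simp only: mult_ac)
    qed
    finally show ?thesis by simp
  qed
  have "c j = 0" if "j \<le> degree p" for j
    by (rule fall_combination_zero[where A="{n0..n0 + degree p}" and d="degree p" and c=c]) (use z that in auto)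
  then have "coeff p i = 0" if "i \<le> degree p" using that by (auto simp: c_def)
  then show "coeff p i = coeff 0 i" by (cases "i \<le> degree p") (auto simp: coeff_eq_0)
qed

lemma ytensor_zops_dop:
  assumes "P \<in> ytensor zops"
  obtains p where "P = dop fls_deriv p"
proof -
  obtain n Q where Q: "P = (\<lambda>F. \<Sum>k\<le>n. fls_const (var_y ^ k) * Q k F)" "\<forall>k\<le>n. Q k \<in> zops"
    using assms unfolding ytensor_def by blast
  have "\<forall>k. \<exists>q. k \<le> n \<longrightarrow> Q k = dop fls_deriv q" using Q(2) by (metis zops_iff)
  then obtain q where q: "\<And>k. k \<le> n \<Longrightarrow> Q k = dop fls_deriv (q k)" by metis
  have "P = dop fls_deriv (\<Sum>k\<le>n. smult (fls_const (var_y ^ k)) (q k))"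
    unfolding Q(1) by (rule ext) (simp add: dop_sum dop_smult q)
  then show ?thesis by (rule that)
qed

section \<open>The space W and the operators preserving it\<close>

lemma laurent_finite_support:
  "f \<in> laurent_polys \<Longrightarrow> finite {m. fls_nth f m \<noteq> 0} \<and> range (fls_nth f) \<subseteq> range of_C"
proof (induction rule: laurent_induct)
  case zero
  then show ?case using of_C_closed(1) by (auto intro: range_eqI[of _ _ 0])
next
  case (step c k a)
  have "{m. fls_nth (fls_const (of_C c) * zpow k + a) m \<noteq> 0} \<subseteq> insert k {m. fls_nth a m \<noteq> 0}" by auto
  then have "finite {m. fls_nth (fls_const (of_C c) * zpow k + a) m \<noteq> 0}"
    using step finite_subset by blast
  moreover have "fls_nth (fls_const (of_C c) * zpow k + a) m \<in> range of_C" for m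
  proof -
    obtain d where "fls_nth a m = of_C d" using step by blast
    then show ?thesis by (auto simp flip: of_C_simps)
  qed
  ultimately show ?case by blast
qed

lemma W_def': "W lam = sC.span (zpow ` Jset lam)"
  by (simp add: W_def zpow_def[abs_def])

lemma W_iff: "f \<in> W lam \<longleftrightarrow> f \<in> laurent_polys \<and> (\<forall>m. m \<notin> Jset lam \<longrightarrow> fls_nth f m = 0)"
proof
  assume "f \<in> W lam"
  then show "f \<in> laurent_polys \<and> (\<forall>m. m \<notin> Jset lam \<longrightarrow> fls_nth f m = 0)"
    unfolding W_def'
    by (induction rule: sC.span_induct_alt)
       (auto simp: scale_C_def laurent_const laurent_add laurent_zpow split: if_splits)
next
  assume f: "f \<in> laurent_polys \<and> (\<forall>m. m \<notin> Jset lam \<longrightarrow> fls_nth f m = 0)"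
  define S where "S = {m. fls_nth f m \<noteq> 0}"
  have S: "finite S" "S \<subseteq> Jset lam" using laurent_finite_support[of f] f by (auto simp: S_def)
  have "\<forall>m. \<exists>c. fls_nth f m = of_C c" using laurent_finite_support[of f] f by blast
  then obtain c where c: "\<And>m. fls_nth f m = of_C (c m)" by metis
  have "f = (\<Sum>m\<in>S. scale_C (c m) (zpow m))"
  proof (rule fls_eqI)
    fix k
    have "fls_nth (\<Sum>m\<in>S. scale_C (c m) (zpow m)) k = (\<Sum>m\<in>S. if m = k then fls_nth f m else 0)"
      unfolding fls_nth_sum by (rule sum.cong) (auto simp: scale_C_def c)
    also have "\<dots> = fls_nth f k" using S(1) by (simp add: S_def)
    finally show "fls_nth f k = fls_nth (\<Sum>m\<in>S. scale_C (c m) (zpow m)) k" by simp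
  qed
  also have "\<dots> \<in> sC.span (zpow ` Jset lam)"
    by (intro sC.span_sum sC.span_scale sC.span_base) (use S in auto)
  finally show "f \<in> W lam" by (simp add: W_def')
qed

lemma zops_laurent:
  assumes "P \<in> zops" "f \<in> laurent_polys"
  shows "P f \<in> laurent_polys"
proof -
  obtain p where p: "\<forall>i. coeff p i \<in> laurent_polys" "P = dop fls_deriv p" using assms(1) by (auto simp: zops_iff)
  have d: "(fls_deriv ^^ i) f \<in> laurent_polys" for i
    by (induction i) (simp_all add: assms(2) laurent_deriv)
  have sum: "(\<Sum>i\<in>A. g i) \<in> laurent_polys" if "\<And>i. g i \<in> laurent_polys" for A :: "nat set" and g
    by (induction A rule: infinite_finite_induct) (simp_all add: laurent_add that)
  show ?thesis unfolding p(2) dop_def by (intro sum laurent_mult d p(1)[rule_format])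
qed

lemma A_alg_iff: "P \<in> A_alg lam \<longleftrightarrow> P \<in> zops \<and> (\<forall>f\<in>W lam. P f \<in> W lam)"
  by (auto simp: A_alg_def zops_def)

text \<open>Preserving the span means that the matrix block leading from \<open>Jset lam\<close> to
  its complement is zero.\<close>

lemma A_alg_base:
  assumes "P \<in> zops" "\<And>j m. j \<in> Jset lam \<Longrightarrow> m \<notin> Jset lam \<Longrightarrow> fls_nth (P (zpow j)) m = 0"
  shows "P \<in> A_alg lam"
  unfolding A_alg_iff
proof (intro conjI ballI assms(1))
  fix f assume "f \<in> W lam"
  then show "P f \<in> W lam" unfolding W_def'
  proof (induction rule: sC.span_induct_alt)
    case base
    then show ?case using zops_lin(2)[OF assms(1), of 0 0] by (simp add: sC.span_zero)
  next
    case (step c x y)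
    then obtain j where j: "j \<in> Jset lam" "x = zpow j" by blast
    have "P (zpow j) \<in> W lam" unfolding W_iff
      using zops_laurent[OF assms(1) laurent_zpow] assms(2)[OF j(1)] by blast
    then have "scale_C c (P x) \<in> sC.span (zpow ` Jset lam)" unfolding W_def' j(2) by (rule sC.span_scale)
    moreover have "P (scale_C c x + y) = scale_C c (P x) + P y"
      by (simp add: scale_C_def zops_lin[OF assms(1)])
    ultimately show ?case using step(2) sC.span_add by metis
  qed
qed

lemma W_closed:
  "0 \<in> W lam" "f \<in> W lam \<Longrightarrow> g \<in> W lam \<Longrightarrow> f + g \<in> W lam"
  "f \<in> W lam \<Longrightarrow> fls_const (of_C c) * f \<in> W lam"
  by (auto simp: W_iff laurent_add laurent_const)

lemma op_family_A_alg: "op_family (A_alg lam)"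
proof
  show "(\<lambda>F. 0) \<in> A_alg lam" "(\<lambda>F. F) \<in> A_alg lam"
    by (simp_all add: A_alg_iff zops.zero zops.id W_closed)
  fix P Q c F G a assume P: "P \<in> A_alg lam"
  then show "(\<lambda>F. fls_const (of_C c) * P F) \<in> A_alg lam"
    by (simp add: A_alg_iff zops.scale W_closed)
  show "P (F + G) = P F + P G" "P (fls_const a * F) = fls_const a * P F"
    using P zops_lin by (auto simp: A_alg_iff)
  assume "Q \<in> A_alg lam"
  then show "(\<lambda>F. P F + Q F) \<in> A_alg lam" "(\<lambda>F. P (Q F)) \<in> A_alg lam"
    using P by (simp_all add: A_alg_iff zops.add zops.comp W_closed)
qed

lemma A_alg_y_zops: "A_alg_y lam \<subseteq> ytensor zops"
  unfolding A_alg_y_ytensor ytensor_def using A_alg_iff by blast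

section \<open>Testing operators on the wave function alone\<close>

context partition
begin

interpretation A: op_family "A_alg lam"
  by (rule op_family_A_alg)

text \<open>Coefficient \<open>m\<close> of the image of \<open>Psi\<close> is a combination of the
  functions R_k over \<open>\<complex>[y]\<close>, weighted by row \<open>m\<close> of the matrix
  and nonzero constants. By independence every entry of the row in a column of
  \<open>Jset lam\<close> vanishes.\<close>

lemma Psi_block:
  assumes P: "P \<in> ytensor zops" and z: "fls_nth (P (Psi lam)) m = 0" and j: "j \<in> Jset lam"
  shows "fls_nth (P (zpow j)) m = 0"
proof -
  obtain B where B: "\<And>m k. fls_nth (P (zpow k)) m \<in> range of_y"
    "\<And>F m. fls_nth (P F) m = (\<Sum>k\<in>{m - B..m + B}. fls_nth (P (zpow k)) m * fls_nth F k)"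
    by (rule bandop_matrix[OF coeff_ring_of_y bandop_ytensor[OF P]]) (rule that)
  have "\<forall>k. \<exists>s. fls_nth (P (zpow k)) m = of_y s" using B(1) by blast
  then obtain s where s: "\<And>k. fls_nth (P (zpow k)) m = of_y (s k)" by metis
  obtain c where c: "\<And>m. m \<in> Jset lam \<Longrightarrow> c m \<noteq> 0 \<and> fls_nth (Psi lam) m = of_C (c m) * Rfun lam m"
    by (rule Psi_Rfun) (rule that)
  define A where "A = {m - B..m + B} \<inter> Jset lam"
  show ?thesis
  proof (cases "j \<in> A")
    case True
    have "(\<Sum>k\<in>A. of_y (s k * [:c k:]) * Rfun lam k) = (\<Sum>k\<in>A. of_y (s k) * fls_nth (Psi lam) k)"
    proof (rule sum.cong[OF refl])
      fix k assume "k \<in> A"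
      then have "k \<in> Jset lam" by (simp add: A_def)
      then have "fls_nth (Psi lam) k = of_C (c k) * Rfun lam k" using c by blast
      then show "of_y (s k * [:c k:]) * Rfun lam k = of_y (s k) * fls_nth (Psi lam) k"
        by (simp only: of_y_simps(2) of_C_def mult.assoc)
    qed
    also have "\<dots> = (\<Sum>k\<in>{m - B..m + B}. of_y (s k) * fls_nth (Psi lam) k)"
      by (rule sum.mono_neutral_left) (auto simp: A_def Psi_off_J)
    also have "\<dots> = 0" using z B(2)[of "Psi lam" m] s by simp
    finally have "s j * [:c j:] = 0"
      by (rule Rfun_independent[rotated 2]) (use True in \<open>auto simp: A_def\<close>)
    then show ?thesis using c[OF j] s by auto
  next
    case False
    then have jB: "j \<notin> {m - B..m + B}" using j by (simp add: A_def)
    have "fls_nth (P (zpow j)) m = (\<Sum>k\<in>{m - B..m + B}. fls_nth (P (zpow k)) m * fls_nth (zpow j) k)"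
      by (rule B(2))
    also have "\<dots> = 0" by (rule sum.neutral) (use jB in auto)
    finally show ?thesis .
  qed
qed

text \<open>One direction reads off the zero block. Conversely \<open>Psi_block\<close> makes the
  block of \<open>P\<close> vanish; its entries are polynomials in y whose coefficients are the
  entries of the components, so each component has a zero block too.\<close>

lemma A_alg_y_iff:
  "P \<in> A_alg_y lam \<longleftrightarrow> P \<in> ytensor zops \<and> (\<forall>m. m \<notin> Jset lam \<longrightarrow> fls_nth (P (Psi lam)) m = 0)"
proof
  assume P: "P \<in> A_alg_y lam"
  then have Pz: "P \<in> ytensor zops" using A_alg_y_zops by blast
  obtain n Q where Q: "P = (\<lambda>F. \<Sum>k\<le>n. fls_const (var_y ^ k) * Q k F)" "\<forall>k\<le>n. Q k \<in> A_alg lam"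
    using P unfolding A_alg_y_ytensor ytensor_def by blast
  have block: "fls_nth (P (zpow j)) m = 0" if "j \<in> Jset lam" "m \<notin> Jset lam" for j m
  proof -
    have "zpow j \<in> W lam" using that(1) by (auto simp: W_iff laurent_zpow)
    then have "fls_nth (Q k (zpow j)) m = 0" if "k \<le> n" for k
      using Q(2) that \<open>m \<notin> Jset lam\<close> by (metis A_alg_iff W_iff)
    then show ?thesis by (simp add: Q(1) fls_nth_sum)
  qed
  obtain B where B: "\<And>m k. fls_nth (P (zpow k)) m \<in> range of_y"
    "\<And>F m. fls_nth (P F) m = (\<Sum>k\<in>{m - B..m + B}. fls_nth (P (zpow k)) m * fls_nth F k)"
    by (rule bandop_matrix[OF coeff_ring_of_y bandop_ytensor[OF Pz]]) (rule that)
  have "fls_nth (P (Psi lam)) m = 0" if "m \<notin> Jset lam" for m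
    unfolding B(2)[of "Psi lam" m]
  proof (rule sum.neutral, rule ballI)
    fix k
    show "fls_nth (P (zpow k)) m * fls_nth (Psi lam) k = 0"
      using block[of k m] Psi_off_J[of k] that by (cases "k \<in> Jset lam") auto
  qed
  then show "P \<in> ytensor zops \<and> (\<forall>m. m \<notin> Jset lam \<longrightarrow> fls_nth (P (Psi lam)) m = 0)" using Pz by blast
next
  assume P: "P \<in> ytensor zops \<and> (\<forall>m. m \<notin> Jset lam \<longrightarrow> fls_nth (P (Psi lam)) m = 0)"
  then obtain n Q where Q: "P = (\<lambda>F. \<Sum>k\<le>n. fls_const (var_y ^ k) * Q k F)" "\<forall>k\<le>n. Q k \<in> zops"
    unfolding ytensor_def by blast
  have "Q k \<in> A_alg lam" if k: "k \<le> n" for k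
  proof (rule A_alg_base)
    show "Q k \<in> zops" using Q(2) k by blast
    fix j m assume jm: "j \<in> Jset lam" "m \<notin> Jset lam"
    have "\<exists>c. fls_nth (Q i (zpow j)) m = of_C c" if "i \<le> n" for i
    proof -
      have "Q i \<in> zops" using Q(2) that by blast
      then have "Q i (zpow j) \<in> laurent_polys" by (rule zops_laurent) (rule laurent_zpow)
      then have "fls_nth (Q i (zpow j)) m \<in> range of_C"
        by (rule subsetD[OF conjunct2[OF laurent_finite_support]]) (rule rangeI)
      then show ?thesis by (rule rangeE) (rule exI)
    qed
    then obtain c where c: "\<And>i. i \<le> n \<Longrightarrow> fls_nth (Q i (zpow j)) m = of_C (c i)" by metis
    have "0 = fls_nth (P (zpow j)) m" using Psi_block[of P m j] P jm by simp
    also have "\<dots> = (\<Sum>i\<le>n. var_y ^ i * of_C (c i))"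
      unfolding Q(1) fls_nth_sum by (rule sum.cong[OF refl]) (simp add: c)
    also have "\<dots> = of_y (\<Sum>i\<le>n. monom (c i) i)"
    proof -
      have "var_y ^ i * of_C (c i) = of_y (monom (c i) i)" for i
      proof -
        have "monom (c i) i = monom 1 i * [:c i:]" by (simp add: mult.commute[of "monom 1 i"] smult_monom)
        then show ?thesis by (simp only: of_y_simps var_y_power of_C_def)
      qed
      then show ?thesis by (simp add: of_y_sum)
    qed
    finally have "(\<Sum>i\<le>n. monom (c i) i) = 0" by simp
    then have "coeff (\<Sum>i\<le>n. monom (c i) i) k = 0" by simp
    then have "c k = 0" using k by (simp add: coeff_sum if_distrib sum.delta cong: if_cong)
    then show "fls_nth (Q k (zpow j)) m = 0" using c[OF k] of_C_closed(1) by simp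
  qed
  then show "P \<in> A_alg_y lam" unfolding A_alg_y_ytensor ytensor_def using Q(1) by blast
qed

text \<open>If \<open>Psi\<close> is annihilated then so is \<open>z^j\<close> for every
  \<open>j\<close> in \<open>Jset lam\<close>, in particular for all large \<open>j\<close>.\<close>

lemma A_alg_y_injective:
  assumes "P \<in> A_alg_y lam" "P (Psi lam) = 0"
  shows "P = (\<lambda>F. 0)"
proof -
  have P: "P \<in> ytensor zops" using assms(1) A_alg_y_zops by blast
  then obtain p where p: "P = dop fls_deriv p" by (rule ytensor_zops_dop)
  \<comment> \<open>Beyond this bound \<open>n + l\<close> exceeds every element of
    \<open>kl\<close>, so \<open>int n \<in> Jset lam\<close>.\<close>
  define n0 where "n0 = Suc (Max (insert 0 (set kl)))"
  have "dop fls_deriv p (zpow (int n)) = 0" if n: "n \<ge> n0" for n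
  proof -
    have "n + l \<notin> set kl"
    proof
      assume "n + l \<in> set kl"
      then have "n + l \<le> Max (insert 0 (set kl))" by (intro Max_ge) auto
      then show False using n by (simp add: n0_def)
    qed
    then have "int n \<in> Jset lam" unfolding Jset_iff by (intro exI[of _ "n + l"]) simp
    then have "fls_nth (P (zpow (int n))) m = 0" for m using Psi_block[OF P] assms(2) by simp
    then show ?thesis unfolding p by (intro fls_eqI) simp
  qed
  then have "p = 0" by (rule dop_fls_deriv_eq_0)
  then show ?thesis by (simp add: p fun_eq_iff)
qed

text \<open>An operator annihilating \<open>Psi\<close> annihilates the images of all Hermite
  polynomials under \<open>T\<close>, so its product with \<open>T\<close> is 0; as \<open>T\<close>
  is monic, the operator itself is 0.\<close>

lemma cw_Psi_inject:
  assumes "cw s (Psi lam) = cw s' (Psi lam)"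
  shows "s = s'"
proof -
  define d where "d = s - s'"
  have z: "cw d (Psi lam) = 0" using assms by (simp add: d_def cw_op_diff)
  have "dop dx (dx.dmul d t) (to_fract f) = 0" for f
  proof (induction f rule: poly_hermite_induct)
    case (hermite n)
    have "fls_nth (cw d (Psi lam)) (int n - int l) = 0" by (simp add: z)
    then have "dop dx d (dop dx t (exp_series $ n)) = 0" by (simp add: Psi_nth)
    then show ?case
      unfolding hermite_hpoly[symmetric] hermite_exp_series dx.dop_dmul
      by (simp add: dx.dop_arg_const_mult)
  next
    case (scale c f)
    have "to_fract (smult c f) = of_y c * to_fract f"
      by (simp add: of_y_to_fract flip: to_fract_mult)
    then show ?case using scale by (simp add: dx.dop_arg_const_mult)
  qed (simp_all add: dx.dop_arg_add)
  then have "dx.dmul d t = 0" by (rule dop_eq_0I)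
  then have "lead_coeff d * coeff t l = 0" using dx.coeff_dmul_top[of t l d] degree_t by simp
  then have "d = 0" using coeff_t by simp
  then show ?thesis by (simp add: d_def)
qed

section \<open>From operators in z to operators in x\<close>

lemma commute_Psi:
  assumes "P \<in> ytensor zops"
  shows "P (Psi lam) = cw t (P (zpow (- int l) * exp_ls))"
proof -
  have "P (Psi lam) = P (cw t (zpow (- int l) * exp_ls))" by (simp add: Psi_cw cw_zpow)
  also have "\<dots> = cw t (P (zpow (- int l) * exp_ls))"
    by (rule bandop_cw_commute[OF bandop_ytensor[OF assms]])
  finally show ?thesis .
qed

lemma dop_t_shift: "dop dx (t * monom 1 M) f = dop dx t ((dx ^^ M) f)"
  by (subst dx.dop_mult_const_coeffs) (auto simp: dop_monom)

lemma cw_t_exp: "cw (t * monom 1 M) exp_ls = zpow (int (l + M)) * Psi lam"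
  by (simp add: cw_shift_exp_power Psi_cw zpow_mult flip: mult.assoc)

lemma funpow_dx_exp: "(dx ^^ M) (exp_series $ (k + M)) = exp_series $ k"
proof (induction M)
  case (Suc M)
  then show ?case by (simp add: dx_exp_series funpow_swap1 del: funpow.simps) (simp add: funpow_Suc_right dx_exp_series del: funpow.simps)
qed simp

text \<open>The divisor \<open>q\<close> is \<open>T\<close> after the \<open>M\<close>-th
  derivative. Dividend and divisor both annihilate the Hermite polynomials of degree below
  \<open>M\<close> and of degree \<open>k + M\<close> with \<open>k\<close> in \<open>kl\<close>,
  hence so does the remainder; those are \<open>l + M\<close> degrees, more than its order.\<close>

lemma flat_exists:
  assumes "P \<in> A_alg_y lam"
  shows "\<exists>s. P (Psi lam) = cw s (Psi lam)"
proof -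
  have P: "P \<in> ytensor zops" and off: "\<And>m. m \<notin> Jset lam \<Longrightarrow> fls_nth (P (Psi lam)) m = 0"
    using assms A_alg_y_iff by blast+
  obtain n p where p: "zpow (int n) * P (zpow (- int l) * exp_ls) = cw p exp_ls"
    using xform_ytensor[OF P xform_zpow[OF xform_exp]] unfolding xform_def by blast
  \<comment> \<open>\<open>Suc\<close> keeps the order \<open>l + M\<close> of the divisor positive,
    as the division requires, even for the empty partition.\<close>
  define M where "M = Suc n"
  obtain p' where p': "zpow (int (l + M)) * P (zpow (- int l) * exp_ls) = cw p' exp_ls"
    using xform_raise[OF p, of "l + M"] by (auto simp: M_def)
  define q where "q = t * monom 1 M"
  have qM: "degree q = l + M" "coeff q (l + M) = 1"
  proof -
    have "q = monom 1 M * t" by (simp add: q_def mult.commute)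
    moreover have "t \<noteq> 0" using coeff_t by auto
    ultimately show "degree q = l + M" "coeff q (l + M) = 1"
      using coeff_t degree_t by (simp_all add: degree_mult_eq degree_monom_eq coeff_monom_mult)
  qed
  obtain s r where sr: "degree r < l + M"
    "\<And>f. dop dx (dx.dmul t p') f = dop dx s (dop dx q f) + dop dx r f"
    using dx.right_division[OF qM, of "dx.dmul t p'"] by (auto simp: M_def)
  have P_nth: "zpow (int (l + M)) * P (Psi lam) = cw (dx.dmul t p') exp_ls"
    unfolding commute_Psi[OF P] cw_dmul p'[symmetric] cw_zpow ..
  have kill: "dop dx r (exp_series $ n) = 0" if n: "n < M \<or> (\<exists>k\<in>set kl. n = k + M)" for n
  proof -
    \<comment> \<open>The factor \<open>zpow (int (l + M))\<close> shifts the exponents by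
      \<open>l + M\<close>, so these \<open>n\<close> correspond to exponents that the image of
      \<open>Psi\<close> omits.\<close>
    have "int n - int (l + M) \<notin> Jset lam" using n unfolding Jset_iff by auto
    then have "fls_nth (cw (dx.dmul t p') exp_ls) (int n) = 0"
      unfolding P_nth[symmetric] by (simp add: off)
    then have 1: "dop dx (dx.dmul t p') (exp_series $ n) = 0" by (simp add: exp_ls_nth)
    have 2: "dop dx q (exp_series $ n) = 0"
      using n
    proof
      assume "n < M"
      then have "(pderiv ^^ M) (hpoly n) = 0"
        by (intro poly_eqI) (simp add: coeff_funpow_pderiv coeff_eq_0)
      then have "(dx ^^ M) (exp_series $ n) = 0"
        by (simp add: exp_series_hermite hermite_hpoly dx.funpow_const_mult funpow_dx_to_fract)
      then show ?thesis by (simp add: q_def dop_t_shift)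
    next
      assume "\<exists>k\<in>set kl. n = k + M"
      then obtain k where "k \<in> set kl" "n = k + M" by blast
      then show ?thesis by (simp add: q_def dop_t_shift funpow_dx_exp dop_t_exp dop_t_kernel)
    qed
    show ?thesis using sr(2)[of "exp_series $ n"] 1 2 by simp
  qed
  define A where "A = {..<M} \<union> (\<lambda>k. k + M) ` set kl"
  have "card A = M + l" unfolding A_def
    by (subst card_Un_disjoint) (auto simp: card_image card_ks)
  then have "r = 0"
  proof (intro dx_operator_few_zeros[of r A])
    fix n assume "n \<in> A"
    then have "dop dx r (exp_series $ n) = 0" by (intro kill) (auto simp: A_def)
    then have "dop dx r (hermite n) = 0"
      unfolding hermite_exp_series by (simp add: dx.dop_arg_const_mult)
    then show "\<exists>f. degree f = n \<and> f \<noteq> 0 \<and> dop dx r (to_fract f) = 0"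
      by (intro exI[of _ "hpoly n"]) (simp add: hermite_hpoly)
  qed (use sr in simp)
  then have "cw (dx.dmul t p') exp_ls = cw s (cw q exp_ls)"
    by (intro fls_eqI) (simp add: sr(2))
  then have "zpow (int (l + M)) * P (Psi lam) = zpow (int (l + M)) * cw s (Psi lam)"
    by (simp only: P_nth q_def cw_t_exp cw_zpow)
  then have "P (Psi lam) = cw s (Psi lam)" by simp
  then show ?thesis by blast
qed

text \<open>Up to a nonzero constant the image of R_m is coefficient \<open>m\<close> of
  \<open>P (Psi lam)\<close>, a finite combination over \<open>\<complex>[y]\<close> of coefficients
  of \<open>Psi\<close>.\<close>

lemma flat_preserves_Wstar:
  assumes P: "P \<in> A_alg_y lam" and s: "P (Psi lam) = cw s (Psi lam)" and g: "g \<in> Wstar lam"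
  shows "dop dx s g \<in> Wstar lam"
proof -
  have Pz: "P \<in> ytensor zops" using P A_alg_y_zops by blast
  obtain c where c: "\<And>m. m \<in> Jset lam \<Longrightarrow> c m \<noteq> 0 \<and> fls_nth (Psi lam) m = of_C (c m) * Rfun lam m"
    by (rule Psi_Rfun) (rule that)
  obtain B where B: "\<And>m k. fls_nth (P (zpow k)) m \<in> range of_y"
    "\<And>F m. fls_nth (P F) m = (\<Sum>k\<in>{m - B..m + B}. fls_nth (P (zpow k)) m * fls_nth F k)"
    by (rule bandop_matrix[OF coeff_ring_of_y bandop_ytensor[OF Pz]]) (rule that)
  have base: "dop dx s (Rfun lam m) \<in> Wstar lam" if m: "m \<in> Jset lam" for m
  proof -
    have "fls_nth (P (Psi lam)) m \<in> Wstar lam"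
      unfolding B(2)[of "Psi lam" m]
    proof (rule Wstar_sum)
      fix k
      obtain a where "fls_nth (P (zpow k)) m = of_y a" using B(1) by blast
      then show "fls_nth (P (zpow k)) m * fls_nth (Psi lam) k \<in> Wstar lam"
        using Wstar_of_y[OF Psi_in_Wstar] by simp
    qed
    then have "of_C (c m) * dop dx s (Rfun lam m) \<in> Wstar lam"
      using c[OF m] by (simp add: s dx.dop_arg_const_mult)
    then have "of_C (1 / c m) * (of_C (c m) * dop dx s (Rfun lam m)) \<in> Wstar lam"
      unfolding of_C_def by (rule Wstar_of_y)
    moreover have "of_C (1 / c m) * of_C (c m) = 1"
      using c[OF m] by (simp flip: of_C_simps(2)) (simp add: of_C_simps)
    ultimately show ?thesis by (simp flip: mult.assoc)
  qed
  show ?thesis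
    using g unfolding Wstar_def
  proof (induction rule: yM.span_induct_alt)
    case base
    then show ?case by (simp add: yM.span_zero)
  next
    case (step a x y)
    then have "of_y a * dop dx s x \<in> Wstar lam" using Wstar_of_y base by blast
    then show ?case using step(2) unfolding Wstar_def
      by (simp add: dx.dop_arg_add dx.dop_arg_const_mult yM.span_add)
  qed
qed

section \<open>From operators in x back to operators in z\<close>

lemma flat_surjective:
  assumes inv: "\<And>g. g \<in> Wstar lam \<Longrightarrow> dop dx s g \<in> Wstar lam"
  obtains P where "P \<in> A_alg_y lam" "P (Psi lam) = cw s (Psi lam)"
proof -
  \<comment> \<open>The operator \<open>\<tau> \<sigma> T\<close>; invariance of
    \<open>Wstar lam\<close> makes it map polynomials to polynomials, hence its coefficients are
    polynomials.\<close>
  define p where "p = smult (to_fract tau) (dx.dmul s t)"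
  have dp: "dop dx p f = to_fract tau * dop dx s (dop dx t f)" for f
    by (simp add: p_def dop_smult dx.dop_dmul)
  have "dop dx p (to_fract f) \<in> range to_fract" for f
  proof -
    obtain h where "to_fract tau * dop dx s (dop dx t (to_fract f)) = to_fract h"
      by (rule Wstar_gaps[OF inv[OF dop_t_in_Wstar]]) blast
    then show ?thesis by (simp add: dp)
  qed
  then obtain a where a: "p = map_poly to_fract a" by (rule dop_to_fract_coeffs)
  obtain M r s' where div: "lowx N s'"
    "\<And>f. dop pderiv a ((pderiv ^^ M) f) = dop pderiv b (dop pderiv r f) + dop pderiv s' f"
    using left_division[of a] by blast
  have tb: "to_fract (dop pderiv b f) = to_fract tau * dop dx t (to_fract f)" for f
    by (simp add: dop_t)
  have s'_eq: "to_fract (dop pderiv s' f) = to_fract tau *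
      (dop dx s (dop dx t (to_fract ((pderiv ^^ M) f))) - dop dx t (to_fract (dop pderiv r f)))" for f
  proof -
    have "to_fract (dop pderiv s' f) = to_fract (dop pderiv a ((pderiv ^^ M) f)) - to_fract (dop pderiv b (dop pderiv r f))"
      by (simp add: div(2))
    moreover have "to_fract (dop pderiv a ((pderiv ^^ M) f)) =
        to_fract tau * dop dx s (dop dx t (to_fract ((pderiv ^^ M) f)))"
      by (simp only: dop_to_fract[symmetric] a[symmetric] dp)
    ultimately show ?thesis by (simp only: tb right_diff_distrib)
  qed
  have "s' = 0"
  \<comment> \<open>On each Hermite polynomial the remainder takes a value in \<open>tau\<close>
    times \<open>Wstar lam\<close>, where the degrees have the required gaps.\<close>
  proof (rule low_operator_zero[OF div(1)])
    fix n assume nz: "dop pderiv s' (hpoly n) \<noteq> 0"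
    have "dop dx s (dop dx t (to_fract ((pderiv ^^ M) (hpoly n)))) - dop dx t (to_fract (dop pderiv r (hpoly n))) \<in> Wstar lam"
      (is "?g \<in> _") by (intro Wstar_diff inv dop_t_in_Wstar)
    then obtain f where f: "to_fract tau * ?g = to_fract f"
      "f \<noteq> 0 \<Longrightarrow> \<exists>k. k \<notin> set kl \<and> int (degree f) = int N + int k - int l"
      by (rule Wstar_gaps) (rule that)
    have "dop pderiv s' (hpoly n) = f"
      using s'_eq[of "hpoly n"] unfolding f(1) by simp
    then show "\<exists>k. k \<notin> set kl \<and> int (degree (dop pderiv s' (hpoly n))) = int N + int k - int l"
      using nz f(2) by simp
  qed
  define r' where "r' = map_poly to_fract r"
  \<comment> \<open>With zero remainder, the division is an intertwining identity between
    \<open>s\<close> and the polynomial operator \<open>r'\<close>.\<close>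
  have "dx.dmul s (t * monom 1 M) = dx.dmul t r'"
  proof (rule dop_eqI)
    fix f
    have "to_fract tau * (dop dx s (dop dx t (to_fract ((pderiv ^^ M) f))) - dop dx t (to_fract (dop pderiv r f))) = 0"
      unfolding s'_eq[symmetric] using \<open>s' = 0\<close> by simp
    then have "dop dx s (dop dx t (to_fract ((pderiv ^^ M) f))) = dop dx t (to_fract (dop pderiv r f))" by simp
    then show "dop dx (dx.dmul s (t * monom 1 M)) (to_fract f) = dop dx (dx.dmul t r') (to_fract f)"
      by (simp add: dx.dop_dmul dop_t_shift funpow_dx_to_fract r'_def dop_to_fract)
  qed
  note ops = this
  obtain Q where Q: "Q \<in> ytensor zops" "cw r' exp_ls = Q exp_ls"
    unfolding r'_def using polynomial_operator_transfer[of r] by blast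
  \<comment> \<open>Multiplication by \<open>z^l\<close> turns \<open>Psi\<close> into
    \<open>T\<close> applied to the exponential, there \<open>Q\<close> acts as \<open>r'\<close>
    inserted after \<open>T\<close>, and the intertwining identity trades this for \<open>s\<close>
    and the factor \<open>z^(l + M)\<close>, which is removed again.\<close>
  define P where "P = (\<lambda>F. zpow (- int (l + M)) * Q (zpow (int l) * F))"
  have P: "P \<in> ytensor zops"
  proof -
    have "(\<lambda>F. Q (zpow (int l) * F)) \<in> ytensor zops"
      using zops.ytensor_comp[OF Q(1) zops.ytensor_base[OF zops_zpow]] .
    then show ?thesis unfolding P_def
      using zops.ytensor_comp[OF zops.ytensor_base[OF zops_zpow[of "- int (l + M)"]]] by blast
  qed
  have "zpow (int l) * Psi lam = cw t exp_ls" by (simp add: Psi_cw zpow_mult flip: mult.assoc)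
  then have "P (Psi lam) = zpow (- int (l + M)) * Q (cw t exp_ls)" by (simp add: P_def)
  also have "Q (cw t exp_ls) = cw t (cw r' exp_ls)"
    unfolding Q(2) by (rule bandop_cw_commute[OF bandop_ytensor[OF Q(1)]])
  also have "\<dots> = cw s (zpow (int (l + M)) * Psi lam)"
    unfolding cw_t_exp[symmetric] cw_dmul[symmetric] ops ..
  also have "zpow (- int (l + M)) * \<dots> = cw s (Psi lam)"
    by (simp add: cw_zpow zpow_mult flip: mult.assoc)
  finally have e: "P (Psi lam) = cw s (Psi lam)" .
  \<comment> \<open>Operators in x act coefficientwise and create no new exponents, so the criterion
    on \<open>Psi\<close> holds.\<close>
  have "P \<in> A_alg_y lam" unfolding A_alg_y_iff using P by (simp add: e Psi_off_J)
  then show ?thesis using e by (rule that)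
qed

end

section \<open>Assembling the anti-isomorphism\<close>

lemma Astar_alg_iff: "\<sigma> \<in> Astar_alg lam \<longleftrightarrow> (\<exists>s. \<sigma> = dop dx s \<and> (\<forall>g\<in>Wstar lam. dop dx s g \<in> Wstar lam))"
  using diff_ops_iff[of UNIV \<sigma> dx] by (auto simp: Astar_alg_def)

context partition
begin

interpretation A: op_family "A_alg lam"
  by (rule op_family_A_alg)

lemma op_algebra_A_alg_y: "op_algebra scale_C (A_alg_y lam)"
  unfolding op_algebra_def
proof (intro conjI allI ballI ring_op_ring)
  show "(\<lambda>_. 0) \<in> A_alg_y lam"
    unfolding A_alg_y_ytensor by (rule A.ytensor_base[OF A.zero])
  show "id \<in> A_alg_y lam"
    using A.ytensor_base[OF A.id] by (simp add: A_alg_y_ytensor id_def)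
  fix P assume P: "P \<in> A_alg_y lam"
  show sc: "(\<lambda>v. scale_C c (P v)) \<in> A_alg_y lam" for c
    using A.ytensor_scale[of P "[:c:]"] P by (simp add: A_alg_y_ytensor scale_C_def of_C_def)
  have "scale_C (- 1) v = - v" for v by simp
  then show "(\<lambda>v. - P v) \<in> A_alg_y lam" using sc[of "- 1"] by simp
  show "P (v + w) = P v + P w" for v w
    using A.ytensor_lin(1) P by (simp add: A_alg_y_ytensor)
  fix Q assume Q: "Q \<in> A_alg_y lam"
  show "(\<lambda>v. P v + Q v) \<in> A_alg_y lam" using A.ytensor_add P Q by (simp add: A_alg_y_ytensor)
  show "P \<circ> Q \<in> A_alg_y lam" using A.ytensor_comp P Q by (simp add: A_alg_y_ytensor comp_def)
qed

lemma op_algebra_Astar_alg: "op_algebra (\<lambda>c g. of_C c * g) (Astar_alg lam)"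
  unfolding op_algebra_def
proof (intro conjI allI ballI ring_op_ring)
  show "(\<lambda>_. 0) \<in> Astar_alg lam" unfolding Astar_alg_iff
    by (intro exI[of _ 0]) (auto simp: fun_eq_iff)
  show "id \<in> Astar_alg lam" unfolding Astar_alg_iff
    by (intro exI[of _ 1]) (auto simp: fun_eq_iff)
  fix P assume "P \<in> Astar_alg lam"
  then obtain p where p: "P = dop dx p" "\<forall>g\<in>Wstar lam. dop dx p g \<in> Wstar lam"
    unfolding Astar_alg_iff by blast
  show "(\<lambda>v. of_C c * P v) \<in> Astar_alg lam" for c unfolding Astar_alg_iff
    by (intro exI[of _ "smult (of_C c) p"]) (auto simp: fun_eq_iff dop_smult p of_C_def Wstar_of_y)
  show "(\<lambda>v. - P v) \<in> Astar_alg lam" unfolding Astar_alg_iff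
  proof (intro exI[of _ "- p"] conjI ballI)
    fix g assume "g \<in> Wstar lam"
    then have "0 - dop dx p g \<in> Wstar lam" using p(2) by (intro Wstar_diff) auto
    then show "dop dx (- p) g \<in> Wstar lam" by (simp add: dop_minus)
  qed (simp add: fun_eq_iff dop_minus p)
  show "P (v + w) = P v + P w" for v w by (simp add: p dx.dop_arg_add)
  fix Q assume "Q \<in> Astar_alg lam"
  then obtain q where q: "Q = dop dx q" "\<forall>g\<in>Wstar lam. dop dx q g \<in> Wstar lam"
    unfolding Astar_alg_iff by blast
  show "(\<lambda>v. P v + Q v) \<in> Astar_alg lam" unfolding Astar_alg_iff
    by (intro exI[of _ "p + q"]) (auto simp: fun_eq_iff dop_add p q Wstar_add)
  show "P \<circ> Q \<in> Astar_alg lam" unfolding Astar_alg_iff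
    by (intro exI[of _ "dx.dmul p q"]) (auto simp: fun_eq_iff dx.dop_dmul p q)
qed

lemma ex1_flat:
  assumes "P \<in> A_alg_y lam"
  shows "\<exists>!\<sigma>. \<sigma> \<in> Astar_alg lam \<and> P (Psi lam) = coeffwise \<sigma> (Psi lam)"
proof (rule ex_ex1I)
  obtain s where s: "P (Psi lam) = cw s (Psi lam)" using flat_exists[OF assms] by blast
  then have "dop dx s \<in> Astar_alg lam"
    unfolding Astar_alg_iff using flat_preserves_Wstar[OF assms s] by blast
  then show "\<exists>\<sigma>. \<sigma> \<in> Astar_alg lam \<and> P (Psi lam) = coeffwise \<sigma> (Psi lam)"
    using s unfolding cw_def by blast
next
  fix \<sigma> \<sigma>'
  assume *: "\<sigma> \<in> Astar_alg lam \<and> P (Psi lam) = coeffwise \<sigma> (Psi lam)"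
    "\<sigma>' \<in> Astar_alg lam \<and> P (Psi lam) = coeffwise \<sigma>' (Psi lam)"
  then obtain s s' where s: "\<sigma> = dop dx s" "\<sigma>' = dop dx s'" unfolding Astar_alg_iff by blast
  then have "cw s (Psi lam) = cw s' (Psi lam)" using * unfolding cw_def by metis
  then have "s = s'" by (rule cw_Psi_inject)
  then show "\<sigma> = \<sigma>'" using s by simp
qed

lemma flat_eqI:
  assumes "P \<in> A_alg_y lam" "\<sigma> \<in> Astar_alg lam" "P (Psi lam) = coeffwise \<sigma> (Psi lam)"
  shows "flat lam P = \<sigma>"
  unfolding flat_def using ex1_flat[OF assms(1)] assms(2,3) by (intro the1_equality) auto

lemma flat_in_Astar_alg:
  assumes "P \<in> A_alg_y lam"
  shows "flat lam P \<in> Astar_alg lam" "P (Psi lam) = coeffwise (flat lam P) (Psi lam)"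
  using theI'[OF ex1_flat[OF assms]] unfolding flat_def by blast+

lemma flat_poly:
  assumes "P \<in> A_alg_y lam"
  obtains s where "flat lam P = dop dx s" "P (Psi lam) = cw s (Psi lam)"
  using flat_in_Astar_alg[OF assms] unfolding Astar_alg_iff cw_def by metis

lemma flat_add:
  assumes "P \<in> A_alg_y lam" "Q \<in> A_alg_y lam"
  shows "flat lam (\<lambda>F. P F + Q F) = (\<lambda>f. flat lam P f + flat lam Q f)"
proof (rule flat_eqI)
  show "(\<lambda>F. P F + Q F) \<in> A_alg_y lam" using A.ytensor_add assms by (simp add: A_alg_y_ytensor)
  show "(\<lambda>f. flat lam P f + flat lam Q f) \<in> Astar_alg lam"
    using ring.ring_simprules(1)[of "op_ring (Astar_alg lam)" "flat lam P" "flat lam Q"]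
      op_algebra_Astar_alg flat_in_Astar_alg(1)[OF assms(1)] flat_in_Astar_alg(1)[OF assms(2)]
    by (simp add: op_ring_def op_algebra_def)
  obtain p where p: "flat lam P = dop dx p" "P (Psi lam) = cw p (Psi lam)" by (rule flat_poly[OF assms(1)])
  obtain q where q: "flat lam Q = dop dx q" "Q (Psi lam) = cw q (Psi lam)" by (rule flat_poly[OF assms(2)])
  show "P (Psi lam) + Q (Psi lam) = coeffwise (\<lambda>f. flat lam P f + flat lam Q f) (Psi lam)"
    by (rule fls_eqI) (simp add: p q coeffwise_nth)
qed

text \<open>\<open>Q\<close> is first replaced by its counterpart in x, which then commutes with
  \<open>P\<close>; so \<open>P\<close> acts on \<open>Psi\<close> first and the order of the
  factors is reversed.\<close>

lemma flat_comp:
  assumes "P \<in> A_alg_y lam" "Q \<in> A_alg_y lam"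
  shows "flat lam (P \<circ> Q) = flat lam Q \<circ> flat lam P"
proof (rule flat_eqI)
  show "P \<circ> Q \<in> A_alg_y lam" using A.ytensor_comp assms by (simp add: A_alg_y_ytensor comp_def)
  show "flat lam Q \<circ> flat lam P \<in> Astar_alg lam"
    using ring.ring_simprules(5)[of "op_ring (Astar_alg lam)" "flat lam Q" "flat lam P"]
      op_algebra_Astar_alg flat_in_Astar_alg(1)[OF assms(1)] flat_in_Astar_alg(1)[OF assms(2)]
    by (simp add: op_ring_def op_algebra_def)
  obtain p where p: "flat lam P = dop dx p" "P (Psi lam) = cw p (Psi lam)" by (rule flat_poly[OF assms(1)])
  obtain q where q: "flat lam Q = dop dx q" "Q (Psi lam) = cw q (Psi lam)" by (rule flat_poly[OF assms(2)])
  have "P \<in> ytensor zops" using assms A_alg_y_zops by blast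
  then have "P (cw q (Psi lam)) = cw q (P (Psi lam))" by (intro bandop_cw_commute bandop_ytensor)
  then show "(P \<circ> Q) (Psi lam) = coeffwise (flat lam Q \<circ> flat lam P) (Psi lam)"
    by (intro fls_eqI) (simp add: p q coeffwise_nth)
qed

lemma flat_id: "flat lam id = id"
proof (rule flat_eqI)
  show "id \<in> A_alg_y lam" using A.ytensor_base[OF A.id] by (simp add: A_alg_y_ytensor id_def)
  show "id \<in> Astar_alg lam" unfolding Astar_alg_iff by (intro exI[of _ 1]) (auto simp: fun_eq_iff)
  show "id (Psi lam) = coeffwise id (Psi lam)" by (rule fls_eqI) (simp add: coeffwise_nth)
qed

lemma flat_scale:
  assumes "P \<in> A_alg_y lam"
  shows "flat lam (\<lambda>F. scale_C c (P F)) = (\<lambda>f. of_C c * flat lam P f)"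
proof (rule flat_eqI)
  show "(\<lambda>F. scale_C c (P F)) \<in> A_alg_y lam"
    using op_algebra_A_alg_y assms by (simp add: op_algebra_def)
  show "(\<lambda>f. of_C c * flat lam P f) \<in> Astar_alg lam"
    using op_algebra_Astar_alg flat_in_Astar_alg(1)[OF assms] by (simp add: op_algebra_def)
  obtain p where p: "flat lam P = dop dx p" "P (Psi lam) = cw p (Psi lam)" by (rule flat_poly[OF assms])
  show "scale_C c (P (Psi lam)) = coeffwise (\<lambda>f. of_C c * flat lam P f) (Psi lam)"
    by (rule fls_eqI) (simp add: p scale_C_def coeffwise_nth)
qed

lemma flat_bij: "bij_betw (flat lam) (A_alg_y lam) (Astar_alg lam)"
proof (rule bij_betw_imageI)
  show "inj_on (flat lam) (A_alg_y lam)"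
  proof (rule inj_onI)
    fix P Q assume P: "P \<in> A_alg_y lam" and Q: "Q \<in> A_alg_y lam" and eq: "flat lam P = flat lam Q"
    define D where "D F = P F + scale_C (- 1) (Q F)" for F
    have "(\<lambda>F. scale_C (- 1) (Q F)) \<in> A_alg_y lam"
      using op_algebra_A_alg_y Q unfolding op_algebra_def by blast
    then have "D \<in> A_alg_y lam"
      using A.ytensor_add[of P "\<lambda>F. scale_C (- 1) (Q F)"] P by (simp add: A_alg_y_ytensor D_def[abs_def])
    have D: "D F = P F - Q F" for F
      by (simp add: D_def)
    have "P (Psi lam) = Q (Psi lam)" using flat_in_Astar_alg(2)[OF P] flat_in_Astar_alg(2)[OF Q] eq by metis
    then have "D = (\<lambda>F. 0)" using \<open>D \<in> A_alg_y lam\<close> by (intro A_alg_y_injective) (simp_all add: D)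
    then have "P F - Q F = 0" for F using D by metis
    then show "P = Q" by (simp add: fun_eq_iff)
  qed
  show "flat lam ` A_alg_y lam = Astar_alg lam"
  proof (intro equalityI subsetI)
    show "\<sigma> \<in> Astar_alg lam" if "\<sigma> \<in> flat lam ` A_alg_y lam" for \<sigma>
      using that flat_in_Astar_alg(1) by blast
    fix \<sigma> assume \<sigma>: "\<sigma> \<in> Astar_alg lam"
    then obtain s where s: "\<sigma> = dop dx s" "\<forall>g\<in>Wstar lam. dop dx s g \<in> Wstar lam"
      unfolding Astar_alg_iff by blast
    obtain P where P: "P \<in> A_alg_y lam" "P (Psi lam) = cw s (Psi lam)"
      by (rule flat_surjective[of s]) (use s(2) that in blast)+
    then have "flat lam P = \<sigma>" using \<sigma> s(1) by (intro flat_eqI) (simp_all add: cw_def)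
    then show "\<sigma> \<in> flat lam ` A_alg_y lam" using P(1) by blast
  qed
qed

lemma flat_anti_iso:
  "algebra_anti_iso scale_C (\<lambda>c g. of_C c * g) (A_alg_y lam) (Astar_alg lam) (flat lam)"
  unfolding algebra_anti_iso_def
proof (intro conjI allI ballI)
  have "flat lam \<in> Ring.ring_hom (op_ring (A_alg_y lam)) (opposite (op_ring (Astar_alg lam)))"
    by (rule ring_hom_memI)
       (simp_all add: op_ring_def opposite_def flat_in_Astar_alg flat_add flat_comp flat_id)
  then show "flat lam \<in> ring_iso (op_ring (A_alg_y lam)) (opposite (op_ring (Astar_alg lam)))"
    using flat_bij by (simp add: ring_iso_def op_ring_def opposite_def)
qed (simp_all add: op_algebra_A_alg_y op_algebra_Astar_alg flat_scale)

end

theorem theorem5p6: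
  fixes lam :: "nat \<Rightarrow> nat"
  assumes "is_partition lam"
  shows "(\<forall>\<pi>\<in>A_alg_y lam. \<exists>!\<sigma>. \<sigma> \<in> Astar_alg lam \<and> \<pi> (Psi lam) = coeffwise \<sigma> (Psi lam)) \<and>
    algebra_anti_iso scale_C (\<lambda>c g. of_C c * g) (A_alg_y lam) (Astar_alg lam) (flat lam)"
proof -
  interpret partition lam by unfold_locales fact
  show ?thesis using ex1_flat flat_anti_iso by blast
qed

end
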